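(* Let the ground field be $\mathbb{C}$, and let $V_n$ be the vector products $n$-Lie algebra, with its basic Lie algebra $L(V_n)=\wedge^{n-1}V_n$ identified with $so_{n+1}$ as in the context. (i) For every $n\ge 2$, every finite-dimensional $n$-Lie module over $V_n$ is completely reducible. (ii) Let $t,r$ be nonnegative integers and let $M_{t,r}$ be the irreducible $so_4$-module with highest weight $(t,r)$, i.e. $M_{t,r}=M_t\otimes M_r$ as a module over $so_4\cong sl_2\oplus sl_2$. Then $M_{t,r}$ can be prolonged to a $3$-Lie module over $V_3$ if and only if $t=r$. (iii) Let $n>3$ and let $M$ be a finite-dimensional irreducible module over the Lie algebra $so_{n+1}$ with highest weight $\alpha$. Then $M$ can be prolonged to an $n$-Lie module over $V_n$ if and only if $\alpha=t\pi_1$ for some nonnegative integer $t$.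
   Context: **$n$-Lie algebras.** An $n$-Lie algebra is a vector space $A$ with a skew-symmetric multilinear map $\omega=[\cdot,\ldots,\cdot]:\wedge^nA\to A$ satisfying, for all $a_1,\ldots,a_{2n-1}\in A$, $$[a_1,\ldots,a_{n-1},[a_n,\ldots,a_{2n-1}]]=\sum_{i=n}^{2n-1}[a_n,\ldots,a_{i-1},[a_1,\ldots,a_{n-1},a_i],a_{i+1},\ldots,a_{2n-1}].$$ **Basic Lie algebra.** $L(A)=\wedge^{n-1}A$ with bracket $$[a_1\wedge\cdots\wedge a_{n-1},\,b_1\wedge\cdots\wedge b_{n-1}]=\sum_{i=1}^{n-1}b_1\wedge\cdots\wedge b_{i-1}\wedge[a_1,\ldots,a_{n-1},b_i]\wedge b_{i+1}\wedge\cdots\wedge b_{n-1}.$$ **$n$-Lie modules.** An $n$-Lie module over $A$ is a vector space $M$ with a linear map $\rho:\wedge^{n-1}A\to \mathrm{End}\,M$ which is a representation of $L(A)$, i.e. $\rho([x,y])=\rho(x)\rho(y)-\rho(y)\rho(x)$, and which satisfies, for all $a_1,\ldots,a_{2n-2}\in A$, $$\rho([a_1,\ldots,a_n]\wedge a_{n+1}\wedge\cdots\wedge a_{2n-2})=\sum_{i=1}^n(-1)^{i+n}\rho(a_1\wedge\cdots\wedge\widehat{a_i}\wedge\cdots\wedge a_n)\,\rho(a_i\wedge a_{n+1}\wedge\cdots\wedge a_{2n-2}).\quad( * )$$ A module over the Lie algebra $L(A)$ *can be prolonged* to an $n$-Lie module over $A$ if its representation $\rho$ satisfies $( * )$. A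 submodule is a subspace invariant under all $\rho(x)$. A module is irreducible if its only submodules are $0$ and itself, and completely reducible if it is a direct sum of irreducible submodules. **Vector products $n$-Lie algebra.** $V_n$ is the $(n+1)$-dimensional complex $n$-Lie algebra with basis $e_1,\ldots,e_{n+1}$ and $[e_1,\ldots,\widehat{e_i},\ldots,e_{n+1}]=(-1)^ie_i$ for $i=1,\ldots,n+1$ (hats denote omission). **Identification $L(V_n)\cong so_{n+1}$.** $so_{n+1}$ has basis $e_{ij}$, $1\le i<j\le n+1$, realized as $e_{ij}=x_i\partial_j-x_j\partial_i$ acting on $\mathbb{C}[x_1,\ldots,x_{n+1}]$. The isomorphism of Lie algebras $L(V_n)\to so_{n+1}$ is $$e_1\wedge\cdots\widehat{e_i}\cdots\widehat{e_j}\cdots\wedge e_{n+1}\mapsto(-1)^{i+j+n+1}e_{ij},\quad i<j.$$ Via this isomorphism, $so_{n+1}$-modules are regarded as $L(V_n)$-modules. **Weights.** $\pi_1,\ldots,\pi_{[(n+1)/2]}$ are the fundamental weights of $so_{n+1}$ in the standard order, so that for $n>3$, $\pi_1$ is the highest weight of the standard $(n+1)$-dimensional representation. $M_t$ denotes the $(t+1)$-dimensional irreducible $sl_2$-module with highest weight $t$. $M_t\otimes M_r$ is the $sl_2\oplus sl_2$-module in which the first copy of $sl_2$ acts on $M_t$ and the second on $M_r$. *)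

theory Defs
  imports Complex_Main "HOL-Library.Function_Algebras" "HOL-Library.Poly_Mapping"
begin

(* Complex vector spaces are given by a scalar multiplication s on a type of class
   ab_group_add (locale vector_space); subspaces, spans, bases are those of that locale. *)

section \<open>Alternating maps and n-Lie algebras\<close>

(* k-ary maps are functions on lists; only their values on lists of length k matter. *)
definition alternating_map ::
  "(complex \<Rightarrow> 'a::ab_group_add \<Rightarrow> 'a) \<Rightarrow> (complex \<Rightarrow> 'b::ab_group_add \<Rightarrow> 'b) \<Rightarrow> nat \<Rightarrow> ('a list \<Rightarrow> 'b) \<Rightarrow> bool"
  where
  "alternating_map s1 s2 k f \<longleftrightarrow>
     (\<forall>xs i x y. length xs = k \<and> i < k \<longrightarrow> f (xs[i := x + y]) = f (xs[i := x]) + f (xs[i := y])) \<and>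
     (\<forall>xs i c x. length xs = k \<and> i < k \<longrightarrow> f (xs[i := s1 c x]) = s2 c (f (xs[i := x]))) \<and>
     (\<forall>xs. length xs = k \<and> \<not> distinct xs \<longrightarrow> f xs = 0)"

locale nlie_algebra = vector_space scale
  for scale :: "complex \<Rightarrow> 'a::ab_group_add \<Rightarrow> 'a" +
  fixes n :: nat and br :: "'a list \<Rightarrow> 'a"
  assumes br_alternating: "alternating_map scale scale n br"
    and br_Filippov:
      "\<And>as bs. length as = n - 1 \<Longrightarrow> length bs = n \<Longrightarrow>
         br (as @ [br bs]) = (\<Sum>i<n. br (bs[i := br (as @ [bs ! i])]))"

definition omit :: "nat \<Rightarrow> 'a list \<Rightarrow> 'a list" where
  "omit i xs = take i xs @ drop (Suc i) xs"

(* The vector products n-Lie algebra V_n, with its basis e_1, ..., e_{n+1}. *)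
locale vector_products_algebra = nlie_algebra scale n br
  for scale :: "complex \<Rightarrow> 'a::ab_group_add \<Rightarrow> 'a" and n br +
  fixes e :: "nat \<Rightarrow> 'a"
  assumes e_inj: "inj_on e {1..n+1}"
    and e_independent: "\<not> dependent (e ` {1..n+1})"
    and e_span: "span (e ` {1..n+1}) = UNIV"
    and br_basis: "\<And>i. i \<in> {1..n+1} \<Longrightarrow>
      br (map e (filter (\<lambda>k. k \<noteq> i) [1..<n+2])) = scale ((-1) ^ i) (e i)"


section \<open>The basic Lie algebra\<close>

(* The exterior power is realized inside the dual of the space of alternating forms:
   a_1 /\ ... /\ a_k is the functional "evaluate at (a_1, ..., a_k)" on alternating k-forms,
   extended by 0 to the functions that are not alternating k-forms. Over a field the span of
   these functionals is the k-th exterior power. *)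
definition fscale :: "complex \<Rightarrow> ('x \<Rightarrow> complex) \<Rightarrow> ('x \<Rightarrow> complex)" where
  "fscale c u = (\<lambda>x. c * u x)"

definition wedge ::
  "(complex \<Rightarrow> 'a::ab_group_add \<Rightarrow> 'a) \<Rightarrow> 'a list \<Rightarrow> (('a list \<Rightarrow> complex) \<Rightarrow> complex)" where
  "wedge s as = (\<lambda>f. if alternating_map s (*) (length as) f then f as else 0)"

definition ext_power ::
  "(complex \<Rightarrow> 'a::ab_group_add \<Rightarrow> 'a) \<Rightarrow> nat \<Rightarrow> (('a list \<Rightarrow> complex) \<Rightarrow> complex) set" where
  "ext_power s k = module.span fscale {wedge s as | as. length as = k}"

abbreviation basic_Lie where
  "basic_Lie s n \<equiv> ext_power s (n - 1)"

(* On decomposable elements this is the defining formula: see basic_bracket_wedge. *)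
definition basic_bracket ::
  "(complex \<Rightarrow> 'a::ab_group_add \<Rightarrow> 'a) \<Rightarrow> nat \<Rightarrow> ('a list \<Rightarrow> 'a) \<Rightarrow>
   (('a list \<Rightarrow> complex) \<Rightarrow> complex) \<Rightarrow> (('a list \<Rightarrow> complex) \<Rightarrow> complex) \<Rightarrow>
   (('a list \<Rightarrow> complex) \<Rightarrow> complex)" where
  "basic_bracket s n br x y = (\<lambda>f.
     if alternating_map s (*) (n - 1) f
     then x (\<lambda>as. y (\<lambda>bs. \<Sum>i<n - 1. f (bs[i := br (as @ [bs ! i])])))
     else 0)"


lemma sum_fun_apply: "(\<Sum>i\<in>A. g i) x = (\<Sum>i\<in>A. g i x)"
  by (induction A rule: infinite_finite_induct) auto

lemma alternating_mapD:
  assumes "alternating_map s1 s2 k f" and "length xs = k"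
  shows "i < k \<Longrightarrow> f (xs[i := x + y]) = f (xs[i := x]) + f (xs[i := y])"
    and "i < k \<Longrightarrow> f (xs[i := s1 c x]) = s2 c (f (xs[i := x]))"
    and "\<not> distinct xs \<Longrightarrow> f xs = 0"
  using assms unfolding alternating_map_def by blast+

lemma alternating_map_cong:
  assumes "\<And>xs. length xs = k \<Longrightarrow> f xs = g xs"
  shows "alternating_map s1 s2 k f \<longleftrightarrow> alternating_map s1 s2 k g"
proof -
  have "f (xs[i := x]) = g (xs[i := x])" if "length xs = k" for xs i x
    using assms that by simp
  then show ?thesis
    unfolding alternating_map_def using assms by (simp cong: conj_cong imp_cong)
qed

lemma alternating_form_swap:
  fixes f :: "'a::ab_group_add list \<Rightarrow> complex"
  assumes f: "alternating_map s (*) k f" and len: "length bs = k"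
    and pq: "p < k" "q < k" "p \<noteq> q"
  shows "f (bs[p := x, q := y]) + f (bs[p := y, q := x]) = 0"
proof -
  have nd: "f (bs[p := z, q := z]) = 0" for z
    by (rule alternating_mapD(3)[OF f]) (use len pq nth_eq_iff_index_eq[of "bs[p := z, q := z]" p q] in auto)
  have ex: "f (bs[p := u + v, q := w]) = f (bs[p := u, q := w]) + f (bs[p := v, q := w])" for u v w
    using alternating_mapD(1)[OF f, of "bs[q := w]" p u v] len pq
    by (simp add: list_update_swap)
  have "0 = f (bs[p := x + y, q := x + y])"
    using nd by simp
  also have "\<dots> = f (bs[p := x + y, q := x]) + f (bs[p := x + y, q := y])"
    using alternating_mapD(1)[OF f, of "bs[p := x + y]" q x y] len pq by simp
  also have "\<dots> = f (bs[p := y, q := x]) + f (bs[p := x, q := y])"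
    by (simp add: ex nd)
  finally show ?thesis by (simp add: add.commute)
qed

lemma alternating_form_derivation:
  fixes f :: "'a::ab_group_add list \<Rightarrow> complex"
  assumes f: "alternating_map s (*) k f"
    and D_add: "\<And>x y. D (x + y) = D x + D y" and D_scale: "\<And>c x. D (s c x) = s c (D x)"
  shows "alternating_map s (*) k (\<lambda>bs. \<Sum>i<k. f (bs[i := D (bs ! i)]))"
  unfolding alternating_map_def
proof (intro conjI allI impI)
  fix bs :: "'a list" and j x y
  assume a: "length bs = k \<and> j < k"
  have "f (bs[j := x + y, i := D (bs[j := x + y] ! i)]) =
        f (bs[j := x, i := D (bs[j := x] ! i)]) + f (bs[j := y, i := D (bs[j := y] ! i)])"
    if "i < k" for i
  proof (cases "i = j")
    case True
    then show ?thesis using a alternating_mapD(1)[OF f, of bs j] by (simp add: D_add)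
  next
    case False
    then show ?thesis
      using a alternating_mapD(1)[OF f, of "bs[i := D (bs ! i)]" j x y] by (simp add: list_update_swap)
  qed
  then show "(\<Sum>i<k. f (bs[j := x + y, i := D (bs[j := x + y] ! i)])) =
     (\<Sum>i<k. f (bs[j := x, i := D (bs[j := x] ! i)])) + (\<Sum>i<k. f (bs[j := y, i := D (bs[j := y] ! i)]))"
    by (simp add: sum.distrib)
next
  fix bs :: "'a list" and j c x
  assume a: "length bs = k \<and> j < k"
  have "f (bs[j := s c x, i := D (bs[j := s c x] ! i)]) = c * f (bs[j := x, i := D (bs[j := x] ! i)])"
    if "i < k" for i
  proof (cases "i = j")
    case True
    then show ?thesis using a alternating_mapD(2)[OF f, of bs j] by (simp add: D_scale)
  next
    case False
    then show ?thesis
      using a alternating_mapD(2)[OF f, of "bs[i := D (bs ! i)]" j c x] by (simp add: list_update_swap)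
  qed
  then show "(\<Sum>i<k. f (bs[j := s c x, i := D (bs[j := s c x] ! i)])) =
     c * (\<Sum>i<k. f (bs[j := x, i := D (bs[j := x] ! i)]))"
    by (simp add: sum_distrib_left)
next
  fix bs :: "'a list"
  assume a: "length bs = k \<and> \<not> distinct bs"
  then obtain p q where pq: "p < k" "q < k" "p \<noteq> q" "bs ! p = bs ! q"
    by (auto simp: distinct_conv_nth)
  let ?g = "\<lambda>i. f (bs[i := D (bs ! i)])"
  have z: "?g i = 0" if "i \<in> {..<k} - {p, q}" for i
    by (rule alternating_mapD(3)[OF f])
       (use a that pq nth_eq_iff_index_eq[of "bs[i := D (bs ! i)]" p q] in auto)
  have "sum ?g {..<k} = sum ?g {p, q}"
    by (rule sum.mono_neutral_right) (use pq z in auto)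
  also have "\<dots> = f (bs[p := D (bs ! p), q := bs ! p]) + f (bs[p := bs ! p, q := D (bs ! p)])"
  proof -
    have "bs[p := D (bs ! p), q := bs ! p] = bs[p := D (bs ! p)]"
      by (metis list_update_id list_update_swap pq(3,4))
    moreover have "bs[p := bs ! p, q := D (bs ! p)] = bs[q := D (bs ! q)]"
      by (metis list_update_id pq(4))
    ultimately show ?thesis using pq by (simp del: list_update_id)
  qed
  also have "\<dots> = 0"
    using a pq by (intro alternating_form_swap[OF f]) auto
  finally show "sum ?g {..<k} = 0" .
qed

lemma (in nlie_algebra) basic_bracket_wedge:
  assumes n: "1 \<le> n" and as: "length as = n - 1" and bs: "length bs = n - 1"
  shows "basic_bracket scale n br (wedge scale as) (wedge scale bs) =
    (\<Sum>i<n - 1. wedge scale (bs[i := br (as @ [bs ! i])]))"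
proof
  fix f :: "'a list \<Rightarrow> complex"
  let ?S = "\<lambda>as bs. \<Sum>i<n - 1. f (bs[i := br (as @ [bs ! i])])"
  show "basic_bracket scale n br (wedge scale as) (wedge scale bs) f =
    (\<Sum>i<n - 1. wedge scale (bs[i := br (as @ [bs ! i])])) f"
  proof (cases "alternating_map scale (*) (n - 1) f")
    case f: True
    have last: "(cs @ [u])[n - 1 := v] = cs @ [v]" if "length cs = n - 1" for cs :: "'a list" and u v
      using that by (metis list_update_length)
    have inner: "alternating_map scale (*) (n - 1) (?S cs)" if cs: "length cs = n - 1" for cs
    proof (rule alternating_form_derivation[OF f])
      have l: "length (cs @ [0]) = n" "n - 1 < n" using cs n by auto
      show "br (cs @ [x + y]) = br (cs @ [x]) + br (cs @ [y])" for x y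
        using alternating_mapD(1)[OF br_alternating l(1) l(2), of x y] by (simp only: last[OF cs])
      show "br (cs @ [scale c x]) = scale c (br (cs @ [x]))" for c x
        using alternating_mapD(2)[OF br_alternating l(1) l(2), of c x] by (simp only: last[OF cs])
    qed
    have f0: "f (bs[i := 0]) = 0" if "i < n - 1" for i
      using alternating_mapD(2)[OF f bs that, of 0 0] by simp
    have outer: "alternating_map scale (*) (n - 1) (\<lambda>as. ?S as bs)"
      unfolding alternating_map_def
    proof (intro conjI allI impI)
      fix cs :: "'a list" and j x y
      assume a: "length cs = n - 1 \<and> j < n - 1"
      then have jn: "j < n" "length cs + 1 = n" using n by linarith+
      have "br (cs[j := x + y] @ [u]) = br (cs[j := x] @ [u]) + br (cs[j := y] @ [u])" for u
        using alternating_mapD(1)[OF br_alternating, of "cs @ [u]" j x y] a jn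
        by (simp add: list_update_append)
      then show "?S (cs[j := x + y]) bs = ?S (cs[j := x]) bs + ?S (cs[j := y]) bs"
        by (simp add: alternating_mapD(1)[OF f bs] sum.distrib)
    next
      fix cs :: "'a list" and j c x
      assume a: "length cs = n - 1 \<and> j < n - 1"
      then have jn: "j < n" "length cs + 1 = n" using n by linarith+
      have "br (cs[j := scale c x] @ [u]) = scale c (br (cs[j := x] @ [u]))" for u
        using alternating_mapD(2)[OF br_alternating, of "cs @ [u]" j c x] a jn
        by (simp add: list_update_append)
      then show "?S (cs[j := scale c x]) bs = c * ?S (cs[j := x]) bs"
        by (simp add: alternating_mapD(2)[OF f bs] sum_distrib_left)
    next
      fix cs :: "'a list"
      assume a: "length cs = n - 1 \<and> \<not> distinct cs"
      have "br (cs @ [u]) = 0" for u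
        using a n by (intro alternating_mapD(3)[OF br_alternating]) auto
      then show "?S cs bs = 0" by (simp add: f0)
    qed
    have wb: "wedge scale bs (?S cs) = ?S cs bs" if "length cs = n - 1" for cs
      using inner[OF that] bs by (simp add: wedge_def)
    have "alternating_map scale (*) (n - 1) (\<lambda>cs. wedge scale bs (?S cs))"
      by (rule alternating_map_cong[THEN iffD1, OF _ outer]) (simp only: wb)
    then show ?thesis
      using f as bs wb[OF as] by (simp add: basic_bracket_def wedge_def sum_fun_apply del: One_nat_def)
  next
    case False
    then show ?thesis using bs by (simp add: basic_bracket_def wedge_def sum_fun_apply del: One_nat_def)
  qed
qed


section \<open>Modules\<close>

(* rho is an action of a Lie algebra with carrier L on the subspace M of the ambient space. *)
definition lie_module ::
  "(complex \<Rightarrow> 'l::ab_group_add \<Rightarrow> 'l) \<Rightarrow> 'l set \<Rightarrow> ('l \<Rightarrow> 'l \<Rightarrow> 'l) \<Rightarrow>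
   (complex \<Rightarrow> 'm::ab_group_add \<Rightarrow> 'm) \<Rightarrow> 'm set \<Rightarrow> ('l \<Rightarrow> 'm \<Rightarrow> 'm) \<Rightarrow> bool" where
  "lie_module sL L lb sM M \<rho> \<longleftrightarrow>
     module.subspace sM M \<and>
     (\<forall>x\<in>L. \<forall>u\<in>M. \<rho> x u \<in> M) \<and>
     (\<forall>x\<in>L. \<forall>u\<in>M. \<forall>w\<in>M. \<rho> x (u + w) = \<rho> x u + \<rho> x w) \<and>
     (\<forall>x\<in>L. \<forall>c. \<forall>u\<in>M. \<rho> x (sM c u) = sM c (\<rho> x u)) \<and>
     (\<forall>x\<in>L. \<forall>y\<in>L. \<forall>u\<in>M. \<rho> (x + y) u = \<rho> x u + \<rho> y u) \<and>
     (\<forall>x\<in>L. \<forall>c. \<forall>u\<in>M. \<rho> (sL c x) u = sM c (\<rho> x u)) \<and>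
     (\<forall>x\<in>L. \<forall>y\<in>L. \<forall>u\<in>M. \<rho> (lb x y) u = \<rho> x (\<rho> y u) - \<rho> y (\<rho> x u))"

(* The condition for an L(A)-module to be prolonged to an n-Lie module over A.
   List positions start at 0, so a_i is as ! (i - 1). *)
definition can_be_prolonged ::
  "(complex \<Rightarrow> 'a::ab_group_add \<Rightarrow> 'a) \<Rightarrow> nat \<Rightarrow> ('a list \<Rightarrow> 'a) \<Rightarrow>
   (complex \<Rightarrow> 'm::ab_group_add \<Rightarrow> 'm) \<Rightarrow> 'm set \<Rightarrow>
   ((('a list \<Rightarrow> complex) \<Rightarrow> complex) \<Rightarrow> 'm \<Rightarrow> 'm) \<Rightarrow> bool" where
  "can_be_prolonged sA n br sM M \<rho> \<longleftrightarrow>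
     (\<forall>as bs. length as = n \<longrightarrow> length bs = n - 2 \<longrightarrow> (\<forall>u\<in>M.
        \<rho> (wedge sA (br as # bs)) u =
        (\<Sum>i=1..n. sM ((-1) ^ (i + n))
           (\<rho> (wedge sA (omit (i - 1) as)) (\<rho> (wedge sA (as ! (i - 1) # bs)) u)))))"

definition nlie_module ::
  "(complex \<Rightarrow> 'a::ab_group_add \<Rightarrow> 'a) \<Rightarrow> nat \<Rightarrow> ('a list \<Rightarrow> 'a) \<Rightarrow>
   (complex \<Rightarrow> 'm::ab_group_add \<Rightarrow> 'm) \<Rightarrow> 'm set \<Rightarrow>
   ((('a list \<Rightarrow> complex) \<Rightarrow> complex) \<Rightarrow> 'm \<Rightarrow> 'm) \<Rightarrow> bool" where
  "nlie_module sA n br sM M \<rho> \<longleftrightarrow>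
     lie_module fscale (basic_Lie sA n) (basic_bracket sA n br) sM M \<rho> \<and>
     can_be_prolonged sA n br sM M \<rho>"

definition finite_dim :: "(complex \<Rightarrow> 'm::ab_group_add \<Rightarrow> 'm) \<Rightarrow> 'm set \<Rightarrow> bool" where
  "finite_dim sM M \<longleftrightarrow> (\<exists>B. finite B \<and> M = module.span sM B)"

definition submodule ::
  "(complex \<Rightarrow> 'm::ab_group_add \<Rightarrow> 'm) \<Rightarrow> 'l set \<Rightarrow> ('l \<Rightarrow> 'm \<Rightarrow> 'm) \<Rightarrow> 'm set \<Rightarrow> 'm set \<Rightarrow> bool" where
  "submodule sM L \<rho> M N \<longleftrightarrow>
     module.subspace sM N \<and> N \<subseteq> M \<and> (\<forall>x\<in>L. \<forall>u\<in>N. \<rho> x u \<in> N)"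

definition irreducible_module ::
  "(complex \<Rightarrow> 'm::ab_group_add \<Rightarrow> 'm) \<Rightarrow> 'l set \<Rightarrow> ('l \<Rightarrow> 'm \<Rightarrow> 'm) \<Rightarrow> 'm set \<Rightarrow> bool" where
  "irreducible_module sM L \<rho> M \<longleftrightarrow>
     M \<noteq> {0} \<and> (\<forall>N. submodule sM L \<rho> M N \<longrightarrow> N = {0} \<or> N = M)"

definition completely_reducible ::
  "(complex \<Rightarrow> 'm::ab_group_add \<Rightarrow> 'm) \<Rightarrow> 'l set \<Rightarrow> ('l \<Rightarrow> 'm \<Rightarrow> 'm) \<Rightarrow> 'm set \<Rightarrow> bool" where
  "completely_reducible sM L \<rho> M \<longleftrightarrow>
     (\<exists>F. (\<forall>N\<in>F. submodule sM L \<rho> M N \<and> irreducible_module sM L \<rho> N) \<and>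
          module.span sM (\<Union>F) = M \<and>
          (\<forall>N\<in>F. N \<inter> module.span sM (\<Union>(F - {N})) = {0}))"


section \<open>The Lie algebra so(N)\<close>

(* Polynomials in variables x_0, x_1, x_2, ...; an element m of nat =>0 nat is the exponent
   vector of a monomial. The operators in so_alg N involve only x_1, ..., x_N. *)
type_synonym cpoly = "(nat \<Rightarrow>\<^sub>0 nat) \<Rightarrow>\<^sub>0 complex"

definition var :: "nat \<Rightarrow> cpoly" where
  "var i = Poly_Mapping.single (Poly_Mapping.single i 1) 1"

definition pdiff :: "nat \<Rightarrow> cpoly \<Rightarrow> cpoly" where
  "pdiff j p = (\<Sum>m\<in>Poly_Mapping.keys p.
     Poly_Mapping.single (m - Poly_Mapping.single j 1)
       (of_nat (Poly_Mapping.lookup m j) * Poly_Mapping.lookup p m))"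

definition so_gen :: "nat \<Rightarrow> nat \<Rightarrow> cpoly \<Rightarrow> cpoly" where
  "so_gen i j = (\<lambda>p. var i * pdiff j p - var j * pdiff i p)"

definition oscale :: "complex \<Rightarrow> (cpoly \<Rightarrow> cpoly) \<Rightarrow> (cpoly \<Rightarrow> cpoly)" where
  "oscale c T = (\<lambda>p. Poly_Mapping.single 0 c * T p)"

definition so_alg :: "nat \<Rightarrow> (cpoly \<Rightarrow> cpoly) set" where
  "so_alg N = module.span oscale {so_gen i j | i j. 1 \<le> i \<and> i < j \<and> j \<le> N}"

definition commutator :: "(cpoly \<Rightarrow> cpoly) \<Rightarrow> (cpoly \<Rightarrow> cpoly) \<Rightarrow> (cpoly \<Rightarrow> cpoly)" where
  "commutator S T = (\<lambda>p. S (T p) - T (S p))"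

abbreviation so_module where
  "so_module N \<equiv> lie_module oscale (so_alg N) commutator"

(* e_1 /\ ... e_i omitted ... e_j omitted ... /\ e_{n+1} *)
definition wedge_omit2 ::
  "(complex \<Rightarrow> 'a::ab_group_add \<Rightarrow> 'a) \<Rightarrow> nat \<Rightarrow> (nat \<Rightarrow> 'a) \<Rightarrow> nat \<Rightarrow> nat \<Rightarrow>
   (('a list \<Rightarrow> complex) \<Rightarrow> complex)" where
  "wedge_omit2 s n e i j = wedge s (map e (filter (\<lambda>k. k \<noteq> i \<and> k \<noteq> j) [1..<n+2]))"

(* The isomorphism L(V_n) -> so(n+1): the linear map sending the basis vector
   wedge_omit2 s n e i j to (-1)^(i+j+n+1) e_ij. *)
definition vp_iso ::
  "(complex \<Rightarrow> 'a::ab_group_add \<Rightarrow> 'a) \<Rightarrow> nat \<Rightarrow> (nat \<Rightarrow> 'a) \<Rightarrow>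
   (('a list \<Rightarrow> complex) \<Rightarrow> complex) \<Rightarrow> (cpoly \<Rightarrow> cpoly)" where
  "vp_iso s n e x =
     (\<Sum>(i, j)\<in>{(i, j). 1 \<le> i \<and> i < j \<and> j \<le> n + 1}.
        oscale
          (module.representation fscale
             {wedge_omit2 s n e k l | k l. 1 \<le> k \<and> k < l \<and> l \<le> n + 1} x (wedge_omit2 s n e i j)
           * (-1) ^ (i + j + n + 1))
          (so_gen i j))"

abbreviation so_can_be_prolonged where
  "so_can_be_prolonged s n br e sM M \<rho> \<equiv>
     can_be_prolonged s n br sM M (\<lambda>x. \<rho> (vp_iso s n e x))"


section \<open>Weights\<close>

(* The Cartan subalgebra of so(N) has basis H_1, ..., H_{N div 2}; on the standard representation
   H_k has the eigenvector x_{2k-1} + i x_{2k} with eigenvalue 1 and x_{2k-1} - i x_{2k} with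
   eigenvalue -1. A weight is represented by its values on H_1, ..., H_{N div 2}, that is, by its
   coordinates with respect to epsilon_1, ..., epsilon_{N div 2}; other indices are irrelevant. *)
definition cartan_H :: "nat \<Rightarrow> cpoly \<Rightarrow> cpoly" where
  "cartan_H k = oscale (- \<i>) (so_gen (2 * k - 1) (2 * k))"

definition eps :: "nat \<Rightarrow> nat \<Rightarrow> complex" where
  "eps k = (\<lambda>j. if j = k then 1 else 0)"

definition positive_roots :: "nat \<Rightarrow> (nat \<Rightarrow> complex) set" where
  "positive_roots N =
     {eps k - eps l | k l. 1 \<le> k \<and> k < l \<and> l \<le> N div 2} \<union>
     {eps k + eps l | k l. 1 \<le> k \<and> k < l \<and> l \<le> N div 2} \<union>
     (if odd N then {eps k | k. 1 \<le> k \<and> k \<le> N div 2} else {})"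

definition root_space :: "nat \<Rightarrow> (nat \<Rightarrow> complex) \<Rightarrow> (cpoly \<Rightarrow> cpoly) set" where
  "root_space N \<beta> =
     {x \<in> so_alg N. \<forall>k\<in>{1..N div 2}. commutator (cartan_H k) x = oscale (\<beta> k) x}"

(* A nonzero weight vector of weight alpha killed by all positive root vectors; in an irreducible
   finite-dimensional module it is unique up to scalars, and alpha is the highest weight. *)
definition has_highest_weight ::
  "nat \<Rightarrow> (complex \<Rightarrow> 'm::ab_group_add \<Rightarrow> 'm) \<Rightarrow> 'm set \<Rightarrow> ((cpoly \<Rightarrow> cpoly) \<Rightarrow> 'm \<Rightarrow> 'm) \<Rightarrow>
   (nat \<Rightarrow> complex) \<Rightarrow> bool" where
  "has_highest_weight N sM M \<rho> \<alpha> \<longleftrightarrow>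
     (\<exists>v\<in>M. v \<noteq> 0 \<and>
        (\<forall>k\<in>{1..N div 2}. \<rho> (cartan_H k) v = sM (\<alpha> k) v) \<and>
        (\<forall>\<beta>\<in>positive_roots N. \<forall>x\<in>root_space N \<beta>. \<rho> x v = 0))"

(* Bourbaki numbering, types B_m (N = 2m+1) and D_m (N = 2m). For N = 4 the simple roots are
   eps 1 - eps 2 and eps 1 + eps 2, one for each copy of sl(2), and t pi_1 + r pi_2 takes the
   values t and r on their coroots H1 = H_1 - H_2 and H2 = H_1 + H_2 (defined below). *)
definition fundamental_weight :: "nat \<Rightarrow> nat \<Rightarrow> (nat \<Rightarrow> complex)" where
  "fundamental_weight N i = (let m = N div 2 in
     if odd N then
       (if i < m then (\<Sum>k=1..i. eps k) else fscale (1/2) (\<Sum>k=1..m. eps k))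
     else
       (if i + 1 < m then (\<Sum>k=1..i. eps k)
        else if i + 1 = m then fscale (1/2) ((\<Sum>k=1..m - 1. eps k) - eps m)
        else fscale (1/2) (\<Sum>k=1..m. eps k)))"


section \<open>The decomposition of so(4)\<close>

(* With z_k = x_{2k-1} + i x_{2k}, zb_k = x_{2k-1} - i x_{2k} as coordinates:
   E1 = z_1 d/dz_2 - zb_2 d/dzb_1,  F1 = z_2 d/dz_1 - zb_1 d/dzb_2,
   E2 = z_1 d/dzb_2 - z_2 d/dzb_1,  F2 = zb_2 d/dz_1 - zb_1 d/dz_2.
   E1, H1, F1 and E2, H2, F2 are standard bases of two commuting copies of sl(2) spanning so(4). *)
definition E1 :: "cpoly \<Rightarrow> cpoly" where
  "E1 = oscale (1/2) (so_gen 1 3 + so_gen 2 4 + oscale \<i> (so_gen 2 3 - so_gen 1 4))"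
definition F1 :: "cpoly \<Rightarrow> cpoly" where
  "F1 = oscale (1/2) (oscale \<i> (so_gen 2 3 - so_gen 1 4) - so_gen 1 3 - so_gen 2 4)"
definition H1 :: "cpoly \<Rightarrow> cpoly" where
  "H1 = cartan_H 1 - cartan_H 2"
definition E2 :: "cpoly \<Rightarrow> cpoly" where
  "E2 = oscale (1/2) (so_gen 1 3 - so_gen 2 4 + oscale \<i> (so_gen 2 3 + so_gen 1 4))"
definition F2 :: "cpoly \<Rightarrow> cpoly" where
  "F2 = oscale (1/2) (so_gen 2 4 - so_gen 1 3 + oscale \<i> (so_gen 2 3 + so_gen 1 4))"
definition H2 :: "cpoly \<Rightarrow> cpoly" where
  "H2 = cartan_H 1 + cartan_H 2"

(* M is isomorphic to the tensor product of M_t and M_r, the first copy of sl(2) acting on M_t and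
   the second on M_r. M_t has the basis v_0, ..., v_t with h v_k = (t - 2k) v_k,
   e v_k = k (t - k + 1) v_{k-1}, f v_k = v_{k+1} (0 if k = t); b k l is v_k tensor v_l. *)
definition is_tensor_module ::
  "nat \<Rightarrow> nat \<Rightarrow> (complex \<Rightarrow> 'm::ab_group_add \<Rightarrow> 'm) \<Rightarrow> 'm set \<Rightarrow> ((cpoly \<Rightarrow> cpoly) \<Rightarrow> 'm \<Rightarrow> 'm) \<Rightarrow> bool"
  where
  "is_tensor_module t r sM M \<rho> \<longleftrightarrow>
     (\<exists>b :: nat \<Rightarrow> nat \<Rightarrow> 'm.
        inj_on (\<lambda>(k, l). b k l) ({0..t} \<times> {0..r}) \<and>
        \<not> module.dependent sM ((\<lambda>(k, l). b k l) ` ({0..t} \<times> {0..r})) \<and>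
        module.span sM ((\<lambda>(k, l). b k l) ` ({0..t} \<times> {0..r})) = M \<and>
        (\<forall>k\<in>{0..t}. \<forall>l\<in>{0..r}.
           \<rho> H1 (b k l) = sM (of_nat t - 2 * of_nat k) (b k l) \<and>
           \<rho> E1 (b k l) = sM (of_nat (k * (t - k + 1))) (b (k - 1) l) \<and>
           \<rho> F1 (b k l) = (if k = t then 0 else b (k + 1) l) \<and>
           \<rho> H2 (b k l) = sM (of_nat r - 2 * of_nat l) (b k l) \<and>
           \<rho> E2 (b k l) = sM (of_nat (l * (r - l + 1))) (b k (l - 1)) \<and>
           \<rho> F2 (b k l) = (if l = r then 0 else b k (l + 1))))"

end

theory Submission
  imports Defs "HOL-Computational_Algebra.Fundamental_Theorem_Algebra"
begin

text \<open>
  In terms of the operators \<open>E i j\<close> by which the \<open>e_ij\<close> act, the module condition for the arguments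
  \<open>a_1, ..., a_n\<close> and \<open>a_(n+1), ..., a_(2n-2)\<close> among the basis vectors is either the bracket relation
  of so(n+1) or, for distinct indices, the Pluecker relation
  \<open>E i j E k l - E i k E j l + E i l E j k = 0\<close>. So a module can be prolonged if and only if the Pluecker
  relations hold on it.

  Let \<open>H = - \<i> E 1 2\<close>, \<open>R c = E 1 c + \<i> E 2 c\<close> and \<open>L c = E 1 c - \<i> E 2 c\<close> for \<open>c \<ge> 3\<close>. On a vector
  killed by all \<open>R c\<close>, the Pluecker relation for \<open>1, 2, c, d\<close> becomes \<open>(H + 1) E c d = 0\<close>. By sl(2) theory
  for \<open>R c, L c, 2 H\<close> the weights of \<open>H\<close> on such vectors are half of natural numbers, hence all
  \<open>E c d\<close> with \<open>c, d \<ge> 3\<close> kill them: a highest weight is a multiple of \<open>\<epsilon>_1\<close>. Conversely, if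
  the highest weight is a multiple of \<open>\<epsilon>_1\<close>, then the Pluecker relations hold on the highest weight
  vector, and the vectors on which they hold form a submodule.

  For complete reducibility, each highest weight vector generates an irreducible submodule, on which the
  Casimir operator is a scalar that determines the weight of the vector. If these submodules did
  not span \<open>M\<close>, then a highest weight vector modulo their span could be corrected by polynomials in \<open>H\<close>
  and \<open>C + \<i> H\<close>, where \<open>C\<close> is the Casimir operator, to a highest weight vector outside their span.
\<close>

section \<open>Polynomials in an operator\<close>

text \<open>Quotients of \<open>M\<close> are never formed; statements are made modulo a submodule
  \<open>S\<close> instead. \<open>S = {0}\<close> yields genuine highest weight vectors, and the
  span of the cyclic submodules yields those of the quotient. Lifting such a \<open>w\<close> from
  the quotient meets two obstacles. \<open>H\<close> is not known to be diagonalisable on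
  \<open>M\<close>; a generalized eigenvector killed by all \<open>R c\<close> is nevertheless an
  eigenvector, because \<open>e^k f^k v = k! h (h - 1) ... (h - k + 1) v\<close> involves a
  polynomial with simple roots. And \<open>R c w\<close> is only known to lie in \<open>S\<close>.
  After the corrections it is a generalized eigenvector of \<open>cas + \<i> H\<close> for
  \<open>\<gamma>(b) + \<i> (b + 1)\<close>, whereas on \<open>S\<close> this operator has the
  eigenvalues \<open>\<gamma>(a) + \<i> (a - l)\<close>, with \<open>\<gamma>\<close> the eigenvalue
  of \<open>cas\<close>. Weights and \<open>\<gamma>\<close> are real, so the factor
  \<open>\<i>\<close> lets one operator record both numbers: a coincidence forces
  \<open>a = b\<close> and then \<open>b + 1 = b - l\<close>, which is impossible for a natural
  number \<open>l\<close>.\<close>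

locale complex_space = vector_space scale
  for scale :: "complex \<Rightarrow> 'm::ab_group_add \<Rightarrow> 'm"
begin

text \<open>Horner evaluation of p at the operator T, applied to u.\<close>

definition poly_op :: "('m \<Rightarrow> 'm) \<Rightarrow> complex poly \<Rightarrow> 'm \<Rightarrow> 'm" where
  "poly_op T p u = fold_coeffs (\<lambda>a v. scale a u + T v) p 0"

lemma poly_op_0 [simp]: "poly_op T 0 u = 0"
  by (simp add: poly_op_def)

lemma poly_op_pCons:
  assumes "module_hom scale scale T"
  shows "poly_op T (pCons a p) u = scale a u + T (poly_op T p u)"
  by (cases "p = 0 \<and> a = 0") (auto simp: poly_op_def module_hom.zero[OF assms])

lemma poly_op_linear:
  assumes T: "module_hom scale scale T"
  shows "module_hom scale scale (poly_op T p)"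
proof -
  have add: "poly_op T p (u + v) = poly_op T p u + poly_op T p v" for u v
    by (induction p) (auto simp: poly_op_pCons[OF T] module_hom.add[OF T] scale_right_distrib)
  have sc: "poly_op T p (scale c u) = scale c (poly_op T p u)" for c u
    by (induction p)
      (auto simp: poly_op_pCons[OF T] module_hom.scale[OF T] scale_right_distrib mult.commute)
  show ?thesis
    by unfold_locales (use add sc in auto)
qed

lemma poly_op_add:
  assumes T: "module_hom scale scale T"
  shows "poly_op T (p + q) u = poly_op T p u + poly_op T q u"
proof (induction p arbitrary: q)
  case (pCons a p)
  show ?case
  proof (cases q)
    case (pCons b q')
    then show ?thesis
      by (simp add: poly_op_pCons[OF T] pCons.IH module_hom.add[OF T] scale_left_distrib)
  qed
qed simp

lemma poly_op_smult:
  assumes T: "module_hom scale scale T"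
  shows "poly_op T (smult c p) u = scale c (poly_op T p u)"
  by (induction p) (auto simp: poly_op_pCons[OF T] module_hom.scale[OF T] scale_right_distrib)

lemma poly_op_commute:
  assumes T: "module_hom scale scale T" and S: "module_hom scale scale S"
    and ST: "\<And>u. S (T u) = T (S u)"
  shows "S (poly_op T p u) = poly_op T p (S u)"
  by (induction p)
    (auto simp: poly_op_pCons[OF T] module_hom.zero[OF S] module_hom.add[OF S] module_hom.scale[OF S] ST)

lemma poly_op_mult:
  assumes T: "module_hom scale scale T"
  shows "poly_op T (p * q) u = poly_op T p (poly_op T q u)"
  by (induction p) (simp_all add: poly_op_pCons[OF T] poly_op_add[OF T] poly_op_smult[OF T])

lemma poly_op_linear_factor:
  assumes T: "module_hom scale scale T"
  shows "poly_op T [:- r, 1:] u = T u - scale r u"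
  by (simp add: poly_op_pCons[OF T] module_hom.zero[OF T])

lemma poly_op_monom:
  assumes T: "module_hom scale scale T"
  shows "poly_op T (monom c k) u = scale c ((T ^^ k) u)"
  by (induction k) (simp_all add: monom_0 monom_Suc poly_op_pCons[OF T] module_hom.zero[OF T] module_hom.scale[OF T])

lemma poly_op_sum:
  assumes T: "module_hom scale scale T"
  shows "poly_op T (\<Sum>i\<in>A. f i) u = (\<Sum>i\<in>A. poly_op T (f i) u)"
  by (induction A rule: infinite_finite_induct) (auto simp: poly_op_add[OF T])

lemma poly_op_in_subspace:
  assumes T: "module_hom scale scale T" and S: "subspace S"
    and TS: "\<And>u. u \<in> S \<Longrightarrow> T u \<in> S" and u: "u \<in> S"
  shows "poly_op T p u \<in> S"
  by (induction p) (auto simp: poly_op_pCons[OF T] S subspace_0 subspace_add subspace_scale TS u)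

text \<open>Horner induction: T keeps the previous error inside S, and the new error is a multiple
  of T w - b w. This replaces evaluating p(T) on an eigenvector of the quotient by S.\<close>

lemma poly_op_eigenvector_mod:
  assumes T: "module_hom scale scale T" and S: "subspace S"
    and TS: "\<And>u. u \<in> S \<Longrightarrow> T u \<in> S" and w: "T w - scale b w \<in> S"
  shows "poly_op T p w - scale (poly p b) w \<in> S"
proof (induction p)
  case 0
  then show ?case using S by (simp add: subspace_0)
next
  case (pCons a p)
  have "poly_op T (pCons a p) w - scale (poly (pCons a p) b) w
      = T (poly_op T p w - scale (poly p b) w) + scale (poly p b) (T w - scale b w)"
    by (simp add: poly_op_pCons[OF T] module_hom.diff[OF T] module_hom.scale[OF T] algebra_simps)
  then show ?case
    using S TS[OF pCons.IH] w by (simp add: subspace_add subspace_scale)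
qed

lemma poly_op_eigenvector:
  assumes T: "module_hom scale scale T" and w: "T w = scale b w"
  shows "poly_op T p w = scale (poly p b) w"
  using poly_op_eigenvector_mod[OF T, of "{0}" w b p] w module_hom.zero[OF T] by simp

text \<open>The polynomials (X - \<mu>)^k and q are coprime. In place of a Bezout identity, one
  factor is peeled off at a time: (T - \<mu>) y vanishes by induction, so y is an eigenvector and
  q(T) y = q(\<mu>) y.\<close>

lemma generalized_eigenvector_eq_0:
  assumes T: "module_hom scale scale T"
    and y: "poly_op T ([:- \<mu>, 1:] ^ k) y = 0" and q: "poly_op T q y = 0" "poly q \<mu> \<noteq> 0"
  shows "y = 0"
  using y q(1)
proof (induction k arbitrary: y)
  case 0
  then show ?case by (simp add: one_pCons poly_op_pCons[OF T] module_hom.zero[OF T])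
next
  case (Suc k)
  let ?z = "T y - scale \<mu> y"
  have z: "?z = poly_op T [:- \<mu>, 1:] y"
    by (simp add: poly_op_linear_factor[OF T])
  have "poly_op T ([:- \<mu>, 1:] ^ k) ?z = 0"
    using Suc.prems(1) unfolding z power_Suc2 by (simp only: poly_op_mult[OF T])
  moreover have "poly_op T q ?z = 0"
    unfolding z using Suc.prems(2) module_hom.zero[OF poly_op_linear[OF T]]
    by (metis mult.commute poly_op_mult[OF T])
  ultimately have "?z = 0" by (rule Suc.IH)
  then show ?case
    using poly_op_eigenvector[OF T, of y \<mu> q] Suc.prems(2) q(2) by simp
qed

text \<open>The vector (T - \<mu>) y is killed by q(T) and by a power of T - \<mu>, hence zero by
  coprimality.\<close>

lemma generalized_eigenvector_simple_root:
  assumes T: "module_hom scale scale T"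
    and y: "poly_op T ([:- \<mu>, 1:] ^ k) y = 0"
    and q: "poly_op T (q * [:- \<mu>, 1:]) y = 0" "poly q \<mu> \<noteq> 0"
  shows "T y = scale \<mu> y"
proof -
  let ?z = "poly_op T [:- \<mu>, 1:] y"
  have "poly_op T ([:- \<mu>, 1:] ^ k) ?z = 0"
    using y module_hom.zero[OF poly_op_linear[OF T]] by (metis mult.commute poly_op_mult[OF T])
  moreover have "poly_op T q ?z = 0"
    using q(1) by (simp only: poly_op_mult[OF T])
  ultimately have "?z = 0"
    using generalized_eigenvector_eq_0[OF T] q(2) by blast
  then show ?thesis by (simp add: poly_op_linear_factor[OF T])
qed

lemma annihilating_poly_vector:
  assumes T: "module_hom scale scale T" and B: "finite B" and u: "u \<in> span B"
    and TB: "\<And>u. u \<in> span B \<Longrightarrow> T u \<in> span B"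
  shows "\<exists>p. p \<noteq> 0 \<and> poly_op T p u = 0"
proof (cases "inj (\<lambda>k. (T ^^ k) u)")
  \<comment> \<open>Dependence is a property of sets, in which coinciding iterates would collapse.
    They are treated apart and give the polynomial X^i - X^j.\<close>
  case False
  then obtain i j where ij: "i \<noteq> j" "(T ^^ i) u = (T ^^ j) u"
    unfolding inj_def by blast
  have "poly_op T (monom 1 i - monom 1 j) u = 0"
    using ij(2) poly_op_add[OF T, of "monom 1 i - monom 1 j" "monom 1 j" u]
    by (simp add: poly_op_monom[OF T])
  moreover have "monom 1 i - monom 1 j \<noteq> (0 :: complex poly)"
    using ij(1) by (metis diff_eq_diff_eq diff_0_right monom_eq_iff' diff_self eq_iff_diff_eq_0 one_neq_zero)
  ultimately show ?thesis by blast
next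
  case True
  let ?f = "\<lambda>k. (T ^^ k) u"
  let ?d = "card B"
  have fB: "?f k \<in> span B" for k
    by (induction k) (auto intro: u TB)
  have c: "card (?f ` {..?d}) = Suc ?d"
    using True by (subst card_image) (auto intro: inj_on_subset)
  have "dependent (?f ` {..?d})"
  proof (rule ccontr)
    assume "\<not> dependent (?f ` {..?d})"
    then have "card (?f ` {..?d}) \<le> ?d"
      using independent_span_bound[OF B, of "?f ` {..?d}"] fB by blast
    then show False using c by simp
  qed
  then obtain g where g: "(\<Sum>v\<in>?f ` {..?d}. scale (g v) v) = 0" "\<exists>v\<in>?f ` {..?d}. g v \<noteq> 0"
    by (auto simp: dependent_finite)
  let ?p = "\<Sum>i\<le>?d. monom (g (?f i)) i"
  have "poly_op T ?p u = (\<Sum>i\<le>?d. scale (g (?f i)) (?f i))"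
    by (simp add: poly_op_sum[OF T] poly_op_monom[OF T])
  also have "\<dots> = 0"
    using g(1) by (subst (asm) sum.reindex) (auto intro: inj_on_subset[OF True])
  finally have "poly_op T ?p u = 0" .
  moreover obtain i where i: "i \<le> ?d" "g (?f i) \<noteq> 0" using g(2) by auto
  then have "coeff ?p i \<noteq> 0"
    by (simp add: coeff_sum)
  then have "?p \<noteq> 0" by (metis coeff_0)
  ultimately show ?thesis by blast
qed

lemma annihilating_poly:
  assumes T: "module_hom scale scale T" and B: "finite B"
    and TB: "\<And>u. u \<in> span B \<Longrightarrow> T u \<in> span B"
  obtains p where "p \<noteq> 0" "\<And>u. u \<in> span B \<Longrightarrow> poly_op T p u = 0"
proof -
  have "\<forall>u\<in>B. \<exists>p. p \<noteq> 0 \<and> poly_op T p u = 0"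
    using annihilating_poly_vector[OF T B _ TB] span_base by blast
  then obtain P where P: "\<And>u. u \<in> B \<Longrightarrow> P u \<noteq> 0 \<and> poly_op T (P u) u = 0"
    by metis
  let ?p = "\<Prod>u\<in>B. P u"
  have "poly_op T ?p u = 0" if u: "u \<in> B" for u
    using P[OF u] module_hom.zero[OF poly_op_linear[OF T]]
    by (metis B u mult.commute poly_op_mult[OF T] prod.remove)
  then have "poly_op T ?p u = 0" if "u \<in> span B" for u
    using module_hom.eq_0_on_span[OF poly_op_linear[OF T]] that by blast
  moreover have "?p \<noteq> 0" using P B by simp
  ultimately show thesis using that by blast
qed

end

text \<open>Split p = (X - b)^k q with q(b) nonzero. Then q(T) w is a generalized eigenvector
  exactly, not only modulo S, and modulo S it is still a nonzero multiple of w.\<close>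

lemma (in complex_space) exists_generalized_eigenvector_mod:
  assumes T: "module_hom scale scale T" and S: "subspace S"
    and TS: "\<And>u. u \<in> S \<Longrightarrow> T u \<in> S"
    and p: "p \<noteq> 0" "poly_op T p w = 0"
    and w: "T w - scale b w \<in> S" "w \<notin> S"
  obtains q k where "poly_op T ([:- b, 1:] ^ k) (poly_op T q w) = 0" "poly q b \<noteq> 0"
    "poly_op T q w - scale (poly q b) w \<in> S"
proof -
  obtain q where q: "p = [:- b, 1:] ^ order b p * q" "\<not> [:- b, 1:] dvd q"
    using order_decomp[OF p(1)] by blast
  have "poly_op T ([:- b, 1:] ^ order b p) (poly_op T q w) = 0"
    using p(2) q(1) by (metis poly_op_mult[OF T])
  then show thesis
    using that poly_op_eigenvector_mod[OF T S TS w(1)] q(2) by (metis poly_eq_0_iff_dvd)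
qed

text \<open>Linear factors of p are stripped one by one; when q(T) w is not in S but (T - r) q(T) w
  is, the vector q(T) w is an eigenvector modulo S. Stability of K keeps it in K.\<close>

lemma (in complex_space) exists_eigenvector_mod:
  assumes T: "module_hom scale scale T" and S: "subspace S"
    and K: "\<And>u. u \<in> K \<Longrightarrow> T u \<in> K" "subspace K"
    and p: "p \<noteq> 0" "poly_op T p w \<in> S" and w: "w \<in> K" "w \<notin> S"
  shows "\<exists>b w'. w' \<in> K \<and> w' \<notin> S \<and> T w' - scale b w' \<in> S"
  using p w
  proof (induction "degree p" arbitrary: p w rule: less_induct)
    case less
    have "\<not> constant (poly p)"
    proof
      assume "constant (poly p)"
      then have "degree p = 0" by (simp add: constant_degree)
      then obtain c where c: "p = [:c:]" by (metis degree_eq_zeroE)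
      then have "scale c w \<in> S" using less.prems(2) by (simp add: poly_op_pCons[OF T] module_hom.zero[OF T])
      then have "scale (inverse c) (scale c w) \<in> S" using S subspace_scale by blast
      then show False using c less.prems by simp
    qed
    then obtain r where "poly p r = 0" using fundamental_theorem_of_algebra by blast
    then obtain q where q: "p = [:- r, 1:] * q" by (metis dvdE poly_eq_0_iff_dvd)
    with less.prems(1) have q0: "q \<noteq> 0" by auto
    have dq: "degree q < degree p"
      unfolding q by (subst degree_mult_eq) (use q0 in auto)
    show ?case
    proof (cases "poly_op T q w \<in> S")
      case True
      then show ?thesis using less.hyps[OF dq q0 _ less.prems(3,4)] by blast
    next
      case False
      moreover have "poly_op T q w \<in> K"
        using poly_op_in_subspace[OF T K(2) K(1) less.prems(3)] .
      moreover have "T (poly_op T q w) - scale r (poly_op T q w) \<in> S"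
        using less.prems(2) unfolding q by (simp only: poly_op_mult[OF T] poly_op_linear_factor[OF T])
      ultimately show ?thesis by blast
    qed
  qed

section \<open>Triples spanning sl(2)\<close>

lemma (in complex_space) subspace_scale_cancel:
  assumes "subspace S" "scale c x \<in> S" "c \<noteq> 0"
  shows "x \<in> S"
  using subspace_scale[OF assms(1,2), of "inverse c"] assms(3) by simp

locale sl2_triple = complex_space scale
  for scale :: "complex \<Rightarrow> 'm::ab_group_add \<Rightarrow> 'm" +
  fixes e f h :: "'m \<Rightarrow> 'm"
  assumes e_hom: "module_hom scale scale e"
    and f_hom: "module_hom scale scale f"
    and h_hom: "module_hom scale scale h"
    and h_e: "\<And>u. h (e u) = e (h u) + scale 2 (e u)"
    and h_f: "\<And>u. h (f u) = f (h u) - scale 2 (f u)"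
    and e_f: "\<And>u. e (f u) = f (e u) + h u"
begin

lemmas triple_hom_simps =
  module_hom.add[OF e_hom] module_hom.scale[OF e_hom] module_hom.zero[OF e_hom] module_hom.diff[OF e_hom]
  module_hom.add[OF f_hom] module_hom.scale[OF f_hom] module_hom.zero[OF f_hom] module_hom.diff[OF f_hom]
  module_hom.add[OF h_hom] module_hom.scale[OF h_hom] module_hom.zero[OF h_hom] module_hom.diff[OF h_hom]

text \<open>Modulo S, e f^(k+1) w = (k + 1) (\<mu> - k) f^k w. If \<mu> is not a natural number,
  these coefficients never vanish, so no f^k w falls into S, and the infinitely many weights \<mu> -
  2k would all be roots of p.\<close>

lemma highest_weight_nat:
  assumes S: "subspace S" and Sc: "\<And>u. u \<in> S \<Longrightarrow> e u \<in> S" "\<And>u. u \<in> S \<Longrightarrow> f u \<in> S" "\<And>u. u \<in> S \<Longrightarrow> h u \<in> S"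
    and K: "\<And>u. u \<in> K \<Longrightarrow> f u \<in> K"
    and p: "p \<noteq> 0" "\<And>u. u \<in> K \<Longrightarrow> poly_op h p u = 0"
    and w: "w \<in> K" "w \<notin> S" "e w \<in> S" "h w - scale \<mu> w \<in> S"
  shows "\<exists>n::nat. \<mu> = of_nat n"
proof (rule ccontr)
  assume nn: "\<not> ?thesis"
  have fh: "h ((f ^^ k) w) - scale (\<mu> - 2 * of_nat k) ((f ^^ k) w) \<in> S" for k
  proof (induction k)
    case (Suc k)
    have "h ((f ^^ Suc k) w) - scale (\<mu> - 2 * of_nat (Suc k)) ((f ^^ Suc k) w)
      = f (h ((f ^^ k) w) - scale (\<mu> - 2 * of_nat k) ((f ^^ k) w))"
      by (simp add: h_f triple_hom_simps algebra_simps)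
    then show ?case using Sc(2)[OF Suc] by simp
  qed (simp add: w)
  have ef: "e ((f ^^ Suc k) w) - scale (of_nat (Suc k) * (\<mu> - of_nat k)) ((f ^^ k) w) \<in> S" for k
  proof (induction k)
    case 0
    have "e (f w) - scale \<mu> w = f (e w) + (h w - scale \<mu> w)"
      by (simp add: e_f)
    also have "\<dots> \<in> S" using S w Sc(2) by (blast intro: subspace_add)
    finally show ?case by simp
  next
    case (Suc k)
    have "e ((f ^^ Suc (Suc k)) w) - scale (of_nat (Suc (Suc k)) * (\<mu> - of_nat (Suc k))) ((f ^^ Suc k) w)
      = f (e ((f ^^ Suc k) w) - scale (of_nat (Suc k) * (\<mu> - of_nat k)) ((f ^^ k) w))
        + (h ((f ^^ Suc k) w) - scale (\<mu> - 2 * of_nat (Suc k)) ((f ^^ Suc k) w))"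
    proof -
      let ?x = "(f ^^ Suc k) w"
      have "of_nat (Suc (Suc k)) * (\<mu> - of_nat (Suc k)) = of_nat (Suc k) * (\<mu> - of_nat k) + (\<mu> - 2 * of_nat (Suc k))"
        by (simp add: algebra_simps)
      then have "scale (of_nat (Suc (Suc k)) * (\<mu> - of_nat (Suc k))) ?x
        = scale (of_nat (Suc k) * (\<mu> - of_nat k)) ?x + scale (\<mu> - 2 * of_nat (Suc k)) ?x"
        by (simp only: scale_left_distrib)
      then show ?thesis
        using e_f[of ?x] by (simp add: triple_hom_simps)
    qed
    then show ?case using S Suc fh[of "Suc k"] Sc(2) by (simp only: subspace_add)
  qed
  have fS: "(f ^^ k) w \<notin> S" for k
  proof (induction k)
    case (Suc k)
    show ?case
    proof
      assume "(f ^^ Suc k) w \<in> S"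
      then have "e ((f ^^ Suc k) w) \<in> S" by (rule Sc(1))
      from subspace_diff[OF S this ef[of k]]
      have "scale (of_nat (Suc k) * (\<mu> - of_nat k)) ((f ^^ k) w) \<in> S" by simp
      moreover have "of_nat (Suc k) * (\<mu> - of_nat k) \<noteq> 0" using nn by (simp del: of_nat_Suc)
      ultimately have "(f ^^ k) w \<in> S" using subspace_scale_cancel[OF S] by blast
      then show False using Suc by blast
    qed
  qed (simp add: w)
  have fK: "(f ^^ k) w \<in> K" for k
    by (induction k) (auto simp: w K)
  have "poly p (\<mu> - 2 * of_nat k) = 0" for k
  proof (rule ccontr)
    assume nz: "poly p (\<mu> - 2 * of_nat k) \<noteq> 0"
    have "scale (poly p (\<mu> - 2 * of_nat k)) ((f ^^ k) w) \<in> S"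
      using poly_op_eigenvector_mod[OF h_hom S Sc(3) fh, of p k] p(2)[OF fK[of k]] S
      by (auto simp: subspace_neg dest: subspace_neg)
    from subspace_scale_cancel[OF S this nz] show False using fS[of k] by simp
  qed
  then have "range (\<lambda>k::nat. \<mu> - 2 * of_nat k) \<subseteq> {x. poly p x = 0}" by auto
  then have "finite (range (\<lambda>k::nat. \<mu> - 2 * of_nat k))"
    using poly_roots_finite[OF p(1)] finite_subset by blast
  moreover have "inj (\<lambda>k::nat. \<mu> - 2 * of_nat k)" by (auto simp: inj_def)
  ultimately show False using finite_imageD infinite_UNIV_nat by blast
qed

text \<open>Here v need only be killed by e, so the scalars of the usual formula for weight vectors
  become the polynomial h (h - 1) ... (h - k + 1) applied to v.\<close>

lemma e_pow_f_pow:
  assumes "e v = 0"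
  shows "(e ^^ k) ((f ^^ k) v) = scale (fact k) (poly_op h (\<Prod>j<k. [:- of_nat j, 1:]) v)"
  using assms
proof (induction k arbitrary: v)
  case 0
  then show ?case by (simp add: one_pCons poly_op_pCons[OF h_hom] triple_hom_simps)
next
  case (Suc k)
  let ?hk = "\<lambda>k v. h v - scale (of_nat k) v"
  have lin: "(f ^^ k) (scale c x) = scale c ((f ^^ k) x)" "(f ^^ k) (x + y) = (f ^^ k) x + (f ^^ k) y"
    "(e ^^ k) (scale c x) = scale c ((e ^^ k) x)" for c x y k
    by (induction k) (simp_all add: triple_hom_simps)
  have fh: "h ((f ^^ k) v) = (f ^^ k) (h v - scale (2 * of_nat k) v)" for k
  proof (induction k)
    case (Suc k)
    have "h ((f ^^ Suc k) v) = f ((f ^^ k) (h v - scale (2 * of_nat k) v)) - scale 2 (f ((f ^^ k) v))"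
      by (simp add: h_f Suc)
    also have "\<dots> = (f ^^ Suc k) ((h v - scale (2 * of_nat k) v) + scale (- 2) v)"
      by (simp only: lin) (simp add: triple_hom_simps lin)
    also have "(h v - scale (2 * of_nat k) v) + scale (- 2) v = h v - scale (2 * of_nat (Suc k)) v"
      by (simp add: algebra_simps)
    finally show ?case .
  qed simp
  have ef: "e ((f ^^ Suc k) v) = scale (of_nat (Suc k)) ((f ^^ k) (?hk k v))" for k
  proof (induction k)
    case 0
    then show ?case by (simp add: e_f Suc.prems triple_hom_simps)
  next
    case (Suc k)
    have "e ((f ^^ Suc (Suc k)) v) = f (e ((f ^^ Suc k) v)) + h ((f ^^ Suc k) v)"
      using e_f by simp
    also have "\<dots> = scale (of_nat (Suc k)) ((f ^^ Suc k) (?hk k v)) + (f ^^ Suc k) (h v - scale (2 * of_nat (Suc k)) v)"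
      by (simp only: Suc fh[of "Suc k"] triple_hom_simps) simp
    also have "\<dots> = (f ^^ Suc k) (scale (of_nat (Suc k)) (?hk k v) + (h v - scale (2 * of_nat (Suc k)) v))"
      by (simp only: lin)
    also have "scale (of_nat (Suc k)) (?hk k v) + (h v - scale (2 * of_nat (Suc k)) v)
       = scale (of_nat (Suc (Suc k))) (?hk (Suc k) v)"
      using scale_left_distrib[of 1 1 "h v"] by (simp add: algebra_simps)
    finally show ?case by (simp only: lin)
  qed
  \<comment> \<open>The vector (h - k) v is again killed by e, so the induction hypothesis may be
    used for it in place of v.\<close>
  have "e (?hk k v) = 0"
    using h_e[of v] Suc.prems by (simp add: triple_hom_simps)
  then have IH: "(e ^^ k) ((f ^^ k) (?hk k v)) = scale (fact k) (poly_op h (\<Prod>j<k. [:- of_nat j, 1:]) (?hk k v))"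
    by (rule Suc.IH)
  have "(e ^^ Suc k) ((f ^^ Suc k) v) = (e ^^ k) (e ((f ^^ Suc k) v))"
    by (simp only: funpow_Suc_right o_apply)
  also have "\<dots> = scale (of_nat (Suc k)) ((e ^^ k) ((f ^^ k) (?hk k v)))"
    by (simp only: ef lin)
  also have "\<dots> = scale (fact (Suc k)) (poly_op h (\<Prod>j<k. [:- of_nat j, 1:]) (?hk k v))"
    by (simp only: IH scale_scale fact_Suc of_nat_mult)
  also have "?hk k v = poly_op h [:- of_nat k, 1:] v"
    by (simp add: poly_op_linear_factor[OF h_hom])
  also have "poly_op h (\<Prod>j<k. [:- of_nat j, 1:]) \<dots> = poly_op h (\<Prod>j<Suc k. [:- of_nat j, 1:]) v"
    by (simp only: poly_op_mult[OF h_hom, symmetric] prod.lessThan_Suc)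
  finally show ?case .
qed

text \<open>From (h - (\<mu> - 2)) f = f (h - \<mu>), iterated in both exponents.\<close>

lemma f_generalized_eigenvector:
  assumes "poly_op h ([:- \<mu>, 1:] ^ m) u = 0"
  shows "poly_op h ([:- (\<mu> - 2 * of_nat k), 1:] ^ m) ((f ^^ k) u) = 0"
proof -
  have "poly_op h ([:- (\<mu> - 2), 1:] ^ m) (f u) = f (poly_op h ([:- \<mu>, 1:] ^ m) u)" for \<mu> u
  proof (induction m)
    case 0
    then show ?case by (simp add: one_pCons poly_op_pCons[OF h_hom] triple_hom_simps)
  next
    case (Suc m)
    show ?case
      unfolding power_Suc poly_op_mult[OF h_hom] Suc poly_op_linear_factor[OF h_hom]
      by (simp add: h_f triple_hom_simps algebra_simps)
  qed
  note step = this
  show ?thesis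
  proof (induction k)
    case (Suc k)
    have eq: "\<mu> - 2 * of_nat (Suc k) = \<mu> - 2 * of_nat k - 2" by (simp add: algebra_simps)
    show ?case
      unfolding eq funpow.simps o_apply step Suc by (simp add: triple_hom_simps)
  qed (use assms in simp)
qed

text \<open>Some \<mu> - 2k is not a root of p, so f^k v, a generalized eigenvector for it, is zero.
  Applying e^k shows that h (h - 1) ... (h - k + 1) kills v. Its roots are simple, so either \<mu>
  is a simple root and v is an eigenvector, or \<mu> is no root and v = 0.\<close>

lemma highest_vector_semisimple:
  assumes K: "\<And>u. u \<in> K \<Longrightarrow> f u \<in> K"
    and p: "p \<noteq> 0" "\<And>u. u \<in> K \<Longrightarrow> poly_op h p u = 0"
    and v: "v \<in> K" "e v = 0" "poly_op h ([:- \<mu>, 1:] ^ m) v = 0"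
  shows "h v = scale \<mu> v"
proof -
  have "\<exists>k::nat. poly p (\<mu> - 2 * of_nat k) \<noteq> 0"
  proof (rule ccontr)
    assume "\<not> ?thesis"
    then have "range (\<lambda>k::nat. \<mu> - 2 * of_nat k) \<subseteq> {x. poly p x = 0}" by auto
    then have "finite (range (\<lambda>k::nat. \<mu> - 2 * of_nat k))"
      using poly_roots_finite[OF p(1)] finite_subset by blast
    moreover have "inj (\<lambda>k::nat. \<mu> - 2 * of_nat k)" by (auto simp: inj_def)
    ultimately show False using finite_imageD infinite_UNIV_nat by blast
  qed
  then obtain k :: nat where k: "poly p (\<mu> - 2 * of_nat k) \<noteq> 0" by blast
  have fK: "(f ^^ k) v \<in> K" for k
    by (induction k) (auto simp: v K)
  have "(f ^^ k) v = 0"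
    using generalized_eigenvector_eq_0[OF h_hom f_generalized_eigenvector[OF v(3)] p(2)[OF fK] k] .
  moreover have "(e ^^ k) 0 = 0" by (induction k) (auto simp: triple_hom_simps)
  ultimately have z: "poly_op h (\<Prod>j<k. [:- of_nat j, 1:]) v = 0"
    using e_pow_f_pow[OF v(2), of k] by simp
  show ?thesis
  proof (cases "\<exists>j<k. \<mu> = of_nat j")
    case True
    then obtain j where j: "j < k" "\<mu> = of_nat j" by blast
    let ?q = "\<Prod>j\<in>{..<k} - {j}. [:- of_nat j, 1:] :: complex poly"
    have "(\<Prod>j<k. [:- of_nat j, 1:]) = ?q * [:- \<mu>, 1:]"
      using j by (subst prod.remove[of _ j]) (auto simp: mult.commute)
    moreover have "poly ?q \<mu> \<noteq> 0"
      using j by (auto simp: poly_prod)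
    ultimately show ?thesis
      using generalized_eigenvector_simple_root[OF h_hom v(3), of ?q] z by simp
  next
    case False
    then have "poly (\<Prod>j<k. [:- of_nat j, 1:]) \<mu> \<noteq> 0"
      by (auto simp: poly_prod)
    then have "v = 0"
      using generalized_eigenvector_eq_0[OF h_hom v(3) z] by blast
    then show ?thesis by (simp add: triple_hom_simps)
  qed
qed

end

section \<open>Representations of so(N)\<close>

text \<open>Keeps the index 1 in \<open>E 1 c\<close> literal; as \<open>Suc 0\<close> it would not
  match the commutation rules below.\<close>

declare One_nat_def [simp del]

text \<open>The operators are linear on the whole type and map it into \<open>M\<close>, so the
  relations can be used as equations without membership conditions. \<open>so_lie_module\<close>
  supplies such operators for a module given only on \<open>M\<close>.\<close>

locale so_rep = complex_space scale
  for scale :: "complex \<Rightarrow> 'm::ab_group_add \<Rightarrow> 'm" +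
  fixes N :: nat and E :: "nat \<Rightarrow> nat \<Rightarrow> 'm \<Rightarrow> 'm" and M :: "'m set"
  assumes N3: "3 \<le> N"
    and fin_dim: "\<exists>B. finite B \<and> M = span B"
    and E_hom: "\<And>i j. module_hom scale scale (E i j)"
    and E_in_M: "\<And>i j u. E i j u \<in> M"
    and E_anti: "\<And>i j u. i \<in> {1..N} \<Longrightarrow> j \<in> {1..N} \<Longrightarrow> E j i u = - E i j u"
    and E_comm: "\<And>i j k l u. i \<in> {1..N} \<Longrightarrow> j \<in> {1..N} \<Longrightarrow> k \<in> {1..N} \<Longrightarrow> l \<in> {1..N} \<Longrightarrow>
      E i j (E k l u) = E k l (E i j u) + (if j = k then E i l u else 0) - (if j = l then E i k u else 0)
        - (if i = k then E j l u else 0) + (if i = l then E j k u else 0)"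
begin

lemmas E_simps = module_hom.add[OF E_hom] module_hom.scale[OF E_hom] module_hom.zero[OF E_hom]
  module_hom.diff[OF E_hom] module_hom.neg[OF E_hom] module_hom.sum[OF E_hom]

definition H :: "'m \<Rightarrow> 'm" where "H u = scale (- \<i>) (E 1 2 u)"
definition R :: "nat \<Rightarrow> 'm \<Rightarrow> 'm" where "R c u = E 1 c u + scale \<i> (E 2 c u)"
definition L :: "nat \<Rightarrow> 'm \<Rightarrow> 'm" where "L c u = E 1 c u - scale \<i> (E 2 c u)"

lemma H_hom: "module_hom scale scale H"
  by unfold_locales (simp_all add: H_def E_simps algebra_simps)

lemma R_hom: "module_hom scale scale (R c)"
  by unfold_locales (simp_all add: R_def E_simps algebra_simps)

lemma L_hom: "module_hom scale scale (L c)"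
  by unfold_locales (simp_all add: L_def E_simps algebra_simps)

lemmas H_simps = module_hom.add[OF H_hom] module_hom.scale[OF H_hom] module_hom.zero[OF H_hom]
  module_hom.diff[OF H_hom] module_hom.neg[OF H_hom]
lemmas R_simps = module_hom.add[OF R_hom] module_hom.scale[OF R_hom] module_hom.zero[OF R_hom]
  module_hom.diff[OF R_hom] module_hom.neg[OF R_hom]
lemmas L_simps = module_hom.add[OF L_hom] module_hom.scale[OF L_hom] module_hom.zero[OF L_hom]
  module_hom.diff[OF L_hom] module_hom.neg[OF L_hom]

lemma E_12: "E 1 2 u = scale \<i> (H u)"
  by (simp add: H_def)

lemma E_same: "i \<in> {1..N} \<Longrightarrow> E i i u = 0"
proof -
  assume "i \<in> {1..N}"
  then have "E i i u + E i i u = 0" using E_anti[of i i u] by (metis add.right_inverse)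
  then have "scale 2 (E i i u) = 0" using scale_left_distrib[of 1 1 "E i i u"] by simp
  then show ?thesis by simp
qed

lemma scale_double: "scale 2 u = u + u"
  using scale_left_distrib[of 1 1 u] by simp

lemma E_comm_special:
  assumes "c \<in> {3..N}" "d \<in> {3..N}"
  shows "E 1 2 (E 1 c u) = E 1 c (E 1 2 u) - E 2 c u"
    and "E 1 2 (E 2 c u) = E 2 c (E 1 2 u) + E 1 c u"
    and "E 1 2 (E c d u) = E c d (E 1 2 u)"
    and "E 1 c (E 1 d u) = E 1 d (E 1 c u) - E c d u"
    and "E 2 c (E 2 d u) = E 2 d (E 2 c u) - E c d u"
    and "E 1 c (E 2 d u) = E 2 d (E 1 c u) - (if c = d then E 1 2 u else 0)"
    and "E 2 c (E 1 d u) = E 1 d (E 2 c u) + (if c = d then E 1 2 u else 0)"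
  using assms E_comm[of 1 2 1 c u] E_comm[of 1 2 2 c u] E_comm[of 1 2 c d u] E_comm[of 1 c 1 d u]
    E_comm[of 2 c 2 d u] E_comm[of 1 c 2 d u] E_comm[of 2 c 1 d u] E_same[of 1 u] E_same[of 2 u]
    E_same[of c u] E_anti[of 1 2 u] E_anti[of 1 c u] E_anti[of 2 c u]
  by auto

lemma E_comm_tail:
  assumes "b \<in> {3..N}" "c \<in> {3..N}" "d \<in> {3..N}"
  shows "E 1 b (E c d u) = E c d (E 1 b u) + ((if b = c then E 1 d u else 0) - (if b = d then E 1 c u else 0))"
    and "E 2 b (E c d u) = E c d (E 2 b u) + ((if b = c then E 2 d u else 0) - (if b = d then E 2 c u else 0))"
  using assms E_comm[of 1 b c d u] E_comm[of 2 b c d u] by auto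

lemma H_R: "c \<in> {3..N} \<Longrightarrow> H (R c u) = R c (H u) + R c u"
  by (simp add: H_def R_def E_simps E_comm_special[of c c u] scale_right_distrib scale_right_diff_distrib)

lemma H_L: "c \<in> {3..N} \<Longrightarrow> H (L c u) = L c (H u) - L c u"
  by (simp add: H_def L_def E_simps E_comm_special[of c c u] scale_right_distrib scale_right_diff_distrib)

lemma H_E: "c \<in> {3..N} \<Longrightarrow> d \<in> {3..N} \<Longrightarrow> H (E c d u) = E c d (H u)"
  by (simp add: H_def E_simps E_comm_special(3)[of c d u])

lemma R_E: "b \<in> {3..N} \<Longrightarrow> c \<in> {3..N} \<Longrightarrow> d \<in> {3..N} \<Longrightarrow>
  R b (E c d u) = E c d (R b u) + (if b = c then R d u else 0) - (if b = d then R c u else 0)"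
  by (simp add: R_def E_simps E_comm_tail[of b c d u] scale_right_distrib scale_right_diff_distrib)

lemma L_E: "b \<in> {3..N} \<Longrightarrow> c \<in> {3..N} \<Longrightarrow> d \<in> {3..N} \<Longrightarrow>
  E c d (L b u) = L b (E c d u) - (if b = c then L d u else 0) + (if b = d then L c u else 0)"
  by (simp add: L_def E_simps E_comm_tail[of b c d u] scale_right_distrib scale_right_diff_distrib)

lemma R_L: "c \<in> {3..N} \<Longrightarrow> d \<in> {3..N} \<Longrightarrow>
  R c (L d u) = L d (R c u) - scale 2 (E c d u) - (if c = d then scale 2 (H u) else 0)"
  by (simp add: R_def L_def E_simps E_comm_special[of c d u] E_12
     scale_right_distrib scale_right_diff_distrib scale_double)

text \<open>The product \<open>L c (R c u)\<close> is the sum of the two squares plus \<i> times the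
  commutator of \<open>E 1 c\<close> and \<open>E 2 c\<close>, which is - \<open>E 1 2\<close> = -
  \<i> \<open>H\<close>.\<close>

lemma squares_RL:
  assumes c: "c \<in> {3..N}"
  shows "E 1 c (E 1 c u) + E 2 c (E 2 c u) = L c (R c u) - H u"
  using c by (simp add: R_def L_def E_simps E_comm_special(6)[of c c u] E_12
     scale_right_distrib scale_right_diff_distrib)

section \<open>The Casimir operator\<close>

definition cas :: "'m \<Rightarrow> 'm" where
  "cas u = (\<Sum>i\<in>{1..N}. \<Sum>j\<in>{1..N}. E i j (E i j u))"

lemma cas_hom: "module_hom scale scale cas"
  by unfold_locales
    (simp_all add: cas_def E_simps sum.distrib scale_sum_right)

text \<open>Commuting \<open>E a b\<close> past \<open>E i j\<close> replaces one index b by a, or a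
  by b with a minus sign. Summing over all ordered pairs, rather than i < j, lets each index
  condition collapse one summation; the four resulting sums then cancel in pairs.\<close>

lemma cas_E:
  assumes ab: "a \<in> {1..N}" "b \<in> {1..N}"
  shows "E a b (cas u) = cas (E a b u)"
proof -
  let ?I = "{1..N}"
  let ?D = "\<lambda>i j v. (if b = i then E a j v else 0) - (if a = i then E b j v else 0)
        + (if b = j then E i a v else 0) - (if a = j then E i b v else 0)"
  have c: "E a b (E i j v) = E i j (E a b v) + ?D i j v" if "i \<in> ?I" "j \<in> ?I" for i j v
    using E_comm[OF ab that, of v] E_anti[of i a v] E_anti[of i b v] that ab by simp
  have "E a b (cas u) = (\<Sum>i\<in>?I. \<Sum>j\<in>?I. E a b (E i j (E i j u)))"
    by (simp add: cas_def E_simps)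
  also have "\<dots> = (\<Sum>i\<in>?I. \<Sum>j\<in>?I. E i j (E i j (E a b u)) + (E i j (?D i j u) + ?D i j (E i j u)))"
  proof (intro sum.cong refl)
    fix i j assume ij: "i \<in> ?I" "j \<in> ?I"
    show "E a b (E i j (E i j u)) = E i j (E i j (E a b u)) + (E i j (?D i j u) + ?D i j (E i j u))"
      unfolding c[OF ij, of "E i j u"] c[OF ij, of u] by (simp only: E_simps add.assoc)
  qed
  also have "\<dots> = cas (E a b u) + (\<Sum>i\<in>?I. \<Sum>j\<in>?I. E i j (?D i j u) + ?D i j (E i j u))"
    by (simp add: cas_def sum.distrib)
  also have "(\<Sum>i\<in>?I. \<Sum>j\<in>?I. E i j (?D i j u) + ?D i j (E i j u)) =
     (\<Sum>i\<in>?I. \<Sum>j\<in>?I. if b = i then E i j (E a j u) + E a j (E i j u) else 0)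
     - (\<Sum>i\<in>?I. \<Sum>j\<in>?I. if a = i then E i j (E b j u) + E b j (E i j u) else 0)
     + (\<Sum>i\<in>?I. \<Sum>j\<in>?I. if b = j then E i j (E i a u) + E i a (E i j u) else 0)
     - (\<Sum>i\<in>?I. \<Sum>j\<in>?I. if a = j then E i j (E i b u) + E i b (E i j u) else 0)"
    unfolding sum.distrib[symmetric] sum_subtractf[symmetric]
    by (intro sum.cong refl) (simp add: E_simps)
  also have "\<dots> = 0"
  proof -
    have x: "(\<Sum>i\<in>?I. \<Sum>j\<in>?I. if x = i then g i j else 0) = (\<Sum>j\<in>?I. g x j)" if "x \<in> ?I"
      for x and g :: "nat \<Rightarrow> nat \<Rightarrow> 'm"
    proof -
      have "(\<Sum>i\<in>?I. \<Sum>j\<in>?I. if x = i then g i j else 0) = (\<Sum>i\<in>?I. if x = i then (\<Sum>j\<in>?I. g i j) else 0)"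
        by (intro sum.cong) auto
      then show ?thesis using that by (simp add: sum.delta)
    qed
    have y: "(\<Sum>i\<in>?I. \<Sum>j\<in>?I. if x = j then g i j else 0) = (\<Sum>i\<in>?I. g i x)" if "x \<in> ?I"
      for x and g :: "nat \<Rightarrow> nat \<Rightarrow> 'm"
      using that by (simp add: sum.delta)
    show ?thesis
      unfolding x[OF ab(1)] x[OF ab(2)] y[OF ab(1)] y[OF ab(2)]
      by (simp add: sum.distrib algebra_simps)
  qed
  finally show ?thesis by simp
qed

lemma cas_H: "H (cas u) = cas (H u)"
  using N3 cas_E[of 1 2 u] by (simp add: H_def module_hom.scale[OF cas_hom] module_hom.neg[OF cas_hom])

lemma cas_L: "c \<in> {3..N} \<Longrightarrow> L c (cas u) = cas (L c u)"
  using N3 cas_E[of 1 c u] cas_E[of 2 c u]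
  by (simp add: L_def module_hom.scale[OF cas_hom] module_hom.diff[OF cas_hom])

lemma cas_R: "c \<in> {3..N} \<Longrightarrow> R c (cas u) = cas (R c u)"
  using N3 cas_E[of 1 c u] cas_E[of 2 c u]
  by (simp add: R_def module_hom.scale[OF cas_hom] module_hom.add[OF cas_hom])

text \<open>Splits off the indices 1 and 2 and puts the \<open>R c\<close> to act first. On a vector
  killed by all \<open>R c\<close> and all \<open>E c d\<close> with c, d >= 3 only the terms in
  \<open>H\<close> survive. The factor N - 2 counts the c in {3..N}, each contributing -
  \<open>H\<close> through \<open>squares_RL\<close>.\<close>

lemma cas_expand:
  "cas u = scale 2 (\<Sum>c\<in>{3..N}. L c (R c u)) - scale (2 * of_nat (N - 2)) (H u) - scale 2 (H (H u))
     + (\<Sum>c\<in>{3..N}. \<Sum>d\<in>{3..N}. E c d (E c d u))"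
proof -
  let ?J = "{3..N}"
  have I: "{1..N} = insert 1 (insert 2 ?J)" using N3 by auto
  have s: "(\<Sum>i\<in>{1..N}. g i) = g 1 + g 2 + (\<Sum>i\<in>?J. g i)" for g :: "nat \<Rightarrow> 'm"
    unfolding I by (simp add: add.assoc)
  have sq: "E j i (E j i u) = E i j (E i j u)" if "i \<in> {1..N}" "j \<in> {1..N}" for i j
    using E_anti[OF that] by (simp add: E_simps)
  have one: "1 \<in> {1..N}" "2 \<in> {1..N}" using N3 by auto
  have "cas u = E 1 2 (E 1 2 u) + E 1 2 (E 1 2 u)
     + (\<Sum>c\<in>?J. E 1 c (E 1 c u)) + (\<Sum>c\<in>?J. E 2 c (E 2 c u))
     + (\<Sum>c\<in>?J. E c 1 (E c 1 u)) + (\<Sum>c\<in>?J. E c 2 (E c 2 u))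
     + (\<Sum>c\<in>?J. \<Sum>d\<in>?J. E c d (E c d u))"
    unfolding cas_def s sq[OF one] E_same[OF one(1)] E_same[OF one(2)]
    by (simp add: sum.distrib E_simps algebra_simps)
  also have "(\<Sum>c\<in>?J. E c 1 (E c 1 u)) = (\<Sum>c\<in>?J. E 1 c (E 1 c u))"
    by (intro sum.cong refl sq) auto
  also have "(\<Sum>c\<in>?J. E c 2 (E c 2 u)) = (\<Sum>c\<in>?J. E 2 c (E 2 c u))"
    by (intro sum.cong refl sq) auto
  finally have "cas u = scale 2 (E 1 2 (E 1 2 u)) + scale 2 (\<Sum>c\<in>?J. E 1 c (E 1 c u) + E 2 c (E 2 c u))
     + (\<Sum>c\<in>?J. \<Sum>d\<in>?J. E c d (E c d u))"
    by (simp add: scale_double sum.distrib algebra_simps)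
  also have "(\<Sum>c\<in>?J. E 1 c (E 1 c u) + E 2 c (E 2 c u)) = (\<Sum>c\<in>?J. L c (R c u) - H u)"
    by (intro sum.cong refl squares_RL)
  also have "\<dots> = (\<Sum>c\<in>?J. L c (R c u)) - scale (of_nat (N - 2)) (H u)"
    using N3 by (simp add: sum_subtractf sum_constant_scale Suc_diff_le)
  also have "E 1 2 (E 1 2 u) = - H (H u)"
    by (simp add: E_12 H_simps E_simps)
  finally show ?thesis
    by (simp add: algebra_simps)
qed

section \<open>Submodules\<close>

definition submod :: "'m set \<Rightarrow> bool" where
  "submod K \<longleftrightarrow> subspace K \<and> K \<subseteq> M \<and> (\<forall>i\<in>{1..N}. \<forall>j\<in>{1..N}. \<forall>u\<in>K. E i j u \<in> K)"

lemma submod_subspace: "submod K \<Longrightarrow> subspace K"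
  and submod_subset: "submod K \<Longrightarrow> K \<subseteq> M"
  and submod_E: "submod K \<Longrightarrow> i \<in> {1..N} \<Longrightarrow> j \<in> {1..N} \<Longrightarrow> u \<in> K \<Longrightarrow> E i j u \<in> K"
  by (auto simp: submod_def)

lemma submod_H: "submod K \<Longrightarrow> u \<in> K \<Longrightarrow> H u \<in> K"
  unfolding H_def using N3 by (intro subspace_scale submod_subspace submod_E) auto

lemma submod_R: "submod K \<Longrightarrow> c \<in> {3..N} \<Longrightarrow> u \<in> K \<Longrightarrow> R c u \<in> K"
  unfolding R_def using N3 by (intro subspace_scale subspace_add submod_subspace submod_E) auto

lemma submod_L: "submod K \<Longrightarrow> c \<in> {3..N} \<Longrightarrow> u \<in> K \<Longrightarrow> L c u \<in> K"
  unfolding L_def using N3 by (intro subspace_scale subspace_diff submod_subspace submod_E) auto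

lemma submod_cas: "submod K \<Longrightarrow> u \<in> K \<Longrightarrow> cas u \<in> K"
  unfolding cas_def by (intro subspace_sum submod_subspace submod_E) auto

lemma submodI:
  assumes K: "subspace K" "K \<subseteq> M" and H: "\<And>u. u \<in> K \<Longrightarrow> H u \<in> K"
    and R: "\<And>c u. c \<in> {3..N} \<Longrightarrow> u \<in> K \<Longrightarrow> R c u \<in> K"
    and L: "\<And>c u. c \<in> {3..N} \<Longrightarrow> u \<in> K \<Longrightarrow> L c u \<in> K"
    and E: "\<And>c d u. c \<in> {3..N} \<Longrightarrow> d \<in> {3..N} \<Longrightarrow> u \<in> K \<Longrightarrow> E c d u \<in> K"
  shows "submod K"
proof -
  have 12: "E 1 2 u \<in> K" if "u \<in> K" for u
    unfolding E_12 by (intro subspace_scale K H that)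
  have 1: "E 1 c u \<in> K" if "c \<in> {3..N}" "u \<in> K" for c u
  proof -
    have "E 1 c u = scale (1/2) (R c u + L c u)"
      by (simp add: R_def L_def scale_double[symmetric])
    then show ?thesis using K R L that by (simp only: subspace_scale subspace_add)
  qed
  have 2: "E 2 c u \<in> K" if "c \<in> {3..N}" "u \<in> K" for c u
  proof -
    have "E 2 c u = scale (- \<i> / 2) (R c u - L c u)"
      by (simp add: R_def L_def scale_double[symmetric])
    then show ?thesis using K R L that by (simp only: subspace_scale subspace_diff)
  qed
  have flip: "E j i u \<in> K" if "i \<in> {1..N}" "j \<in> {1..N}" "E i j u \<in> K" for i j u
    using E_anti[OF that(1,2)] K(1) that(3) by (simp add: subspace_neg)
  have "E i j u \<in> K" if ij: "i \<in> {1..N}" "j \<in> {1..N}" and u: "u \<in> K" for i j u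
  proof -
    have r: "x = 1 \<or> x = 2 \<or> x \<in> {3..N}" if "x \<in> {1..N}" for x
      using that by auto
    show ?thesis
      using r[OF ij(1)] r[OF ij(2)] ij u 12[OF u] 1[OF _ u] 2[OF _ u] E[OF _ _ u] flip[of 1 2] flip[of 1 i] flip[of 2 i]
        E_same[of 1 u] E_same[of 2 u] subspace_0[OF K(1)] by metis
  qed
  then show ?thesis using K by (simp add: submod_def)
qed

lemma submod_0: "submod {0}"
  using fin_dim by (auto simp: submod_def E_simps span_zero)

lemma submod_M: "submod M"
  using fin_dim E_in_M by (auto simp: submod_def)

lemma annihilating_poly_M:
  assumes "module_hom scale scale T" "\<And>u. u \<in> M \<Longrightarrow> T u \<in> M"
  obtains p where "p \<noteq> 0" "\<And>u. u \<in> M \<Longrightarrow> poly_op T p u = 0"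
  using fin_dim annihilating_poly[OF assms(1)] assms(2) by metis

text \<open>\<open>R c\<close> raises \<open>H\<close> by 1, not 2, so 2 \<open>H\<close> takes the
  role of h; hence this triple only yields that weights of \<open>H\<close> are half natural
  numbers.\<close>

lemma sl2_R:
  assumes "c \<in> {3..N}"
  shows "sl2_triple scale (R c) (\<lambda>u. - L c u) (\<lambda>u. scale 2 (H u))"
proof unfold_locales
qed (use assms in \<open>simp_all add: R_simps L_simps H_simps H_R H_L R_L E_same algebra_simps\<close>)

end

section \<open>Highest weight vectors and complete reducibility\<close>

text \<open>Polynomials not vanishing at \<mu> are closed under products, and the product of
  annihilators of x and y annihilates their combinations. With
  \<open>generalized_eigenvector_eq_0\<close> it excludes generalized eigenvectors for \<mu> from
  the span without splitting it into eigenspaces.\<close>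

lemma (in complex_space) span_annihilated:
  assumes T: "module_hom scale scale T"
    and B: "\<And>x. x \<in> B \<Longrightarrow> \<exists>q. poly q \<mu> \<noteq> 0 \<and> poly_op T q x = 0"
    and u: "u \<in> span B"
  shows "\<exists>q. poly q \<mu> \<noteq> 0 \<and> poly_op T q u = 0"
  using u
proof (induction rule: span_induct_alt)
  case base
  have "poly_op T 1 0 = 0" by (rule module_hom.zero[OF poly_op_linear[OF T]])
  then show ?case by (intro exI[of _ 1]) simp
next
  case (step c x y)
  obtain q r where q: "poly q \<mu> \<noteq> 0" "poly_op T q x = 0" and r: "poly r \<mu> \<noteq> 0" "poly_op T r y = 0"
    using B[OF step(1)] step(2) by blast
  have "poly_op T (q * r) (scale c x + y) = scale c (poly_op T r (poly_op T q x)) + poly_op T q (poly_op T r y)"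
    using module_hom.add[OF poly_op_linear[OF T]] module_hom.scale[OF poly_op_linear[OF T]]
    by (metis mult.commute poly_op_mult[OF T])
  then show ?case
    using q r module_hom.zero[OF poly_op_linear[OF T]] by (intro exI[of _ "q * r"]) simp
qed

context so_rep
begin

text \<open>A highest weight vector of the quotient by S, seen only through \<open>H\<close> and the
  \<open>R c\<close>. That the \<open>E c d\<close> with c, d >= 3 also map it into S will follow
  from the Pluecker relations in \<open>highest_mod_E\<close>.\<close>

definition highest_mod :: "'m set \<Rightarrow> complex \<Rightarrow> 'm \<Rightarrow> bool" where
  "highest_mod S b w \<longleftrightarrow> w \<in> M \<and> w \<notin> S \<and> (\<forall>c\<in>{3..N}. R c w \<in> S) \<and> H w - scale b w \<in> S"

text \<open>\<open>cas\<close> is \<open>-2\<close> times the Casimir operator, which acts by \<open>b (b + N - 2)\<close> on the irreducible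
  module with highest weight \<open>b \<epsilon>_1\<close>.\<close>

definition cas_value :: "complex \<Rightarrow> complex" where
  "cas_value b = - 2 * (b * b + of_nat (N - 2) * b)"

text \<open>Covers the polynomial corrections of a vector, which agree with a nonzero multiple of it
  modulo S.\<close>

lemma highest_mod_cong:
  assumes S: "submod S" and w: "highest_mod S b w" and w': "w' - scale c w \<in> S" "c \<noteq> 0"
  shows "highest_mod S b w'"
proof -
  note sS = submod_subspace[OF S]
  have eq: "w' = (w' - scale c w) + scale c w" by simp
  have "w' \<in> M"
    using w w' submod_subset[OF S] submod_subspace[OF submod_M] unfolding highest_mod_def
    by (subst eq) (intro subspace_add subspace_scale, auto)
  moreover have "w' \<notin> S"
  proof
    assume "w' \<in> S"
    then have "scale c w \<in> S" using subspace_diff[OF sS _ w'(1), of w'] by simp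
    then show False using subspace_scale_cancel[OF sS] w'(2) w unfolding highest_mod_def by blast
  qed
  moreover have "R d w' \<in> S" if d: "d \<in> {3..N}" for d
  proof -
    have "R d w' = R d (w' - scale c w) + scale c (R d w)" by (simp add: R_simps)
    then show ?thesis
      using submod_R[OF S d w'(1)] w d sS unfolding highest_mod_def by (simp add: subspace_add subspace_scale)
  qed
  moreover have "H w' - scale b w' \<in> S"
  proof -
    have "H w' - scale b w' = (H (w' - scale c w) - scale b (w' - scale c w)) + scale c (H w - scale b w)"
      by (simp add: H_simps algebra_simps)
    then show ?thesis
      using submod_H[OF S w'(1)] w w' sS unfolding highest_mod_def
      by (simp only: subspace_add subspace_diff subspace_scale)
  qed
  ultimately show ?thesis by (simp add: highest_mod_def)
qed

text \<open>The eigenvalues of \<open>H\<close> on K modulo S are roots of an annihilating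
  polynomial, so one has maximal real part. For its eigenvector w, an \<open>R c w\<close> outside S
  would have the eigenvalue b + 1.\<close>

lemma ex_highest_mod:
  assumes S: "submod S" and K: "submod K" and SK: "\<not> K \<subseteq> S"
  shows "\<exists>b. \<exists>w\<in>K. highest_mod S b w"
proof -
  obtain p where p: "p \<noteq> 0" "\<And>u. u \<in> M \<Longrightarrow> poly_op H p u = 0"
    using annihilating_poly_M[OF H_hom submod_H[OF submod_M]] by blast
  define \<Lambda> where "\<Lambda> = {b. \<exists>w. w \<in> K \<and> w \<notin> S \<and> H w - scale b w \<in> S}"
  obtain w0 where w0: "w0 \<in> K" "w0 \<notin> S" using SK by blast
  have pz: "poly_op H p u = 0" if "u \<in> K" for u using p(2) submod_subset[OF K] that by blast
  have "\<exists>b w'. w' \<in> K \<and> w' \<notin> S \<and> H w' - scale b w' \<in> S"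
    by (rule exists_eigenvector_mod[OF H_hom submod_subspace[OF S] submod_H[OF K] submod_subspace[OF K] p(1) _ w0])
      (simp_all add: pz w0 subspace_0 submod_subspace[OF S])
  then have ne: "\<Lambda> \<noteq> {}" by (auto simp: \<Lambda>_def)
  have "\<Lambda> \<subseteq> {x. poly p x = 0}"
  proof
    fix b assume "b \<in> \<Lambda>"
    then obtain w where w: "w \<in> K" "w \<notin> S" "H w - scale b w \<in> S" by (auto simp: \<Lambda>_def)
    have "scale (poly p b) w \<in> S"
      using poly_op_eigenvector_mod[OF H_hom submod_subspace[OF S] submod_H[OF S] w(3), of p] pz[OF w(1)]
        subspace_neg[OF submod_subspace[OF S]] by fastforce
    then have "poly p b = 0" using subspace_scale_cancel[OF submod_subspace[OF S]] w(2) by blast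
    then show "b \<in> {x. poly p x = 0}" by simp
  qed
  then have fin: "finite \<Lambda>" using poly_roots_finite[OF p(1)] finite_subset by blast
  define m where "m = Max (Re ` \<Lambda>)"
  have "m \<in> Re ` \<Lambda>" using fin ne unfolding m_def by (intro Max_in) auto
  then obtain b where b: "b \<in> \<Lambda>" "Re b = m" by auto
  then obtain w where w: "w \<in> K" "w \<notin> S" "H w - scale b w \<in> S" by (auto simp: \<Lambda>_def)
  have "R c w \<in> S" if c: "c \<in> {3..N}" for c
  proof (rule ccontr)
    assume "R c w \<notin> S"
    moreover have "H (R c w) - scale (b + 1) (R c w) = R c (H w - scale b w)"
      using c by (simp add: H_R R_simps algebra_simps)
    then have "H (R c w) - scale (b + 1) (R c w) \<in> S" using submod_R[OF S c w(3)] by simp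
    ultimately have "b + 1 \<in> \<Lambda>" using submod_R[OF K c w(1)] by (auto simp: \<Lambda>_def)
    then have "Re (b + 1) \<in> Re ` \<Lambda>" by (rule imageI)
    then have "Re (b + 1) \<le> m" using fin unfolding m_def by (intro Max_ge) auto
    then show False using b by simp
  qed
  then show ?thesis
    using w submod_subset[OF K] unfolding highest_mod_def by blast
qed

text \<open>Theory of sl(2) modulo S, for the triple with c = 3, which exists because N >=
  3.\<close>

lemma highest_mod_half_nat:
  assumes S: "submod S" and w: "highest_mod S b w"
  shows "\<exists>k::nat. b = of_nat k / 2"
proof -
  have c: "3 \<in> {3..N}" using N3 by simp
  interpret sl2_triple scale "R 3" "\<lambda>u. - L 3 u" "\<lambda>u. scale 2 (H u)"
    by (rule sl2_R[OF c])
  note sS = submod_subspace[OF S] and sM = submod_subspace[OF submod_M]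
  obtain p where p: "p \<noteq> 0" "\<And>u. u \<in> M \<Longrightarrow> poly_op (\<lambda>u. scale 2 (H u)) p u = 0"
    using annihilating_poly_M[OF h_hom subspace_scale[OF sM submod_H[OF submod_M]]] by blast
  have "\<exists>n::nat. 2 * b = of_nat n"
  proof (rule highest_weight_nat[OF sS _ _ _ _ p, where w = w])
    show "scale 2 (H w) - scale (2 * b) w \<in> S"
      using w subspace_scale[OF sS, of "H w - scale b w" 2]
      by (simp add: highest_mod_def scale_right_diff_distrib)
  qed (use w c in \<open>auto simp: highest_mod_def intro!: subspace_scale subspace_neg sS sM submod_R submod_H submod_L S submod_M\<close>)
  then obtain n :: nat where "2 * b = of_nat n" ..
  then have "b = of_nat n / 2" by (simp add: field_simps)
  then show ?thesis ..
qed

lemma cas_highest_mod: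
  assumes S: "submod S" and w: "highest_mod S b w"
    and E: "\<And>c d. c \<in> {3..N} \<Longrightarrow> d \<in> {3..N} \<Longrightarrow> E c d w \<in> S"
  shows "cas w - scale (cas_value b) w \<in> S"
proof -
  note sS = submod_subspace[OF S]
  let ?x = "H w - scale b w"
  have x: "?x \<in> S" using w by (simp add: highest_mod_def)
  have LR: "(\<Sum>c\<in>{3..N}. L c (R c w)) \<in> S"
    using w by (intro subspace_sum[OF sS] submod_L[OF S]) (auto simp: highest_mod_def)
  have EE: "(\<Sum>c\<in>{3..N}. \<Sum>d\<in>{3..N}. E c d (E c d w)) \<in> S"
    by (intro subspace_sum[OF sS] submod_E[OF S] E) auto
  have eq: "cas w - scale (cas_value b) w = scale 2 (\<Sum>c\<in>{3..N}. L c (R c w)) - scale (2 * of_nat (N - 2)) ?x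
     - scale 2 (H ?x) - scale (2 * b) ?x + (\<Sum>c\<in>{3..N}. \<Sum>d\<in>{3..N}. E c d (E c d w))"
    unfolding cas_expand cas_value_def by (simp add: H_simps algebra_simps)
  show ?thesis
    unfolding eq by (intro subspace_add subspace_diff subspace_scale sS LR EE x submod_H S)
qed

text \<open>The difference of the two values is, up to a constant, (K - L) (K + L + N - 2), and the
  second factor is positive for nonnegative weights because N >= 3.\<close>

lemma cas_value_inj:
  fixes k l :: nat
  assumes "cas_value (of_nat k / 2) = cas_value (of_nat l / 2)"
  shows "k = l"
proof -
  define K L :: real where "K = real k / 2" and "L = real l / 2"
  define n where "n = real (N - 2)"
  have K: "of_nat k / 2 = complex_of_real K" "of_nat l / 2 = complex_of_real L"
    "of_nat (N - 2) = complex_of_real n"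
    by (simp_all add: K_def L_def n_def)
  have c: "cas_value (complex_of_real x) = complex_of_real (- 2 * (x * x + n * x))" for x
    by (simp add: cas_value_def K(3))
  have "complex_of_real (- 2 * (K * K + n * K)) = complex_of_real (- 2 * (L * L + n * L))"
    using assms unfolding K c .
  then have "- 2 * (K * K + n * K) = - 2 * (L * L + n * L)"
    by (simp only: of_real_eq_iff)
  then have "K * K + n * K = L * L + n * L" by argo
  then have "(K - L) * (K + L + n) = 0" by (simp add: algebra_simps)
  moreover have "K + L + n > 0" using N3 by (simp add: K_def L_def n_def)
  ultimately have "K = L" by simp
  then show ?thesis by (simp add: K_def L_def)
qed

section \<open>Cyclic submodules generated by highest weight vectors\<close>

definition highest :: "complex \<Rightarrow> 'm \<Rightarrow> bool" where
  "highest b v \<longleftrightarrow> v \<in> M \<and> v \<noteq> 0 \<and> H v = scale b v \<and> (\<forall>c\<in>{3..N}. R c v = 0) \<and>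
    (\<forall>c\<in>{3..N}. \<forall>d\<in>{3..N}. E c d v = 0)"

lemma highest_imp_mod: "highest b v \<Longrightarrow> highest_mod {0} b v"
  by (simp add: highest_def highest_mod_def)

text \<open>Monomials in the lowering operators applied to v. The length is recorded because it is
  the drop in the eigenvalue of \<open>H\<close>.\<close>

inductive words :: "'m \<Rightarrow> nat \<Rightarrow> 'm \<Rightarrow> bool" for v where
  "words v 0 v"
| "words v k x \<Longrightarrow> c \<in> {3..N} \<Longrightarrow> words v (Suc k) (L c x)"

text \<open>Lowering words alone span the submodule generated by a highest weight vector, because
  \<open>H\<close>, \<open>E c d\<close> and \<open>R c\<close> can be moved to the right until they
  reach v; see \<open>cyclic_submod\<close>.\<close>

definition cyclic :: "'m \<Rightarrow> 'm set" where
  "cyclic v = span {x. \<exists>k. words v k x}"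

lemma words_H:
  assumes "words v k x" "highest b v"
  shows "H x = scale (b - of_nat k) x"
  using assms
proof induction
  case 1
  then show ?case by (simp add: highest_def)
next
  case (2 k x c)
  then show ?case by (simp add: H_L L_simps scale_left_diff_distrib scale_left_distrib)
qed

lemma words_cas:
  assumes "words v k x" "highest b v"
  shows "cas x = scale (cas_value b) x"
  using assms
proof induction
  case 1
  then show ?case
    using cas_highest_mod[OF submod_0 highest_imp_mod[OF 1]] by (simp add: highest_def)
next
  case (2 k x c)
  then show ?case using cas_L[of c x] by (simp add: L_simps)
qed

text \<open>The commutator of \<open>E c d\<close> with a lowering operator is zero or plus or minus
  a lowering operator, and \<open>E c d\<close> kills v; so the length of words is
  preserved.\<close>

lemma words_E:
  assumes "words v k x" "highest b v" "c \<in> {3..N}" "d \<in> {3..N}"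
  shows "E c d x \<in> span {y. words v k y}"
  using assms
proof (induction arbitrary: c d)
  case 1
  then show ?case by (simp add: highest_def span_zero)
next
  case (2 k x a)
  have "L a u \<in> span {y. words v (Suc k) y}" if "u \<in> span {y. words v k y}" for u
    using that
  proof (induction rule: span_induct_alt)
    case (step c x y)
    then have "L a x \<in> span {y. words v (Suc k) y}"
      using words.intros(2)[OF _ 2(2)] by (intro span_base) simp
    then show ?case using step by (simp add: L_simps span_add span_scale)
  qed (simp add: L_simps span_zero)
  moreover have "L c x \<in> span {y. words v (Suc k) y}" if "c \<in> {3..N}" for c
    using words.intros(2)[OF 2(1) that] by (intro span_base) simp
  ultimately show ?case
    using 2 by (auto simp: L_E intro!: span_add span_diff span_zero)
qed

lemma cyclic_L:
  assumes "u \<in> cyclic v" "c \<in> {3..N}"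
  shows "L c u \<in> cyclic v"
  using assms unfolding cyclic_def
proof (induction rule: span_induct_alt)
  case (step c' x y)
  then have "L c x \<in> span {x. \<exists>k. words v k x}"
    using words.intros(2)[OF _ assms(2)] by (intro span_base) blast
  then show ?case using step by (auto simp: L_simps intro!: span_add span_scale)
qed (simp add: L_simps span_zero)

text \<open>Moving \<open>R c\<close> past the first letter \<open>L d\<close> costs only multiples
  of \<open>E c d\<close> and \<open>H\<close> on the shorter word, which stay in the span;
  \<open>R c\<close> on the shorter word is handled by induction.\<close>

lemma words_R:
  assumes "words v k x" "highest b v" "c \<in> {3..N}"
  shows "R c x \<in> cyclic v"
  using assms
proof (induction arbitrary: c)
  case 1
  then show ?case by (simp add: highest_def cyclic_def span_zero)
next
  case (2 k x d)
  have sub: "span {y. words v k y} \<subseteq> cyclic v" unfolding cyclic_def by (intro span_mono) auto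
  have "x \<in> cyclic v" unfolding cyclic_def using 2(1) by (intro span_base) auto
  then have "H x \<in> cyclic v" using words_H[OF 2(1) 2(4)] by (simp add: cyclic_def span_scale)
  moreover have "E c d x \<in> cyclic v" using words_E[OF 2(1,4,5,2)] sub by blast
  moreover have "L d (R c x) \<in> cyclic v" using cyclic_L 2 by blast
  ultimately show ?case
    using 2 unfolding cyclic_def by (auto simp: R_L intro!: span_diff span_scale span_zero)
qed

lemma words_M: "words v k x \<Longrightarrow> v \<in> M \<Longrightarrow> x \<in> M"
  by (induction rule: words.induct) (auto intro: submod_L submod_M)

lemma cyclic_closed:
  assumes T: "module_hom scale scale T" and x: "\<And>k x. words v k x \<Longrightarrow> T x \<in> cyclic v" and u: "u \<in> cyclic v"
  shows "T u \<in> cyclic v"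
  using u unfolding cyclic_def
proof (induction rule: span_induct_alt)
  case (step c x y)
  then show ?case using x[of _ x] unfolding cyclic_def
    by (auto simp: module_hom.add[OF T] module_hom.scale[OF T] intro!: span_add span_scale)
qed (simp add: module_hom.zero[OF T] span_zero)

lemma words_in_cyclic: "words v k x \<Longrightarrow> x \<in> cyclic v"
  unfolding cyclic_def by (intro span_base) auto

lemma cyclic_submod:
  assumes v: "highest b v"
  shows "submod (cyclic v)"
proof (rule submodI)
  show "subspace (cyclic v)" by (simp add: cyclic_def subspace_span)
  show "cyclic v \<subseteq> M"
    unfolding cyclic_def using v submod_subspace[OF submod_M]
    by (intro span_minimal) (auto simp: highest_def intro: words_M)
  show "H u \<in> cyclic v" if "u \<in> cyclic v" for u
  proof (rule cyclic_closed[OF H_hom _ that])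
    fix k x assume "words v k x"
    then show "H x \<in> cyclic v"
      using words_H[OF _ v] words_in_cyclic by (simp add: cyclic_def span_scale)
  qed
  show "R c u \<in> cyclic v" if "c \<in> {3..N}" "u \<in> cyclic v" for c u
    by (rule cyclic_closed[OF R_hom words_R[OF _ v that(1)] that(2)])
  show "L c u \<in> cyclic v" if "c \<in> {3..N}" "u \<in> cyclic v" for c u
    using cyclic_L that by blast
  have sub: "span {y. words v k y} \<subseteq> cyclic v" for k unfolding cyclic_def by (intro span_mono) auto
  show "E c d u \<in> cyclic v" if "c \<in> {3..N}" "d \<in> {3..N}" "u \<in> cyclic v" for c d u
    using cyclic_closed[OF E_hom _ that(3)] words_E[OF _ v that(1,2)] sub by blast
qed

lemma cyclic_cas:
  assumes v: "highest b v" and u: "u \<in> cyclic v"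
  shows "cas u = scale (cas_value b) u"
  using u unfolding cyclic_def
proof (induction rule: span_induct_alt)
  case (step c x y)
  then show ?case using words_cas[OF _ v]
    by (auto simp: module_hom.add[OF cas_hom] module_hom.scale[OF cas_hom] scale_right_distrib mult.commute)
qed (simp add: module_hom.zero[OF cas_hom])

lemma cyclic_minimal:
  assumes "submod K" "v \<in> K"
  shows "cyclic v \<subseteq> K"
proof -
  have "x \<in> K" if "words v k x" for k x
    using that by induction (auto intro: assms submod_L)
  then show ?thesis
    unfolding cyclic_def using submod_subspace[OF assms(1)] by (intro span_minimal) auto
qed

text \<open>Separates the empty word, of weight b, from the nonempty ones, whose weights are
  lower.\<close>

lemma cyclic_decompose:
  assumes "u \<in> cyclic v"
  shows "\<exists>\<kappa> r. u = scale \<kappa> v + r \<and> r \<in> span {x. \<exists>k. words v (Suc k) x}"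
  using assms unfolding cyclic_def
proof (induction rule: span_induct_alt)
  case base
  show ?case by (rule exI[of _ 0], rule exI[of _ 0]) (simp add: span_zero)
next
  case (step c x y)
  then obtain k \<kappa> r where 1: "words v k x" "y = scale \<kappa> v + r" "r \<in> span {x. \<exists>k. words v (Suc k) x}"
    by blast
  show ?case
  proof (cases k)
    case 0
    then have "x = v" using 1(1) by (auto elim: words.cases)
    then have "scale c x + y = scale (c + \<kappa>) v + r" using 1(2) by (simp add: algebra_simps)
    then show ?thesis using 1(3) by blast
  next
    case (Suc k')
    then have "x \<in> span {x. \<exists>k. words v (Suc k) x}" using 1(1) by (intro span_base) auto
    then have "scale c x + r \<in> span {x. \<exists>k. words v (Suc k) x}"
      using 1(3) by (intro span_add span_scale)
    moreover have "scale c x + y = scale \<kappa> v + (scale c x + r)" using 1(2) by (simp add: algebra_simps)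
    ultimately show ?thesis by blast
  qed
qed

definition irr :: "'m set \<Rightarrow> bool" where
  "irr K \<longleftrightarrow> submod K \<and> K \<noteq> {0} \<and> (\<forall>K'. submod K' \<and> K' \<subseteq> K \<longrightarrow> K' = {0} \<or> K' = K)"

end

section \<open>Highest weight vectors in the presence of the Pluecker relations\<close>

locale pluecker_rep = so_rep +
  assumes pluecker: "\<And>i j k l u. i \<in> {1..N} \<Longrightarrow> j \<in> {1..N} \<Longrightarrow> k \<in> {1..N} \<Longrightarrow> l \<in> {1..N} \<Longrightarrow>
    distinct [i, j, k, l] \<Longrightarrow> E i j (E k l u) - E i k (E j l u) + E i l (E j k u) = 0"
begin

text \<open>Substituting \<open>E 2 a w\<close> = \<i> \<open>E 1 a w\<close> - \<i>
  \<open>R a w\<close> in the relation for 1, 2, c, d leaves the commutator of \<open>E 1 c\<close>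
  and \<open>E 1 d\<close>, which is - \<open>E c d\<close>, together with terms in
  \<open>R c w\<close> and \<open>R d w\<close>.\<close>

lemma pluecker_highest:
  assumes S: "submod S" and w: "\<And>c. c \<in> {3..N} \<Longrightarrow> R c w \<in> S" and cd: "c \<in> {3..N}" "d \<in> {3..N}"
  shows "H (E c d w) + E c d w \<in> S"
proof (cases "c = d")
  case True
  then show ?thesis using cd submod_subspace[OF S] by (simp add: E_same H_simps subspace_0)
next
  case False
  have in_I: "1 \<in> {1..N}" "2 \<in> {1..N}" "c \<in> {1..N}" "d \<in> {1..N}" using N3 cd by auto
  have e2: "E 2 a w = scale \<i> (E 1 a w) - scale \<i> (R a w)" for a
    by (simp add: R_def algebra_simps)
  have "scale \<i> (H (E c d w) + E c d w - (E 1 d (R c w) - E 1 c (R d w)))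
      = E 1 2 (E c d w) - E 1 c (E 2 d w) + E 1 d (E 2 c w)"
    unfolding e2 E_12
    by (simp add: E_comm_special(4)[OF cd] E_simps scale_right_distrib scale_right_diff_distrib)
  also have "\<dots> = 0"
    using pluecker[OF in_I] False cd by simp
  finally have "scale \<i> (H (E c d w) + E c d w - (E 1 d (R c w) - E 1 c (R d w))) = 0" .
  then have "H (E c d w) + E c d w = E 1 d (R c w) - E 1 c (R d w)" by simp
  then show ?thesis
    using w[OF cd(1)] w[OF cd(2)] submod_subspace[OF S] submod_E[OF S] in_I by (simp add: subspace_diff)
qed

lemma highest_mod_E:
  assumes S: "submod S" and w: "highest_mod S b w" and cd: "c \<in> {3..N}" "d \<in> {3..N}"
  shows "E c d w \<in> S"
proof -
  note sS = submod_subspace[OF S]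
  have x: "H w - scale b w \<in> S" using w by (simp add: highest_mod_def)
  have "c \<in> {1..N}" "d \<in> {1..N}" using cd by auto
  then have "E c d (H w - scale b w) \<in> S" using submod_E[OF S _ _ x] by blast
  moreover have "H (E c d w) + E c d w \<in> S"
    using pluecker_highest[OF S _ cd] w unfolding highest_mod_def by blast
  moreover have "scale (b + 1) (E c d w) = (H (E c d w) + E c d w) - E c d (H w - scale b w)"
    using H_E[OF cd] by (simp add: E_simps algebra_simps)
  ultimately have "scale (b + 1) (E c d w) \<in> S" using subspace_diff[OF sS] by simp
  \<comment> \<open>The weight b is half a natural number, hence not -1, the only value for which
    the relation would say nothing.\<close>
  moreover have "b + 1 \<noteq> 0"
  proof -
    obtain k :: nat where k: "b = of_nat k / 2" using highest_mod_half_nat[OF S w] ..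
    show ?thesis
    proof
      assume "b + 1 = 0"
      then have "of_nat (k + 2) = (0 :: complex)" by (simp add: k field_simps)
      then show False unfolding of_nat_eq_0_iff by simp
    qed
  qed
  ultimately show ?thesis using subspace_scale_cancel[OF sS] by blast
qed

lemma highestI:
  assumes "w \<in> M" "w \<noteq> 0" "\<And>c. c \<in> {3..N} \<Longrightarrow> R c w = 0" "H w = scale b w"
  shows "highest b w"
  using assms highest_mod_E[OF submod_0, of b w]
  by (simp add: highest_def highest_mod_def)

lemma highest_half_nat: "highest b v \<Longrightarrow> \<exists>k::nat. b = of_nat k / 2"
  using highest_mod_half_nat[OF submod_0 highest_imp_mod] .

text \<open>A nonzero submodule contains a vector u of highest weight. \<open>cas\<close> is a
  scalar on the cyclic module and determines the weight of u, which must be b. Nonempty words have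
  lower weights, so u is a multiple of the generator v.\<close>

lemma cyclic_irr:
  assumes v: "highest b v"
  shows "irr (cyclic v)"
  unfolding irr_def
proof (intro conjI allI impI)
  show "submod (cyclic v)" by (rule cyclic_submod[OF v])
  have vc: "v \<in> cyclic v" by (rule words_in_cyclic) (rule words.intros)
  then show "cyclic v \<noteq> {0}" using v by (auto simp: highest_def)
  fix K assume K: "submod K \<and> K \<subseteq> cyclic v"
  show "K = {0} \<or> K = cyclic v"
  proof (cases "K \<subseteq> {0}")
    case True
    then show ?thesis using K submod_subspace subspace_0 by blast
  next
    case False
    then obtain c u where u: "u \<in> K" "highest_mod {0} c u"
      using ex_highest_mod[OF submod_0] K by blast
    have uc: "u \<in> cyclic v" using u K by blast
    have "cas u = scale (cas_value c) u"
      using cas_highest_mod[OF submod_0 u(2) highest_mod_E[OF submod_0 u(2)]] by simp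
    then have "scale (cas_value c) u = scale (cas_value b) u"
      using cyclic_cas[OF v uc] by metis
    then have cv: "cas_value c = cas_value b"
      using u(2) unfolding highest_mod_def by (metis scale_cancel_right singletonI)
    have cb: "c = b"
      using cas_value_inj cv highest_mod_half_nat[OF submod_0 u(2)] highest_half_nat[OF v] by metis
    obtain \<kappa> r where r: "u = scale \<kappa> v + r" "r \<in> span {x. \<exists>k. words v (Suc k) x}"
      using cyclic_decompose[OF uc] by blast
    \<comment> \<open>Combinations of nonempty words have no component of weight b, while r = u -
      \<kappa> v has weight b; so r = 0.\<close>
    have "\<exists>q. poly q b \<noteq> 0 \<and> poly_op H q r = 0"
    proof (rule span_annihilated[OF H_hom _ r(2)])
      fix x assume "x \<in> {x. \<exists>k. words v (Suc k) x}"
      then obtain k where k: "words v (Suc k) x" by blast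
      have "poly_op H [:- (b - of_nat (Suc k)), 1:] x = 0"
        unfolding poly_op_linear_factor[OF H_hom] using words_H[OF k v] by simp
      moreover have "poly [:- (b - of_nat (Suc k)), 1:] b \<noteq> 0"
        by (simp del: of_nat_Suc)
      ultimately show "\<exists>q. poly q b \<noteq> 0 \<and> poly_op H q x = 0" by blast
    qed
    then obtain q where q: "poly q b \<noteq> 0" "poly_op H q r = 0" by blast
    have "H r = scale b r"
      using u(2) r(1) v cb by (simp add: highest_mod_def highest_def H_simps algebra_simps)
    then have "poly_op H q r = scale (poly q b) r" by (rule poly_op_eigenvector[OF H_hom])
    then have "r = 0" using q by simp
    then have "\<kappa> \<noteq> 0" "u = scale \<kappa> v" using r(1) u(2) by (auto simp: highest_mod_def)
    then have "v \<in> K"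
      using u(1) K submod_subspace subspace_scale_cancel by blast
    then show ?thesis using cyclic_minimal K by blast
  qed
qed

lemma cas_plus_H_hom: "module_hom scale scale (\<lambda>u. cas u + scale \<i> (H u))"
  by unfold_locales
    (simp_all add: H_simps module_hom.add[OF cas_hom] module_hom.scale[OF cas_hom] algebra_simps)

text \<open>\<open>R c\<close> commutes with \<open>cas\<close> and raises \<open>H\<close> by 1, so
  it shifts the eigenvalue of \<open>cas\<close> + \<i> \<open>H\<close> by \<i>.\<close>

lemma R_generalized_eigenvector:
  assumes c: "c \<in> {3..N}"
  shows "poly_op (\<lambda>u. cas u + scale \<i> (H u)) ([:- (\<tau> + \<i>), 1:] ^ k) (R c u)
    = R c (poly_op (\<lambda>u. cas u + scale \<i> (H u)) ([:- \<tau>, 1:] ^ k) u)"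
proof (induction k)
  case 0
  then show ?case
    by (simp add: one_pCons poly_op_pCons[OF cas_plus_H_hom] H_simps module_hom.zero[OF cas_hom])
next
  case (Suc k)
  show ?case
    unfolding power_Suc poly_op_mult[OF cas_plus_H_hom] Suc poly_op_linear_factor[OF cas_plus_H_hom]
    using c by (simp add: R_simps H_R cas_R algebra_simps)
qed

lemma poly_op_double_H:
  "poly_op (\<lambda>u. scale 2 (H u)) ([:- (2 * b), 1:] ^ k) u = scale (2 ^ k) (poly_op H ([:- b, 1:] ^ k) u)"
proof -
  have h: "module_hom scale scale (\<lambda>u. scale 2 (H u))"
    by unfold_locales (simp_all add: H_simps algebra_simps)
  show ?thesis
  proof (induction k)
    case 0
    then show ?case by (simp add: one_pCons poly_op_pCons[OF h] poly_op_pCons[OF H_hom] H_simps)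
  next
    case (Suc k)
    show ?case
      unfolding power_Suc poly_op_mult[OF h] poly_op_mult[OF H_hom] Suc poly_op_linear_factor[OF h]
        poly_op_linear_factor[OF H_hom]
      by (simp add: H_simps algebra_simps)
  qed
qed

text \<open>\<open>R 3 w = 0\<close> makes w a vector killed by e in an sl(2)-triple, where a
  generalized eigenvector of h is an eigenvector; the triple has h = 2 \<open>H\<close>, whence
  \<open>poly_op_double_H\<close>.\<close>

lemma highest_if_R_0:
  assumes w: "w \<in> M" "w \<noteq> 0" "\<And>c. c \<in> {3..N} \<Longrightarrow> R c w = 0"
    and g: "poly_op H ([:- b, 1:] ^ k) w = 0"
  shows "highest b w"
proof -
  have c: "3 \<in> {3..N}" using N3 by simp
  interpret sl2_triple scale "R 3" "\<lambda>u. - L 3 u" "\<lambda>u. scale 2 (H u)"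
    by (rule sl2_R[OF c])
  note sM = submod_subspace[OF submod_M]
  obtain p where p: "p \<noteq> 0" "\<And>u. u \<in> M \<Longrightarrow> poly_op (\<lambda>u. scale 2 (H u)) p u = 0"
    using annihilating_poly_M[OF h_hom subspace_scale[OF sM submod_H[OF submod_M]]] by blast
  have "scale 2 (H w) = scale (2 * b) w"
  proof (rule highest_vector_semisimple[OF _ p w(1) w(3)[OF c]])
    show "- L 3 u \<in> M" if "u \<in> M" for u
      by (intro subspace_neg[OF sM] submod_L[OF submod_M c that])
    show "poly_op (\<lambda>u. scale 2 (H u)) ([:- (2 * b), 1:] ^ k) w = 0"
      by (simp only: poly_op_double_H g scale_zero_right)
  qed
  then have "scale 2 (H w - scale b w) = 0" by (simp add: scale_right_diff_distrib)
  then have "H w = scale b w" by simp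
  then show ?thesis using highestI w by blast
qed

lemma span_irr: "span (\<Union>{K. irr K}) = M"
proof -
  note sM = submod_subspace[OF submod_M]
  define S where "S = span (\<Union>{cyclic v | v. \<exists>b. highest b v})"
  \<comment> \<open>S is spanned by common eigenvectors of \<open>cas\<close> and \<open>H\<close>,
    so the eigenvalues of \<open>cas\<close> + \<i> \<open>H\<close> on S are explicit.\<close>
  define B where "B = {x. \<exists>b v k. highest b v \<and> words v k x}"
  have SB: "S = span B"
  proof -
    have "cyclic v \<subseteq> span B" if "highest b v" for b v
      unfolding cyclic_def B_def using that by (intro span_mono) auto
    then have "S \<subseteq> span B" unfolding S_def by (intro span_minimal) auto
    moreover have "B \<subseteq> S" unfolding B_def S_def using words_in_cyclic by (blast intro: span_base)
    then have "span B \<subseteq> S" unfolding S_def by (intro span_minimal) auto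
    ultimately show ?thesis by blast
  qed
  have "S \<subseteq> M"
    unfolding S_def using sM cyclic_submod submod_subset by (intro span_minimal) auto
  have S: "submod S"
    unfolding submod_def
  proof (intro conjI ballI)
    show "subspace S" "S \<subseteq> M" by (simp_all add: S_def[symmetric] \<open>S \<subseteq> M\<close>) (simp add: S_def)
    fix i j u assume ij: "i \<in> {1..N}" "j \<in> {1..N}" and "u \<in> S"
    from this(3) show "E i j u \<in> S" unfolding S_def
    proof (induction rule: span_induct_alt)
      case (step c x y)
      then obtain b v where v: "highest b v" "x \<in> cyclic v" by blast
      then have "E i j x \<in> cyclic v" using submod_E[OF cyclic_submod ij] by blast
      then have "E i j x \<in> span (\<Union>{cyclic v | v. \<exists>b. highest b v})"
        using v by (intro span_base) auto
      then show ?case using step by (simp add: E_simps span_add span_scale)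
    qed (simp add: E_simps span_zero)
  qed
  note sS = submod_subspace[OF S]
  let ?T = "\<lambda>u. cas u + scale \<i> (H u)"
  note T = cas_plus_H_hom
  have TM: "?T u \<in> M" if "u \<in> M" for u
    using that by (intro subspace_add subspace_scale sM submod_cas submod_H submod_M)
  have TS: "?T u \<in> S" if "u \<in> S" for u
    using that by (intro subspace_add subspace_scale sS submod_cas submod_H S)
  have HT: "H (?T u) = ?T (H u)" for u
    by (simp add: H_simps cas_H)
  have "M \<subseteq> S"
  proof (rule ccontr)
    assume "\<not> M \<subseteq> S"
    then obtain b w where w: "highest_mod S b w" using ex_highest_mod[OF S submod_M] by blast
    have bw: "H w - scale b w \<in> S" "w \<notin> S" "w \<in> M" using w by (auto simp: highest_mod_def)
    obtain p where p: "p \<noteq> 0" "\<And>u. u \<in> M \<Longrightarrow> poly_op H p u = 0"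
      using annihilating_poly_M[OF H_hom submod_H[OF submod_M]] by blast
    obtain q k where q: "poly_op H ([:- b, 1:] ^ k) (poly_op H q w) = 0" "poly q b \<noteq> 0"
      "poly_op H q w - scale (poly q b) w \<in> S"
      \<comment> \<open>First correction: a polynomial in \<open>H\<close> makes w a generalized
        eigenvector of \<open>H\<close> exactly, without changing its weight modulo S.\<close>
      using exists_generalized_eigenvector_mod[OF H_hom sS submod_H[OF S] p(1) p(2)[OF bw(3)] bw(1,2)] by blast
    define w1 where "w1 = poly_op H q w"
    have w1: "highest_mod S b w1"
      using highest_mod_cong[OF S w q(3) q(2)] by (simp add: w1_def)
    define \<tau> where "\<tau> = cas_value b + \<i> * b"
    have "?T w1 - scale \<tau> w1 = (cas w1 - scale (cas_value b) w1) + scale \<i> (H w1 - scale b w1)"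
      by (simp add: \<tau>_def algebra_simps)
    then have Tw1: "?T w1 - scale \<tau> w1 \<in> S"
      using cas_highest_mod[OF S w1 highest_mod_E[OF S w1]] w1 sS
      by (simp only: highest_mod_def subspace_add subspace_scale)
    have w1': "w1 \<in> M" "w1 \<notin> S" using w1 by (auto simp: highest_mod_def)
    obtain p' where p': "p' \<noteq> 0" "\<And>u. u \<in> M \<Longrightarrow> poly_op ?T p' u = 0"
      using annihilating_poly_M[OF T TM] by blast
    obtain q' m where q': "poly_op ?T ([:- \<tau>, 1:] ^ m) (poly_op ?T q' w1) = 0" "poly q' \<tau> \<noteq> 0"
      "poly_op ?T q' w1 - scale (poly q' \<tau>) w1 \<in> S"
      \<comment> \<open>Second correction, now for \<open>cas\<close> + \<i> \<open>H\<close> and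
        its eigenvalue \<tau> modulo S.\<close>
      using exists_generalized_eigenvector_mod[OF T sS TS p'(1) p'(2)[OF w1'(1)] Tw1 w1'(2)] by blast
    define w2 where "w2 = poly_op ?T q' w1"
    have w2: "highest_mod S b w2"
      using highest_mod_cong[OF S w1 q'(3) q'(2)] by (simp add: w2_def)
    \<comment> \<open>The two operators commute, so the second correction preserves what the first
      one achieved.\<close>
    have "poly_op H ([:- b, 1:] ^ k) w2 = poly_op ?T q' (poly_op H ([:- b, 1:] ^ k) w1)"
      unfolding w2_def
      by (intro poly_op_commute[OF T poly_op_linear[OF H_hom]] poly_op_commute[OF H_hom T, symmetric]) (simp add: HT)
    then have gH: "poly_op H ([:- b, 1:] ^ k) w2 = 0"
      using q(1) by (simp add: w1_def module_hom.zero[OF poly_op_linear[OF T]])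
    have R0: "R c w2 = 0" if c: "c \<in> {3..N}" for c
    proof -
      have RS: "R c w2 \<in> span B" using w2 c by (simp add: highest_mod_def SB)
      have "poly_op ?T ([:- (\<tau> + \<i>), 1:] ^ m) (R c w2) = 0"
        unfolding R_generalized_eigenvector[OF c] using q'(1) by (simp add: w2_def R_simps)
      moreover have "\<exists>q. poly q (\<tau> + \<i>) \<noteq> 0 \<and> poly_op ?T q (R c w2) = 0"
      proof (rule span_annihilated[OF T _ RS])
        fix x assume "x \<in> B"
        then obtain a v l where x: "highest a v" "words v l x" by (auto simp: B_def)
        let ?\<mu> = "cas_value a + \<i> * (a - of_nat l)"
        have "?T x = scale ?\<mu> x"
          by (simp only: words_H[OF x(2,1)] words_cas[OF x(2,1)] scale_scale scale_left_distrib)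
        then have "poly_op ?T [:- ?\<mu>, 1:] x = 0"
          unfolding poly_op_linear_factor[OF T] by simp
        moreover have "poly [:- ?\<mu>, 1:] (\<tau> + \<i>) \<noteq> 0"
        proof
          assume "poly [:- ?\<mu>, 1:] (\<tau> + \<i>) = 0"
          then have eq: "cas_value b + \<i> * (b + 1) = cas_value a + \<i> * (a - of_nat l)"
            by (simp add: \<tau>_def algebra_simps)
          obtain i j :: nat where ij: "a = of_nat i / 2" "b = of_nat j / 2"
            using highest_half_nat[OF x(1)] highest_mod_half_nat[OF S w] by blast
          \<comment> \<open>Reality of the values of \<open>cas\<close> lets the real and imaginary
            parts of \<open>eq\<close> be read as separate equations.\<close>
          have im: "Im (cas_value (of_nat i / 2)) = 0" for i :: nat
            by (simp add: cas_value_def)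
          have "Re (cas_value b) = Re (cas_value a)" and Im: "Re (b + 1) = Re (a - of_nat l)"
            using arg_cong[OF eq, of Re] arg_cong[OF eq, of Im] im[of i] im[of j] by (simp_all add: ij)
          then have "cas_value b = cas_value a" using im[of i] im[of j] by (simp add: complex_eq_iff ij)
          then have "j = i" using cas_value_inj by (simp add: ij)
          then show False using Im by (simp add: ij)
        qed
        ultimately show "\<exists>q. poly q (\<tau> + \<i>) \<noteq> 0 \<and> poly_op ?T q x = 0" by blast
      qed
      ultimately show ?thesis using generalized_eigenvector_eq_0[OF T] by blast
    qed
    have w2': "w2 \<in> M" "w2 \<notin> S" using w2 by (auto simp: highest_mod_def)
    then have "w2 \<noteq> 0" using sS subspace_0 by blast
    then have "highest b w2" using highest_if_R_0[OF w2'(1) _ R0 gH] by blast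
    then have "w2 \<in> B" unfolding B_def using words.intros(1) by blast
    then show False using w2'(2) SB span_base by blast
  qed
  moreover have "S \<subseteq> span (\<Union>{K. irr K})"
    unfolding S_def using cyclic_irr by (intro span_mono) auto
  moreover have "span (\<Union>{K. irr K}) \<subseteq> M"
    using sM submod_subset by (intro span_minimal) (auto simp: irr_def)
  ultimately show ?thesis using \<open>S \<subseteq> M\<close> by blast
qed

end

section \<open>Direct sums of irreducible submodules\<close>

context so_rep
begin

lemma submod_Int: "submod A \<Longrightarrow> submod B \<Longrightarrow> submod (A \<inter> B)"
  by (auto simp: submod_def intro: subspace_inter)

lemma submod_span_Union:
  assumes "\<And>K. K \<in> F \<Longrightarrow> submod K"
  shows "submod (span (\<Union>F))"
  unfolding submod_def
proof (intro conjI ballI)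
  show "span (\<Union>F) \<subseteq> M"
    using submod_subspace[OF submod_M] submod_subset[OF assms] by (intro span_minimal) auto
  fix i j u assume ij: "i \<in> {1..N}" "j \<in> {1..N}" and "u \<in> span (\<Union>F)"
  from this(3) show "E i j u \<in> span (\<Union>F)"
  proof (induction rule: span_induct_alt)
    case (step c x y)
    then have "E i j x \<in> \<Union>F" using submod_E[OF assms ij] by blast
    then show ?case using step by (simp add: E_simps span_add span_scale span_base)
  qed (simp add: E_simps span_zero)
qed simp

text \<open>Greedy selection: by irreducibility, each new K lies in the span of those chosen so far
  or meets it only in 0.\<close>

lemma independent_subfamily:
  assumes "finite G" "\<And>K. K \<in> G \<Longrightarrow> irr K"
  shows "\<exists>F\<subseteq>G. span (\<Union>F) = span (\<Union>G) \<and> (\<forall>K\<in>F. K \<inter> span (\<Union>(F - {K})) = {0})"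
  using assms
proof (induction G)
  case (insert K G)
  then obtain F where F: "F \<subseteq> G" "span (\<Union>F) = span (\<Union>G)" "\<forall>K\<in>F. K \<inter> span (\<Union>(F - {K})) = {0}"
    by auto
  have sF: "submod (span (\<Union>F))"
    using F(1) insert.prems by (intro submod_span_Union) (auto simp: irr_def)
  have K: "irr K" using insert.prems by blast
  then have sK: "submod K" by (simp add: irr_def)
  show ?case
  proof (cases "K \<subseteq> span (\<Union>F)")
    case True
    have "span (\<Union>(insert K G)) = span (\<Union>G)"
    proof
      show "span (\<Union>(insert K G)) \<subseteq> span (\<Union>G)"
        using True F(2) span_superset[of "\<Union>G"] by (intro span_minimal) auto
      show "span (\<Union>G) \<subseteq> span (\<Union>(insert K G))" by (intro span_mono) auto
    qed
    then show ?thesis using F by (intro exI[of _ F]) auto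
  next
    case False
    have disj: "K \<inter> span (\<Union>F) = {0}"
      using K submod_Int[OF sK sF] False unfolding irr_def by blast
    let ?F = "insert K F"
    have "K \<notin> F" using False span_superset by blast
    have "span (\<Union>?F) = span (\<Union>(insert K G))"
    proof
      show "span (\<Union>?F) \<subseteq> span (\<Union>(insert K G))" using F(1) by (intro span_mono) auto
      have "G \<subseteq> {A. A \<subseteq> span (\<Union>F)}" using F(2) span_superset[of "\<Union>G"] by auto
      moreover have "span (\<Union>F) \<subseteq> span (\<Union>?F)" by (intro span_mono) auto
      moreover have "K \<subseteq> span (\<Union>?F)" using span_superset[of "\<Union>?F"] by auto
      ultimately show "span (\<Union>(insert K G)) \<subseteq> span (\<Union>?F)"
        by (intro span_minimal) auto
    qed
    moreover have "A \<inter> span (\<Union>(?F - {A})) = {0}" if A: "A \<in> ?F" for A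
    proof (cases "A = K")
      case True
      then show ?thesis using disj \<open>K \<notin> F\<close> by simp
    next
      case neq: False
      then have AF: "A \<in> F" using A by blast
      have sA: "submod A" using AF F(1) insert.prems by (auto simp: irr_def)
      have eq: "\<Union>(?F - {A}) = K \<union> \<Union>(F - {A})" using neq by blast
      \<comment> \<open>Write x = k + y with k in K. Both x and y lie in the old span, hence so does
        k, which is therefore 0; then independence of the old family applies to x = y.\<close>
      have "x = 0" if x: "x \<in> A" "x \<in> span (\<Union>(?F - {A}))" for x
      proof -
        have "x \<in> span (K \<union> \<Union>(F - {A}))" using x(2) unfolding eq .
        then obtain k y where ky: "x = k + y" "k \<in> span K" "y \<in> span (\<Union>(F - {A}))"
          unfolding span_Un by blast
        have kK: "k \<in> K" using ky(2) submod_subspace[OF sK] by (simp add: span_eq_iff[THEN iffD2])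
        have yF: "y \<in> span (\<Union>F)" using ky(3) span_mono[of "\<Union>(F - {A})" "\<Union>F"] by blast
        have "x \<in> span (\<Union>F)" using x(1) AF by (intro span_base) auto
        then have "x - y \<in> span (\<Union>F)" using yF by (rule span_diff)
        then have "k \<in> span (\<Union>F)" using ky(1) by simp
        then have "k = 0" using disj kK by blast
        then show "x = 0" using F(3) AF x(1) ky by auto
      qed
      moreover have "0 \<in> A" using sA submod_subspace subspace_0 by blast
      ultimately show ?thesis by (auto simp: span_zero)
    qed
    ultimately show ?thesis using F(1) by (intro exI[of _ ?F]) auto
  qed
qed auto

lemma span_Union_finite:
  assumes "x \<in> span (\<Union>G)"
  shows "\<exists>F\<subseteq>G. finite F \<and> x \<in> span (\<Union>F)"
  using assms
proof (induction rule: span_induct_alt)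
  case base
  show ?case by (intro exI[of _ "{}"]) simp
next
  case (step c x y)
  then obtain F K where F: "F \<subseteq> G" "finite F" "y \<in> span (\<Union>F)" "x \<in> K" "K \<in> G" by blast
  have "y \<in> span (\<Union>(insert K F))" using F(3) span_mono[of "\<Union>F" "\<Union>(insert K F)"] by auto
  moreover have "x \<in> span (\<Union>(insert K F))" using F by (intro span_base) auto
  ultimately show ?case using F by (intro exI[of _ "insert K F"]) (auto intro: span_add span_scale)
qed

text \<open>A finite generating set of \<open>M\<close> involves only finitely many irreducible
  submodules, so a finite selection suffices in place of a maximality argument.\<close>

lemma direct_sum_of_irr:
  assumes "span (\<Union>{K. irr K}) = M"
  shows "\<exists>F. (\<forall>K\<in>F. irr K) \<and> span (\<Union>F) = M \<and> (\<forall>K\<in>F. K \<inter> span (\<Union>(F - {K})) = {0})"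
proof -
  obtain B where B: "finite B" "M = span B" using fin_dim by blast
  have "\<forall>x\<in>B. \<exists>F\<subseteq>{K. irr K}. finite F \<and> x \<in> span (\<Union>F)"
    using span_Union_finite assms B span_base by metis
  then obtain \<F> where FF: "\<And>x. x \<in> B \<Longrightarrow> \<F> x \<subseteq> {K. irr K} \<and> finite (\<F> x) \<and> x \<in> span (\<Union>(\<F> x))"
    by metis
  define G where "G = \<Union>(\<F> ` B)"
  have G: "finite G" "\<And>K. K \<in> G \<Longrightarrow> irr K" using B FF by (auto simp: G_def)
  have "B \<subseteq> span (\<Union>G)"
  proof
    fix x assume x: "x \<in> B"
    then have "span (\<Union>(\<F> x)) \<subseteq> span (\<Union>G)" by (intro span_mono) (auto simp: G_def)
    then show "x \<in> span (\<Union>G)" using FF[OF x] by blast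
  qed
  then have "M \<subseteq> span (\<Union>G)" unfolding B(2) by (intro span_minimal) auto
  moreover have "span (\<Union>G) \<subseteq> M"
    using submod_subspace[OF submod_M] G(2) submod_subset by (intro span_minimal) (auto simp: irr_def)
  ultimately have "span (\<Union>G) = M" by blast
  then show ?thesis using independent_subfamily[OF G] G(2) by (metis subsetD)
qed

end

section \<open>The Pluecker relations\<close>

context so_rep
begin

text \<open>Splits doubled coefficients into equal summands, so that terms cancel when sl(2)
  relations are checked.\<close>

lemma scale_double_mult: "scale (2 * c) u = scale c u + scale c u" "scale (c * 2) u = scale c u + scale c u"
    "scale (r * (c * 2)) u = scale (r * c) u + scale (r * c) u"
    "scale (c / 2) u = scale (c / 4) u + scale (c / 4) u"
  by (simp_all only: mult_2 mult_2_right distrib_left scale_left_distrib[symmetric])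
    (simp_all add: field_simps)

text \<open>The triple of \<open>sl2_R\<close> with an arbitrary pair p, q in place of 1, 2; needed
  for the planes with indices 2k - 1 and 2k.\<close>

lemma sl2_pair:
  assumes I: "p \<in> {1..N}" "q \<in> {1..N}" "c \<in> {1..N}" and ne: "distinct [p, q, c]"
  shows "sl2_triple scale (\<lambda>u. E p c u + scale \<i> (E q c u)) (\<lambda>u. scale \<i> (E q c u) - E p c u)
    (\<lambda>u. scale (- 2 * \<i>) (E p q u))"
proof -
  have c: "E p q (E p c u) = E p c (E p q u) - E q c u" "E p q (E q c u) = E q c (E p q u) + E p c u"
    "E q c (E p c u) = E p c (E q c u) + E p q u" for u
    using I ne E_comm[of p q p c u] E_comm[of p q q c u] E_comm[of q c p c u] E_anti[of p q u] by auto
  show ?thesis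
    by unfold_locales
      (simp_all add: E_simps c scale_right_distrib scale_right_diff_distrib scale_double scale_double_mult algebra_simps)
qed

text \<open>The vector \<open>f v\<close> would have weight \<open>-2\<close>.\<close>

lemma lowering_weight_0:
  assumes sl2: "sl2_triple scale e f h"
    and M: "\<And>u. u \<in> M \<Longrightarrow> f u \<in> M" "\<And>u. u \<in> M \<Longrightarrow> h u \<in> M"
    and v: "v \<in> M" "e v = 0" "h v = 0"
  shows "f v = 0"
proof (rule ccontr)
  assume nz: "f v \<noteq> 0"
  interpret sl2_triple scale e f h by fact
  obtain p where p: "p \<noteq> 0" "\<And>u. u \<in> M \<Longrightarrow> poly_op h p u = 0"
    using annihilating_poly_M[OF h_hom M(2)] by blast
  have "\<exists>n::nat. - 2 = (of_nat n :: complex)"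
    by (rule highest_weight_nat[OF subspace_single_0 _ _ _ M(1) p, where w = "f v"])
      (use v nz in \<open>simp_all add: triple_hom_simps M h_f e_f\<close>)
  then obtain n :: nat where "- 2 = (of_nat n :: complex)" ..
  then have "of_nat (n + 2) = (0 :: complex)" by (simp add: add_eq_0_iff)
  then show False unfolding of_nat_eq_0_iff by simp
qed

text \<open>In the triple of \<open>sl2_pair\<close> the vector v has e v = 0 and h v = 0, so also f
  v = 0; the two generators are combinations of e and f.\<close>

lemma tail_zero:
  assumes v: "v \<in> M" and I: "p \<in> {1..N}" "q \<in> {1..N}" "c \<in> {1..N}" "distinct [p, q, c]"
    and R: "E p c v + scale \<i> (E q c v) = 0" and H: "E p q v = 0"
  shows "E p c v = 0 \<and> E q c v = 0"
proof -
  have "scale \<i> (E q c v) - E p c v = 0"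
  proof (rule lowering_weight_0[OF sl2_pair[OF I]])
    note sM = submod_subspace[OF submod_M]
    show "scale \<i> (E q c u) - E p c u \<in> M" "scale (- 2 * \<i>) (E p q u) \<in> M" for u
      by (intro subspace_diff[OF sM] subspace_scale[OF sM] E_in_M)+
  qed (use v R H in simp_all)
  then have eq: "E p c v = scale \<i> (E q c v)" by simp
  with R have "scale 2 (scale \<i> (E q c v)) = 0" by (simp only: scale_double)
  then have "E q c v = 0" by simp
  then show ?thesis using eq by simp
qed

text \<open>The Pfaffian of the skew 4 by 4 block of operators with rows and columns i, j, k,
  l.\<close>

definition pl :: "nat \<Rightarrow> nat \<Rightarrow> nat \<Rightarrow> nat \<Rightarrow> 'm \<Rightarrow> 'm" where
  "pl i j k l u = E i j (E k l u) - E i k (E j l u) + E i l (E j k u)"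

lemma pl_hom: "module_hom scale scale (pl i j k l)"
  by unfold_locales (simp_all add: pl_def E_simps algebra_simps)

text \<open>The index conditions become scalars, so that expansions such as \<open>E_pl\<close> are
  linear identities without case splits.\<close>

lemma E_comm_scaled:
  assumes "a \<in> {1..N}" "b \<in> {1..N}" "i \<in> {1..N}" "j \<in> {1..N}"
  shows "E a b (E i j u) = E i j (E a b u) + (scale (of_bool (b = i)) (E a j u) - scale (of_bool (a = i)) (E b j u)
    + scale (of_bool (b = j)) (E i a u) - scale (of_bool (a = j)) (E i b u))"
  using E_comm[OF assms, of u] E_anti[of i a u] E_anti[of i b u] E_same[of i u] E_same[of j u] assms by auto

text \<open>Commutation with \<open>E a b\<close> is a derivation that acts on each of the four
  indices separately, as on a tensor.\<close>

lemma E_pl: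
  assumes ab: "a \<in> {1..N}" "b \<in> {1..N}" and I: "i \<in> {1..N}" "j \<in> {1..N}" "k \<in> {1..N}" "l \<in> {1..N}"
  shows "E a b (pl i j k l u) = pl i j k l (E a b u)
    + (scale (of_bool (b = i)) (pl a j k l u) - scale (of_bool (a = i)) (pl b j k l u))
    + (scale (of_bool (b = j)) (pl i a k l u) - scale (of_bool (a = j)) (pl i b k l u))
    + (scale (of_bool (b = k)) (pl i j a l u) - scale (of_bool (a = k)) (pl i j b l u))
    + (scale (of_bool (b = l)) (pl i j k a u) - scale (of_bool (a = l)) (pl i j k b u))"
  unfolding pl_def
  by (simp only: E_simps E_comm_scaled[OF ab I(1) I(2)] E_comm_scaled[OF ab I(1) I(3)]
      E_comm_scaled[OF ab I(1) I(4)] E_comm_scaled[OF ab I(2) I(3)] E_comm_scaled[OF ab I(2) I(4)]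
      E_comm_scaled[OF ab I(3) I(4)])
    (simp only: scale_right_distrib scale_right_diff_distrib algebra_simps)

text \<open>The entries do not commute, so a repeated index need not give 0: the first three
  patterns leave a single generator.\<close>

lemma pl_repeated:
  assumes I: "x \<in> {1..N}" "y \<in> {1..N}" "z \<in> {1..N}" and d: "distinct [x, y, z]"
  shows "pl x x y z u = E y z u" "pl x y x z u = - E y z u" "pl x y z x u = E y z u"
    "pl y x x z u = 0" "pl y x z x u = 0" "pl y z x x u = 0"
proof -
  have c: "E x y (E x z u) = E x z (E x y u) - E y z u"
    using E_comm[of x y x z u] I d E_same[of x u] E_anti[of x y u] by auto
  have n: "E y x u = - E x y u" "E z x u = - E x z u" for u
    using E_anti I by blast+
  show "pl x x y z u = E y z u" "pl x y x z u = - E y z u" "pl x y z x u = E y z u"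
    "pl y x x z u = 0" "pl y x z x u = 0" "pl y z x x u = 0"
    using I by (simp_all add: pl_def E_same E_simps c n)
qed

text \<open>By \<open>E_pl\<close>, a relation applied to \<open>E a b u\<close> is a combination of
  relations on u with one index replaced. If the new index is fresh, these vanish on u; if both a
  and b are among the indices, they degenerate as in \<open>pl_repeated\<close> and the leftovers
  cancel in pairs.\<close>

lemma pl_zero_set_submod:
  "submod {u \<in> M. \<forall>i\<in>{1..N}. \<forall>j\<in>{1..N}. \<forall>k\<in>{1..N}. \<forall>l\<in>{1..N}. distinct [i, j, k, l] \<longrightarrow> pl i j k l u = 0}"
    (is "submod ?Z")
  unfolding submod_def
proof (intro conjI ballI)
  have "subspace M" by (rule submod_subspace[OF submod_M])
  then show "subspace ?Z"
    by (simp add: subspace_def module_hom.zero[OF pl_hom] module_hom.add[OF pl_hom] module_hom.scale[OF pl_hom])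
  show "?Z \<subseteq> M" by blast
  fix a b u assume ab: "a \<in> {1..N}" "b \<in> {1..N}" and u: "u \<in> ?Z"
  have z: "pl i j k l u = 0" if "i \<in> {1..N}" "j \<in> {1..N}" "k \<in> {1..N}" "l \<in> {1..N}" "distinct [i, j, k, l]"
    for i j k l using u that by blast
  have "pl i j k l (E a b u) = 0"
    if I: "i \<in> {1..N}" "j \<in> {1..N}" "k \<in> {1..N}" "l \<in> {1..N}" and d: "distinct [i, j, k, l]" for i j k l
  proof (cases "a = b")
    case True
    then show ?thesis using ab by (simp add: E_same pl_def E_simps)
  next
    case False
    have "E a b (pl i j k l u) = 0" by (simp only: z[OF I d] E_simps)
    then have eq: "pl i j k l (E a b u) = 
      - ((scale (of_bool (b = i)) (pl a j k l u) - scale (of_bool (a = i)) (pl b j k l u))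
    + (scale (of_bool (b = j)) (pl i a k l u) - scale (of_bool (a = j)) (pl i b k l u))
    + (scale (of_bool (b = k)) (pl i j a l u) - scale (of_bool (a = k)) (pl i j b l u))
    + (scale (of_bool (b = l)) (pl i j k a u) - scale (of_bool (a = l)) (pl i j k b u)))"
      unfolding E_pl[OF ab I] by (simp only: eq_neg_iff_add_eq_0 add.assoc)
    have ne: "i \<noteq> j" "i \<noteq> k" "i \<noteq> l" "j \<noteq> k" "j \<noteq> l" "k \<noteq> l"
      "j \<noteq> i" "k \<noteq> i" "l \<noteq> i" "k \<noteq> j" "l \<noteq> j" "l \<noteq> k" using d by auto
    have I': "1 \<le> i" "i \<le> N" "1 \<le> j" "j \<le> N" "1 \<le> k" "k \<le> N" "1 \<le> l" "l \<le> N"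
      "1 \<le> a" "a \<le> N" "1 \<le> b" "b \<le> N" using I ab by auto
    consider "a \<notin> {i,j,k,l}" | "a = i" | "a = j" | "a = k" | "a = l" by blast
    then show ?thesis
    proof cases
      case 1
      have na: "a \<noteq> i" "a \<noteq> j" "a \<noteq> k" "a \<noteq> l" "i \<noteq> a" "j \<noteq> a" "k \<noteq> a" "l \<noteq> a"
        using 1 by auto
      consider "b \<noteq> i" "b \<noteq> j" "b \<noteq> k" "b \<noteq> l" "i \<noteq> b" "j \<noteq> b" "k \<noteq> b" "l \<noteq> b" | "b = i" | "b = j" | "b = k" | "b = l" by blast
      then show ?thesis unfolding eq by cases (simp_all add: z ne na I')
    next
      case 2
      consider "b \<noteq> i" "b \<noteq> j" "b \<noteq> k" "b \<noteq> l" "i \<noteq> b" "j \<noteq> b" "k \<noteq> b" "l \<noteq> b" | "b = j" | "b = k" | "b = l" using 2 False by blast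
      then show ?thesis unfolding eq by cases (use I' in \<open>simp_all add: 2 z ne pl_repeated\<close>)
    next
      case 3
      consider "b \<noteq> i" "b \<noteq> j" "b \<noteq> k" "b \<noteq> l" "i \<noteq> b" "j \<noteq> b" "k \<noteq> b" "l \<noteq> b" | "b = i" | "b = k" | "b = l" using 3 False by blast
      then show ?thesis unfolding eq by cases (use I' in \<open>simp_all add: 3 z ne pl_repeated\<close>)
    next
      case 4
      consider "b \<noteq> i" "b \<noteq> j" "b \<noteq> k" "b \<noteq> l" "i \<noteq> b" "j \<noteq> b" "k \<noteq> b" "l \<noteq> b" | "b = i" | "b = j" | "b = l" using 4 False by blast
      then show ?thesis unfolding eq by cases (use I' in \<open>simp_all add: 4 z ne pl_repeated\<close>)
    next
      case 5
      consider "b \<noteq> i" "b \<noteq> j" "b \<noteq> k" "b \<noteq> l" "i \<noteq> b" "j \<noteq> b" "k \<noteq> b" "l \<noteq> b" | "b = i" | "b = j" | "b = k" using 5 False by blast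
      then show ?thesis unfolding eq by cases (use I' in \<open>simp_all add: 5 z ne pl_repeated\<close>)
    qed
  qed
  then show "E a b u \<in> ?Z" using E_in_M by blast
qed

lemma pl_swap:
  assumes I: "i \<in> {1..N}" "j \<in> {1..N}" "k \<in> {1..N}" "l \<in> {1..N}" and d: "distinct [i, j, k, l]"
  shows "pl j i k l u = - pl i j k l u" "pl i k j l u = - pl i j k l u" "pl i j l k u = - pl i j k l u"
proof -
  have a: "E j i u = - E i j u" "E k j u = - E j k u" "E l k u = - E k l u" for u
    using E_anti I by blast+
  have c: "E i k (E j l u) = E j l (E i k u)" "E i l (E j k u) = E j k (E i l u)"
    using E_comm[of i k j l u] E_comm[of i l j k u] I d by auto
  show "pl j i k l u = - pl i j k l u" "pl i k j l u = - pl i j k l u" "pl i j l k u = - pl i j k l u"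
    by (simp_all add: pl_def a E_simps c)
qed

text \<open>On distinct indices \<open>pl\<close> is alternating, so it is enough to have increasing
  ones. The sort fixes the last two indices first, then the last three, then all four.\<close>

lemma pl_zero_sorted:
  assumes "\<And>i j k l. i \<in> {1..N} \<Longrightarrow> l \<in> {1..N} \<Longrightarrow> i < j \<Longrightarrow> j < k \<Longrightarrow> k < l \<Longrightarrow> pl i j k l u = 0"
    and I: "i \<in> {1..N}" "j \<in> {1..N}" "k \<in> {1..N}" "l \<in> {1..N}" and d: "distinct [i, j, k, l]"
  shows "pl i j k l u = 0"
proof -
  have sw: "pl j i k l u = 0 \<longleftrightarrow> pl i j k l u = 0" "pl i k j l u = 0 \<longleftrightarrow> pl i j k l u = 0"
    "pl i j l k u = 0 \<longleftrightarrow> pl i j k l u = 0"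
    if "i \<in> {1..N}" "j \<in> {1..N}" "k \<in> {1..N}" "l \<in> {1..N}" "distinct [i, j, k, l]" for i j k l
    using pl_swap[OF that, of u] by auto
  have last3: "pl i j k l u = 0" if "i \<in> {1..N}" "j \<in> {1..N}" "k \<in> {1..N}" "l \<in> {1..N}" "distinct [i, j, k, l]"
    "j < k" "k < l" for i j k l
  proof -
    note d = that(5)
    consider "i < j" | "j < i" "i < k" | "k < i" "i < l" | "l < i" using d by fastforce
    then show ?thesis
    proof cases
      case 1 then show ?thesis using assms(1) that by blast
    next
      case 2
      then have "pl j i k l u = 0" using assms(1) that by blast
      then show ?thesis using sw(1) that by auto
    next
      case 3
      then have "pl j k i l u = 0" using assms(1) that by blast
      then have "pl j i k l u = 0" using sw(2)[of j k i l] that by auto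
      then show ?thesis using sw(1) that by auto
    next
      case 4
      then have "pl j k l i u = 0" using assms(1) that by blast
      then have "pl j k i l u = 0" using sw(3)[of j k l i] that by auto
      then have "pl j i k l u = 0" using sw(2)[of j k i l] that by auto
      then show ?thesis using sw(1) that by auto
    qed
  qed
  have last2: "pl i j k l u = 0" if "i \<in> {1..N}" "j \<in> {1..N}" "k \<in> {1..N}" "l \<in> {1..N}" "distinct [i, j, k, l]"
    "k < l" for i j k l
  proof -
    note d = that(5)
    consider "j < k" | "k < j" "j < l" | "l < j" using d by fastforce
    then show ?thesis
    proof cases
      case 1 then show ?thesis using that by (intro last3) auto
    next
      case 2
      then have "pl i k j l u = 0" using that by (intro last3) auto
      then show ?thesis using sw(2)[of i j k l] that by auto
    next
      case 3
      then have "pl i k l j u = 0" using that by (intro last3) auto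
      then have "pl i k j l u = 0" using sw(3)[of i k l j] that by auto
      then show ?thesis using sw(2)[of i j k l] that by auto
    qed
  qed
  consider "k < l" | "l < k" using d by fastforce
  then show ?thesis
  proof cases
    case 1 then show ?thesis using I d by (intro last2) auto
  next
    case c: 2
    then have "pl i j l k u = 0" using I d by (intro last2) auto
    then show ?thesis using sw(3)[OF I d] by auto
  qed
qed

text \<open>For sorted indices with j >= 3 the operators acting first kill v. Otherwise i = 1 and j
  = 2; then \<open>E 2 c v\<close> = \<i> \<open>E 1 c v\<close> reduces the relation to the
  commutator of \<open>E 1 k\<close> and \<open>E 1 l\<close>, again zero on v.\<close>

lemma pl_highest:
  assumes R: "\<And>c. c \<in> {3..N} \<Longrightarrow> R c v = 0"
    and E: "\<And>c d. c \<in> {3..N} \<Longrightarrow> d \<in> {3..N} \<Longrightarrow> E c d v = 0"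
    and I: "i \<in> {1..N}" "j \<in> {1..N}" "k \<in> {1..N}" "l \<in> {1..N}" "distinct [i, j, k, l]"
  shows "pl i j k l v = 0"
proof (rule pl_zero_sorted[OF _ I])
  fix i j k l assume I: "i \<in> {1..N}" "l \<in> {1..N}" and lt: "i < j" "j < k" "k < l"
  show "pl i j k l v = 0"
  proof (cases "j = 2")
    case False
    then show ?thesis using I lt by (simp add: pl_def E E_simps)
  next
    case True
    then have i1: "i = 1" and kl: "k \<in> {3..N}" "l \<in> {3..N}" "k \<noteq> l" using I lt by auto
    have e2: "E 2 c v = scale \<i> (E 1 c v)" if "c \<in> {3..N}" for c
    proof -
      have "E 1 c v + scale \<i> (E 2 c v) = 0" using R[OF that] by (simp add: R_def)
      then have "scale \<i> (E 1 c v + scale \<i> (E 2 c v)) = 0" by simp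
      then show ?thesis by (simp add: scale_right_distrib)
    qed
    show ?thesis
      unfolding pl_def i1 True using kl E_comm_special(4)[OF kl(1,2), of v]
      by (simp add: E e2 E_simps)
  qed
qed

end

section \<open>Integrality of the highest weight for N >= 4\<close>

context pluecker_rep
begin

text \<open>The triples of \<open>sl2_R\<close> give only half natural numbers. The root
  \<epsilon>_1 - \<epsilon>_2 does better: its coroot is H_1 - H_2 = \<open>H\<close> + \<i>
  \<open>E 3 4\<close>, which acts on v by b itself because \<open>E 3 4 v = 0\<close>.\<close>

lemma highest_vector_nat:
  assumes N4: "4 \<le> N" and v: "highest b v"
  shows "\<exists>t::nat. b = of_nat t"
proof -
  have c: "3 \<in> {3..N}" "4 \<in> {3..N}" using N4 by auto
  note sM = submod_subspace[OF submod_M]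
  let ?e = "\<lambda>u. R 3 u - scale \<i> (R 4 u)" and ?f = "\<lambda>u. scale (- 1 / 4) (L 3 u + scale \<i> (L 4 u))"
    and ?h = "\<lambda>u. H u + scale \<i> (E 3 4 u)"
  have E43: "E 4 3 u = - E 3 4 u" for u using E_anti[of 3 4 u] c by auto
  have ER: "E 3 4 (R 3 u) = R 3 (E 3 4 u) - R 4 u" "E 3 4 (R 4 u) = R 4 (E 3 4 u) + R 3 u" for u
    using R_E[of 3 3 4 u] R_E[of 4 3 4 u] c by auto
  have EL: "E 3 4 (L 3 u) = L 3 (E 3 4 u) - L 4 u" "E 3 4 (L 4 u) = L 4 (E 3 4 u) + L 3 u" for u
    using L_E[of 3 3 4 u] L_E[of 4 3 4 u] c by auto
  have quarter: "scale (1/4) (scale 4 u) = u" for u by simp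
  have four: "scale 4 u = scale 2 u + scale 2 u" "scale (\<i> * 4) u = scale (\<i> * 2) u + scale (\<i> * 2) u" for u
    by (simp_all flip: scale_left_distrib)
  have "sl2_triple scale ?e ?f ?h"
  proof unfold_locales
    fix u
    show "?h (?e u) = ?e (?h u) + scale 2 (?e u)"
      using c by (simp add: H_simps R_simps E_simps H_R ER scale_right_distrib scale_right_diff_distrib
          scale_double scale_double_mult algebra_simps)
    show "?h (?f u) = ?f (?h u) - scale 2 (?f u)"
      using c by (simp add: H_simps L_simps E_simps H_L EL scale_right_distrib scale_right_diff_distrib
          scale_double scale_double_mult algebra_simps)
    show "?e (?f u) = ?f (?e u) + ?h u"
    proof -
      \<comment> \<open>Clears the factor -1/4 that normalises the lowering operator.\<close>
      have "scale (- 4) (?e (?f u)) = scale (- 4) (?f (?e u) + ?h u)"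
        using c by (simp add: R_simps L_simps R_L E43 E_same scale_right_distrib scale_right_diff_distrib
          scale_double scale_double_mult four algebra_simps)
      then show ?thesis by (simp only: scale_cancel_left) simp
    qed
  qed (simp_all add: H_simps R_simps L_simps E_simps algebra_simps)
  then interpret sl2_triple scale ?e ?f ?h .
  obtain p where p: "p \<noteq> 0" "\<And>u. u \<in> M \<Longrightarrow> poly_op ?h p u = 0"
    using annihilating_poly_M[OF h_hom] submod_H[OF submod_M] E_in_M sM
    by (metis subspace_add subspace_scale)
  show ?thesis
    by (rule highest_weight_nat[OF subspace_single_0 _ _ _ _ p, where w = v])
      (use v c in \<open>auto simp: highest_def triple_hom_simps[simplified] H_simps R_simps L_simps E_simps intro!: subspace_scale subspace_add subspace_neg sM submod_L submod_M\<close>)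
qed

end

section \<open>The Lie algebra so(N) of differential operators\<close>

lemma pdiff_superset:
  assumes "finite A" "Poly_Mapping.keys p \<subseteq> A"
  shows "pdiff j p = (\<Sum>m\<in>A. Poly_Mapping.single (m - Poly_Mapping.single j 1)
       (of_nat (Poly_Mapping.lookup m j) * Poly_Mapping.lookup p m))"
  unfolding pdiff_def using assms by (intro sum.mono_neutral_left) (auto simp: in_keys_iff)

lemma pdiff_add: "pdiff j (p + q) = pdiff j p + pdiff j q"
proof -
  let ?A = "Poly_Mapping.keys p \<union> Poly_Mapping.keys q"
  have "Poly_Mapping.keys (p + q) \<subseteq> ?A" by (rule Poly_Mapping.keys_add)
  then show ?thesis
    using pdiff_superset[of ?A "p + q" j] pdiff_superset[of ?A p j] pdiff_superset[of ?A q j]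
    by (simp add: lookup_add distrib_left single_add sum.distrib)
qed

lemma pdiff_0 [simp]: "pdiff j 0 = 0"
  by (simp add: pdiff_def)

lemma pdiff_diff: "pdiff j (p - q) = pdiff j p - pdiff j q"
  using pdiff_add[of j "p - q" q] by simp

lemma pdiff_single:
  "pdiff j (Poly_Mapping.single m c) =
    Poly_Mapping.single (m - Poly_Mapping.single j 1) (of_nat (Poly_Mapping.lookup m j) * c)"
  by (simp add: pdiff_def)

lemma cpoly_induct [case_names zero single add]:
  fixes p :: cpoly
  assumes "P 0" "\<And>m c. P (Poly_Mapping.single m c)" "\<And>p q. P p \<Longrightarrow> P q \<Longrightarrow> P (p + q)"
  shows "P p"
proof (induction p rule: update_induct)
  case const
  then show ?case by (rule assms(1))
next
  case (update f a b)
  have "Poly_Mapping.update a b f = f + Poly_Mapping.single a b"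
    using update(1)
    by (intro poly_mapping_eqI) (auto simp: lookup_update lookup_add lookup_single when_def in_keys_iff)
  then show ?case using assms update by simp
qed

lemma pdiff_const: "pdiff j (Poly_Mapping.single 0 c * p) = Poly_Mapping.single 0 c * pdiff j p"
  by (induction p rule: cpoly_induct)
    (simp_all add: pdiff_single mult_single pdiff_add distrib_left mult.left_commute)

lemma pdiff_var: "pdiff j (var i * p) = (if i = j then p else 0) + var i * pdiff j p"
proof (induction p rule: cpoly_induct)
  case (single m c)
  \<comment> \<open>Subtraction of exponents is truncated at 0, so this fails for i = j and exponent
    0; in that case the coefficient of the derivative vanishes instead.\<close>
  have 1: "Poly_Mapping.single i 1 + m - Poly_Mapping.single j 1 = Poly_Mapping.single i 1 + (m - Poly_Mapping.single j 1)"
    if "i \<noteq> j \<or> Poly_Mapping.lookup m j \<noteq> 0" for m :: "nat \<Rightarrow>\<^sub>0 nat"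
    using that by (intro poly_mapping_eqI) (auto simp: lookup_add lookup_minus lookup_single when_def)
  show ?case
  proof (cases "i = j")
    case False
    then show ?thesis
      by (simp add: var_def mult_single pdiff_single 1 lookup_add lookup_single)
  next
    case True
    have 2: "Poly_Mapping.single j 1 + m - Poly_Mapping.single j 1 = m"
      by simp
    show ?thesis
    proof (cases "Poly_Mapping.lookup m j = 0")
      case z: True
      show ?thesis unfolding \<open>i = j\<close> var_def mult_single pdiff_single 2
        by (simp add: z lookup_add)
    next
      case False
      then have "Poly_Mapping.single j 1 + (m - Poly_Mapping.single j 1) = m"
        using 1[of m] True 2 by simp
      then show ?thesis
        unfolding \<open>i = j\<close> var_def mult_single pdiff_single 2
        by (simp add: lookup_add single_add[symmetric] distrib_right)
    qed
  qed
qed (simp_all add: distrib_left pdiff_add)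

lemma pdiff_commute: "pdiff i (pdiff j p) = pdiff j (pdiff i p)"
proof (induction p rule: cpoly_induct)
  case (single m c)
  show ?case
  proof (cases "i = j")
    case False
    have "m - Poly_Mapping.single j 1 - Poly_Mapping.single i 1 = m - Poly_Mapping.single i 1 - Poly_Mapping.single j 1"
      by (intro poly_mapping_eqI) (simp add: lookup_minus)
    then show ?thesis using False
      by (simp add: pdiff_single lookup_minus lookup_single mult.left_commute)
  qed simp
qed (simp_all add: pdiff_add)

lemma so_gen_linear:
  "so_gen i j (p + q) = so_gen i j p + so_gen i j q"
  "so_gen i j (Poly_Mapping.single 0 c * p) = Poly_Mapping.single 0 c * so_gen i j p"
  by (simp_all add: so_gen_def pdiff_add pdiff_const distrib_left right_diff_distrib mult.left_commute)

lemma so_gen_anti: "so_gen j i = - so_gen i j"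
  by (simp add: so_gen_def fun_eq_iff)

lemma so_gen_same: "so_gen i i = 0"
  by (simp add: so_gen_def fun_eq_iff)

text \<open>By the Leibniz rule; the second-order terms cancel because partial derivatives
  commute.\<close>

lemma commutator_so_gen:
  "commutator (so_gen i j) (so_gen k l) =
    oscale (of_bool (j = k)) (so_gen i l) - oscale (of_bool (j = l)) (so_gen i k)
    - oscale (of_bool (i = k)) (so_gen j l) + oscale (of_bool (i = l)) (so_gen j k)"
proof
  fix p
  have b: "Poly_Mapping.single 0 (of_bool b :: complex) * q = (if b then q else 0)" for b and q :: cpoly
    by simp
  have c: "pdiff j (pdiff k p) = pdiff k (pdiff j p)" "pdiff j (pdiff l p) = pdiff l (pdiff j p)"
    "pdiff i (pdiff k p) = pdiff k (pdiff i p)" "pdiff i (pdiff l p) = pdiff l (pdiff i p)"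
    by (rule pdiff_commute)+
  have f: "(if b then x - y else 0) = (if b then x else 0) - (if b then y else 0)" for b and x y :: cpoly
    by simp
  have g: "var a * (if b then q else 0) = (if b then var a * q else 0)" for a b q by simp
  show "commutator (so_gen i j) (so_gen k l) p =
    (oscale (of_bool (j = k)) (so_gen i l) - oscale (of_bool (j = l)) (so_gen i k)
    - oscale (of_bool (i = k)) (so_gen j l) + oscale (of_bool (i = l)) (so_gen j k)) p"
    unfolding commutator_def so_gen_def oscale_def plus_fun_apply minus_apply b pdiff_diff pdiff_var c
    by (auto simp: algebra_simps)
qed

interpretation oscale: complex_space oscale
proof
  fix a b :: complex and x y :: "cpoly \<Rightarrow> cpoly"
  show "oscale a (x + y) = oscale a x + oscale a y"
    "oscale (a + b) x = oscale a x + oscale b x"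
    by (auto simp: oscale_def fun_eq_iff algebra_simps single_add)
  show "oscale a (oscale b x) = oscale (a * b) x"
    by (auto simp: oscale_def fun_eq_iff mult.assoc[symmetric] mult_single)
  show "oscale 1 x = x"
    by (simp add: oscale_def)
qed

interpretation fscale: complex_space "fscale :: complex \<Rightarrow> ('x \<Rightarrow> complex) \<Rightarrow> _"
  by unfold_locales (auto simp: fscale_def fun_eq_iff algebra_simps)

lemma so_alg_subspace: "oscale.subspace (so_alg N)"
  by (simp add: so_alg_def)

lemma so_gen_in_so_alg:
  assumes "i \<in> {1..N}" "j \<in> {1..N}"
  shows "so_gen i j \<in> so_alg N"
proof -
  have lt: "so_gen i j \<in> so_alg N" if "i \<in> {1..N}" "j \<in> {1..N}" "i < j" for i j
    using that unfolding so_alg_def by (intro oscale.span_base) auto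
  consider "i < j" | "i = j" | "j < i" by linarith
  then show ?thesis
  proof cases
    case 2
    then show ?thesis using oscale.subspace_0[OF so_alg_subspace] by (simp add: so_gen_same)
  next
    case 3
    then show ?thesis
      using lt[OF assms(2,1)] oscale.subspace_neg[OF so_alg_subspace] by (simp add: so_gen_anti[of i j])
  qed (use lt assms in blast)
qed

lemma commutator_add_right:
  assumes "\<And>p q. S (p + q) = S p + S q"
  shows "commutator S (T + T') = commutator S T + commutator S T'"
  by (simp add: commutator_def fun_eq_iff assms)

lemma commutator_oscale_right:
  assumes "\<And>c p. S (Poly_Mapping.single 0 c * p) = Poly_Mapping.single 0 c * S p"
  shows "commutator S (oscale c T) = oscale c (commutator S T)"
  by (simp add: commutator_def fun_eq_iff assms oscale_def right_diff_distrib)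

section \<open>Cartan elements and root vectors\<close>

lemma cartan_H_linear:
  "cartan_H k (p + q) = cartan_H k p + cartan_H k q"
  "cartan_H k (Poly_Mapping.single 0 c * p) = Poly_Mapping.single 0 c * cartan_H k p"
  by (simp_all add: cartan_H_def oscale_def so_gen_linear distrib_left mult.left_commute)

lemma commutator_cartan_H:
  "commutator (cartan_H k) (so_gen a b) = oscale (- \<i>) (commutator (so_gen (2 * k - 1) (2 * k)) (so_gen a b))"
  by (simp add: commutator_def cartan_H_def fun_eq_iff oscale_def so_gen_linear right_diff_distrib)

lemma root_spaceI:
  assumes "x \<in> so_alg N" "\<And>k. k \<in> {1..N div 2} \<Longrightarrow> commutator (cartan_H k) x = oscale (\<beta> k) x"
  shows "x \<in> root_space N \<beta>"
  using assms by (simp add: root_space_def)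

text \<open>The analogue of \<open>R c\<close> for the k-th coordinate plane, formed with its
  isotropic vector x_(2k-1) + \<i> x_(2k).\<close>

definition isotropic_gen :: "nat \<Rightarrow> nat \<Rightarrow> cpoly \<Rightarrow> cpoly" where
  "isotropic_gen k c = so_gen (2 * k - 1) c + oscale \<i> (so_gen (2 * k) c)"

lemma isotropic_gen_in_so_alg:
  assumes "1 \<le> k" "2 * k \<le> N" "c \<in> {1..N}"
  shows "isotropic_gen k c \<in> so_alg N"
  unfolding isotropic_gen_def using assms
  by (intro oscale.subspace_add oscale.subspace_scale so_alg_subspace so_gen_in_so_alg) auto

lemma commutator_cartan_isotropic:
  assumes k: "1 \<le> k" and j: "1 \<le> j" and c: "2 * k < c"
  shows "commutator (cartan_H j) (isotropic_gen k c) =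
    oscale (of_bool (j = k)) (isotropic_gen k c)
     + oscale (- \<i>) (oscale (of_bool (2 * j = c)) (isotropic_gen k (2 * j - 1))
                      - oscale (of_bool (2 * j - 1 = c)) (isotropic_gen k (2 * j)))"
proof -
  have e: "2 * j = 2 * k \<longleftrightarrow> j = k" "2 * j - 1 = 2 * k - 1 \<longleftrightarrow> j = k"
    "2 * j = 2 * k - 1 \<longleftrightarrow> False" "2 * j - 1 = 2 * k \<longleftrightarrow> False"
    using j k by presburger+
  have "commutator (cartan_H j) (isotropic_gen k c) =
    oscale (- \<i>) (commutator (so_gen (2 * j - 1) (2 * j)) (so_gen (2 * k - 1) c))
    + oscale \<i> (oscale (- \<i>) (commutator (so_gen (2 * j - 1) (2 * j)) (so_gen (2 * k) c)))"
    by (simp only: isotropic_gen_def commutator_add_right[OF cartan_H_linear(1)]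
        commutator_oscale_right[OF cartan_H_linear(2)] commutator_cartan_H)
  also have "\<dots> = oscale (of_bool (j = k)) (isotropic_gen k c)
     + oscale (- \<i>) (oscale (of_bool (2 * j = c)) (isotropic_gen k (2 * j - 1))
                      - oscale (of_bool (2 * j - 1 = c)) (isotropic_gen k (2 * j)))"
    unfolding commutator_so_gen e isotropic_gen_def so_gen_anti[of "2 * j - 1" "2 * k - 1"]
      so_gen_anti[of "2 * j" "2 * k - 1"] so_gen_anti[of "2 * j - 1" "2 * k"] so_gen_anti[of "2 * j" "2 * k"]
    using c
    by (auto simp: oscale.scale_right_distrib oscale.scale_right_diff_distrib)
  finally show ?thesis .
qed

text \<open>H_l rotates the indices 2l - 1 and 2l into each other. The combination with factor s
  \<i> diagonalises this rotation with eigenvalue s, because s * s = 1.\<close>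

lemma root_vector_pm:
  assumes kl: "1 \<le> k" "k < l" "2 * l \<le> N" and s: "s = 1 \<or> s = - 1"
  shows "isotropic_gen k (2 * l - 1) + oscale (s * \<i>) (isotropic_gen k (2 * l))
    \<in> root_space N (\<lambda>j. eps k j + s * eps l j)"
proof (rule root_spaceI)
  show "isotropic_gen k (2 * l - 1) + oscale (s * \<i>) (isotropic_gen k (2 * l)) \<in> so_alg N"
    using kl by (intro oscale.subspace_add oscale.subspace_scale so_alg_subspace isotropic_gen_in_so_alg) auto
  fix j assume j: "j \<in> {1..N div 2}"
  have e: "2 * j = 2 * l \<longleftrightarrow> j = l" "2 * j - 1 = 2 * l - 1 \<longleftrightarrow> j = l"
    "2 * j = 2 * l - 1 \<longleftrightarrow> False" "2 * j - 1 = 2 * l \<longleftrightarrow> False"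
    using j kl by (simp, simp, presburger+)
  have 1: "commutator (cartan_H j) (isotropic_gen k (2 * l - 1)) =
    oscale (of_bool (j = k)) (isotropic_gen k (2 * l - 1))
     - oscale (- \<i>) (oscale (of_bool (j = l)) (isotropic_gen k (2 * l)))"
    using commutator_cartan_isotropic[of k j "2 * l - 1"] kl j unfolding e by auto
  have 2: "commutator (cartan_H j) (isotropic_gen k (2 * l)) =
    oscale (of_bool (j = k)) (isotropic_gen k (2 * l))
     + oscale (- \<i>) (oscale (of_bool (j = l)) (isotropic_gen k (2 * l - 1)))"
    using commutator_cartan_isotropic[of k j "2 * l"] kl j unfolding e by auto
  have ss: "s * s = 1" using s by auto
  show "commutator (cartan_H j) (isotropic_gen k (2 * l - 1) + oscale (s * \<i>) (isotropic_gen k (2 * l)))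
    = oscale (eps k j + s * eps l j) (isotropic_gen k (2 * l - 1) + oscale (s * \<i>) (isotropic_gen k (2 * l)))"
    unfolding commutator_add_right[OF cartan_H_linear(1)] commutator_oscale_right[OF cartan_H_linear(2)] 1 2
    using kl s by (auto simp: eps_def oscale.scale_right_distrib oscale.scale_right_diff_distrib)
qed

text \<open>For odd N the index N belongs to no plane, so the Cartan elements act only through the
  plane k.\<close>

lemma root_vector_odd:
  assumes k: "1 \<le> k" "2 * k < N" and N: "odd N"
  shows "isotropic_gen k N \<in> root_space N (eps k)"
proof (rule root_spaceI)
  show "isotropic_gen k N \<in> so_alg N"
    using k by (intro isotropic_gen_in_so_alg) auto
  fix j assume j: "j \<in> {1..N div 2}"
  have "2 * j \<noteq> N" "2 * j - 1 \<noteq> N" using N j by auto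
  then show "commutator (cartan_H j) (isotropic_gen k N) = oscale (eps k j) (isotropic_gen k N)"
    using commutator_cartan_isotropic[of k j N] k j by (simp add: eps_def)
qed

lemma eps_plus_minus:
  assumes "1 \<le> k" "k < l" "2 * l \<le> N" "s = 1 \<or> s = - 1"
  shows "(\<lambda>j. eps k j + s * eps l j) \<in> positive_roots N"
proof -
  have "l \<le> N div 2" using assms(3) by linarith
  moreover have "(\<lambda>j. eps k j + s * eps l j) = eps k + eps l \<or> (\<lambda>j. eps k j + s * eps l j) = eps k - eps l"
    using assms(4) by (auto simp: fun_eq_iff)
  ultimately show ?thesis using assms unfolding positive_roots_def by blast
qed

section \<open>Alternating maps on the vector products algebra\<close>

locale alt_map = V: complex_space sV + W: complex_space sW
  for sV :: "complex \<Rightarrow> 'v::ab_group_add \<Rightarrow> 'v" and sW :: "complex \<Rightarrow> 'w::ab_group_add \<Rightarrow> 'w" +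
  fixes k :: nat and f :: "'v list \<Rightarrow> 'w"
  assumes alt: "alternating_map sV sW k f"
begin

lemma add_at: "length xs + length ys + 1 = k \<Longrightarrow> f (xs @ (x + y) # ys) = f (xs @ x # ys) + f (xs @ y # ys)"
  using alternating_mapD(1)[OF alt, of "xs @ x # ys" "length xs" x y] by simp

lemma scale_at: "length xs + length ys + 1 = k \<Longrightarrow> f (xs @ sV c x # ys) = sW c (f (xs @ x # ys))"
  using alternating_mapD(2)[OF alt, of "xs @ x # ys" "length xs" c x] by simp

lemma not_distinct: "length xs = k \<Longrightarrow> \<not> distinct xs \<Longrightarrow> f xs = 0"
  using alternating_mapD(3)[OF alt] by blast

lemma zero_at: "length xs + length ys + 1 = k \<Longrightarrow> f (xs @ 0 # ys) = 0"
  using scale_at[of xs ys 0 0] by simp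

lemma swap_adjacent:
  assumes "length xs + length ys + 2 = k"
  shows "f (xs @ a # b # ys) = - f (xs @ b # a # ys)"
proof -
  have 1: "f (xs @ (x + y) # z # ys) = f (xs @ x # z # ys) + f (xs @ y # z # ys)" for x y z
    using add_at[of xs "z # ys"] assms by simp
  have 2: "f (xs @ z # (x + y) # ys) = f (xs @ z # x # ys) + f (xs @ z # y # ys)" for x y z
    using add_at[of "xs @ [z]" ys] assms by simp
  have 3: "f (xs @ z # z # ys) = 0" for z
    using assms by (intro not_distinct) auto
  have "f (xs @ (a + b) # (a + b) # ys) = f (xs @ a # b # ys) + f (xs @ b # a # ys)"
    by (subst 1) (simp only: 2 3 add_0_left add_0_right)
  then have "f (xs @ a # b # ys) + f (xs @ b # a # ys) = 0"
    unfolding 3 by (rule sym)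
  then show ?thesis by (simp add: add_eq_0_iff2)
qed

lemma move:
  assumes "length xs + length ys + length zs + 1 = k"
  shows "f (xs @ a # ys @ zs) = sW ((- 1) ^ length ys) (f (xs @ ys @ a # zs))"
  using assms
proof (induction ys arbitrary: xs)
  case (Cons y ys)
  have "f (xs @ a # (y # ys) @ zs) = - f (xs @ y # a # (ys @ zs))"
    using swap_adjacent[of xs "ys @ zs" a y] Cons.prems by simp
  also have "f (xs @ y # a # (ys @ zs)) = sW ((- 1) ^ length ys) (f ((xs @ [y]) @ ys @ a # zs))"
    using Cons.IH[of "xs @ [y]"] Cons.prems by simp
  finally show ?case by simp
qed simp

text \<open>The sign is left open, since the uses ask only for vanishing, for membership in a
  subspace, or for a value up to a scalar.\<close>

lemma perm:
  assumes "mset xs = mset ys" "length xs = k"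
  shows "f xs = f ys \<or> f xs = - f ys"
proof -
  have "f (ps @ xs) = f (ps @ ys) \<or> f (ps @ xs) = - f (ps @ ys)"
    if "mset xs = mset ys" "length ps + length xs = k" for ps
    using that
  proof (induction xs arbitrary: ys ps)
    case (Cons x xs)
    then have "x \<in> set ys" by (metis list.set_intros(1) mset_eq_setD)
    then obtain us vs where ys: "ys = us @ x # vs" by (meson split_list)
    then have m: "mset xs = mset (us @ vs)" using Cons.prems(1) by simp
    then have len: "length xs = length us + length vs" by (metis length_append mset_eq_length)
    have "f ((ps @ [x]) @ xs) = f ((ps @ [x]) @ us @ vs) \<or> f ((ps @ [x]) @ xs) = - f ((ps @ [x]) @ us @ vs)"
      using Cons.IH[OF m, of "ps @ [x]"] Cons.prems(2) by simp
    moreover have "f (ps @ x # us @ vs) = f (ps @ us @ x # vs) \<or> f (ps @ x # us @ vs) = - f (ps @ us @ x # vs)"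
      using move[of ps us vs x] len Cons.prems(2)
      by (cases "even (length us)") (simp_all add: W.scale_minus_left)
    ultimately show ?case using ys by auto
  qed simp
  from this[of "[]"] assms show ?thesis by simp
qed

text \<open>Multilinear expansion, replacing arguments by basis vectors from the right. Basis tuples
  with repetitions give 0. With Y = {0} this tests vanishing on basis vectors.\<close>

lemma in_subspace:
  assumes Y: "W.subspace Y" and e: "V.span (e ` J) = UNIV"
    and basis: "\<And>ks. length ks = k \<Longrightarrow> set ks \<subseteq> J \<Longrightarrow> distinct ks \<Longrightarrow> f (map e ks) \<in> Y"
    and xs: "length xs = k"
  shows "f xs \<in> Y"
proof -
  have "f (us @ map e ks) \<in> Y" if "length us + length ks = k" "set ks \<subseteq> J" for us ks
    using that
  proof (induction us arbitrary: ks rule: rev_induct)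
    case Nil
    show ?case
    proof (cases "distinct ks")
      case True
      then show ?thesis using basis Nil by simp
    next
      case False
      then have "\<not> distinct (map e ks)" by (simp add: distinct_map)
      then show ?thesis using not_distinct[of "map e ks"] Nil W.subspace_0[OF Y] by simp
    qed
  next
    case (snoc u us)
    have "u \<in> V.span (e ` J)" using e by simp
    then have "f (us @ u # map e ks) \<in> Y"
    proof (induction rule: V.span_induct_alt)
      case base
      show ?case using zero_at[of us "map e ks"] snoc.prems W.subspace_0[OF Y] by simp
    next
      case (step c x y)
      then obtain j where j: "j \<in> J" "x = e j" by blast
      have "f (us @ x # map e ks) \<in> Y"
        using snoc.IH[of "j # ks"] snoc.prems j by simp
      moreover have "f (us @ (sV c x + y) # map e ks) = sW c (f (us @ x # map e ks)) + f (us @ y # map e ks)"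
        using snoc.prems by (simp add: add_at scale_at)
      ultimately show ?case using step Y by (simp add: W.subspace_add W.subspace_scale)
    qed
    then show ?case by simp
  qed
  from this[of xs "[]"] xs show ?thesis by simp
qed

end

lemma (in complex_space) wedge_alternating: "alternating_map scale fscale k (wedge scale)"
  unfolding alternating_map_def
proof (intro conjI allI impI)
  fix xs :: "'m list" and i x y
  assume a: "length xs = k \<and> i < k"
  show "wedge scale (xs[i := x + y]) = wedge scale (xs[i := x]) + wedge scale (xs[i := y])"
    using a alternating_mapD(1)[of scale "(*)" k _ xs i] by (auto simp: wedge_def fun_eq_iff)
next
  fix xs :: "'m list" and i c x
  assume a: "length xs = k \<and> i < k"
  show "wedge scale (xs[i := scale c x]) = fscale c (wedge scale (xs[i := x]))"
    using a alternating_mapD(2)[of scale "(*)" k _ xs i] by (auto simp: wedge_def fun_eq_iff fscale_def)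
next
  fix xs :: "'m list"
  assume a: "length xs = k \<and> \<not> distinct xs"
  show "wedge scale xs = 0"
    using a alternating_mapD(3)[of scale "(*)" k _ xs] by (auto simp: wedge_def fun_eq_iff)
qed

lemma (in complex_space) wedge_alt_map: "alt_map scale fscale k (wedge scale)"
  by (intro alt_map.intro complex_space_axioms fscale.complex_space_axioms alt_map_axioms.intro wedge_alternating)

lemma minus_one_power_diff:
  "1 \<le> i \<Longrightarrow> (- 1 :: complex) ^ (i - 1) = - ((- 1) ^ i)"
  "2 \<le> i \<Longrightarrow> (- 1 :: complex) ^ (i - 2) = (- 1) ^ i"
  "3 \<le> i \<Longrightarrow> (- 1 :: complex) ^ (i - 3) = - ((- 1) ^ i)"
  by (auto dest!: le_Suc_ex simp: power_add)

section \<open>Signs and brackets of basis vectors\<close>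

sublocale vector_products_algebra \<subseteq> complex_space scale
  by unfold_locales

context vector_products_algebra
begin

sublocale br: alt_map scale scale n br
  by (intro alt_map.intro complex_space_axioms alt_map_axioms.intro br_alternating)

definition rest_list :: "nat set \<Rightarrow> nat list" where
  "rest_list S = filter (\<lambda>k. k \<notin> S) [1..<n+2]"

lemma set_rest_list: "set (rest_list S) = {1..n+1} - S"
  unfolding rest_list_def by (simp only: set_filter set_upt) auto

lemma distinct_rest_list: "distinct (rest_list S)"
  by (simp add: rest_list_def)

lemma length_rest_list: "length (rest_list S) = card ({1..n+1} - S)"
  by (metis distinct_card distinct_rest_list set_rest_list)

lemma rest_list_insert:
  assumes x: "x \<in> {1..n+1}" "x \<notin> S"
  obtains xs ys where "rest_list S = xs @ x # ys" "rest_list (insert x S) = xs @ ys"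
    "length xs = card ({1..<x} - S)"
proof -
  have split: "[1..<n+2] = [1..<x] @ x # [x+1..<n+2]"
    using x upt_add_eq_append[of 1 x "n + 2 - x"] upt_conv_Cons[of x "n + 2"]
    by (simp del: upt_Suc add_2_eq_Suc' flip: Suc_eq_plus1)
  define us vs where "us = [1..<x]" and "vs = [x+1..<n+2]"
  have x': "x \<notin> set us" "x \<notin> set vs" by (simp_all only: us_def vs_def set_upt) auto
  let ?f = "filter (\<lambda>k. k \<notin> S)"
  have "rest_list S = ?f us @ x # ?f vs"
    unfolding rest_list_def split us_def[symmetric] vs_def[symmetric] using x by simp
  moreover have "filter (\<lambda>k. k \<notin> insert x S) us = ?f us" "filter (\<lambda>k. k \<notin> insert x S) vs = ?f vs"
    using x' by (auto intro!: filter_cong)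
  then have "rest_list (insert x S) = ?f us @ ?f vs"
    unfolding rest_list_def split us_def[symmetric] vs_def[symmetric] by simp
  moreover have "set (?f us) = {1..<x} - S" unfolding us_def set_filter set_upt by auto
  then have "length (?f us) = card ({1..<x} - S)"
    by (metis distinct_card distinct_filter distinct_upt us_def)
  ultimately show thesis using that by blast
qed

text \<open>The sign counts the smaller indices outside S, past which e x is moved to the
  front.\<close>

lemma alt_rest_list:
  assumes f: "alt_map scale sW k f" and k: "k = card ({1..n+1} - S)" and x: "x \<in> {1..n+1}" "x \<notin> S"
  shows "f (map e (rest_list S)) = sW ((- 1) ^ card ({1..<x} - S)) (f (e x # map e (rest_list (insert x S))))"
proof -
  interpret f: alt_map scale sW k f by fact
  obtain xs ys where l: "rest_list S = xs @ x # ys" "rest_list (insert x S) = xs @ ys"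
    "length xs = card ({1..<x} - S)"
    using rest_list_insert[OF x] .
  have "length xs + length ys + 1 = k"
    using length_rest_list[of S] unfolding l(1) k by simp
  then have "f (e x # map e xs @ map e ys) = sW ((- 1) ^ length xs) (f (map e xs @ e x # map e ys))"
    using f.move[of "[]" "map e xs" "map e ys" "e x"] by simp
  then have "sW ((- 1) ^ length xs) (f (e x # map e xs @ map e ys)) = f (map e xs @ e x # map e ys)"
    by (simp flip: power_add mult_2)
  then show ?thesis by (simp add: l)
qed

text \<open>The sign in the identification with so(n+1), extended skew-symmetrically to all pairs;
  with it \<open>so_wedge i j\<close> corresponds to e_ij for every i, j.\<close>

definition sgn2 :: "nat \<Rightarrow> nat \<Rightarrow> complex" where
  "sgn2 i j = (if i < j then (- 1) ^ (i + j + n + 1) else if j < i then - ((- 1) ^ (i + j + n + 1)) else 0)"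

definition so_wedge :: "nat \<Rightarrow> nat \<Rightarrow> ('a list \<Rightarrow> complex) \<Rightarrow> complex" where
  "so_wedge i j = fscale (sgn2 i j) (wedge scale (map e (rest_list {i, j})))"

lemma sgn2_anti: "sgn2 j i = - sgn2 i j"
  by (auto simp: sgn2_def add.commute)

lemma sgn2_square: "i \<noteq> j \<Longrightarrow> sgn2 i j * sgn2 i j = 1"
  by (auto simp: sgn2_def simp flip: power_add mult_2)

lemma so_wedge_anti: "so_wedge j i = - so_wedge i j"
  by (simp add: so_wedge_def sgn2_anti[of j i] insert_commute)

lemma so_wedge_same: "so_wedge i i = 0"
  by (simp add: so_wedge_def sgn2_def)

lemma wedge_omit2_eq: "wedge_omit2 scale n e i j = wedge scale (map e (rest_list {i, j}))"
  by (simp add: wedge_omit2_def rest_list_def)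

lemma card_rest: "S \<subseteq> {1..n+1} \<Longrightarrow> card ({1..n+1} - S) = n + 1 - card S"
  by (subst card_Diff_subset) (auto intro: finite_subset)

text \<open>\<open>so_wedge j l\<close> is a Hodge dual of \<open>e_j \<and> e_l\<close>. Only the consistency of the signs matters, so the
  sign \<open>s\<close> of the permutation that sorts the factors is never computed for general \<open>i, j, l\<close>.\<close>

definition hodge3 :: "nat \<Rightarrow> nat \<Rightarrow> nat \<Rightarrow> complex \<Rightarrow> bool" where
  "hodge3 i j l s \<longleftrightarrow> s * s = 1 \<and>
     wedge scale (e i # map e (rest_list {i, j, l})) = fscale s (so_wedge j l) \<and>
     wedge scale (e j # map e (rest_list {i, j, l})) = fscale (- s) (so_wedge i l) \<and>
     wedge scale (e l # map e (rest_list {i, j, l})) = fscale s (so_wedge i j)"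

lemma hodge3_swap:
  "hodge3 i j l s \<Longrightarrow> hodge3 j i l (- s)" "hodge3 i j l s \<Longrightarrow> hodge3 i l j (- s)"
proof -
  have s: "{j, i, l} = {i, j, l}" "{i, l, j} = {i, j, l}" by auto
  show "hodge3 i j l s \<Longrightarrow> hodge3 j i l (- s)" "hodge3 i j l s \<Longrightarrow> hodge3 i l j (- s)"
    unfolding hodge3_def s so_wedge_anti[of j i] so_wedge_anti[of l j] by simp_all
qed

lemma sort3:
  fixes i j l :: nat
  assumes "\<And>i j l. i < j \<Longrightarrow> j < l \<Longrightarrow> i \<in> A \<Longrightarrow> j \<in> A \<Longrightarrow> l \<in> A \<Longrightarrow> P i j l"
    and "\<And>i j l. P i j l \<Longrightarrow> P j i l" and "\<And>i j l. P i j l \<Longrightarrow> P i l j"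
    and "distinct [i, j, l]" "i \<in> A" "j \<in> A" "l \<in> A"
  shows "P i j l"
proof -
  note d = assms(4)
  consider "i < j" "j < l" | "i < l" "l < j" | "j < i" "i < l" | "j < l" "l < i" | "l < i" "i < j" | "l < j" "j < i"
    using d by fastforce
  then show ?thesis using assms by cases metis+
qed

lemma ex_hodge3:
  assumes "distinct [i, j, l]" "i \<in> {1..n+1}" "j \<in> {1..n+1}" "l \<in> {1..n+1}"
  shows "\<exists>s. hodge3 i j l s"
  using _ _ _ assms
proof (rule sort3[where A = "{1..n+1}" and P = "\<lambda>i j l. \<exists>s. hodge3 i j l s"])
  fix i j l assume lt: "i < j" "j < l" and I: "i \<in> {1..n+1}" "j \<in> {1..n+1}" "l \<in> {1..n+1}"
  \<comment> \<open>For i < j < l the moved factors pass i - 1, j - 2 and l - 3 smaller indices.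
    Together with \<open>sgn2\<close> all three signs equal this one, up to the minus for the middle
    index.\<close>
  let ?s = "(- 1) ^ (i + j + l + n) :: complex"
  let ?w = "\<lambda>x. wedge scale (e x # map e (rest_list {i, j, l}))"
  have k: "n - 1 = card ({1..n+1} - {j, l})" "n - 1 = card ({1..n+1} - {i, l})" "n - 1 = card ({1..n+1} - {i, j})"
    using I lt by (subst card_rest; auto)+
  have "{1..<i} - {j, l} = {1..<i}" using lt by auto
  then have c1: "card ({1..<i} - {j, l}) = i - 1" by simp
  have "{1..<j} - {i, l} = {1..<j} - {i}" using lt by auto
  then have c2: "card ({1..<j} - {i, l}) = j - 2" using lt I by (simp add: card_Diff_subset)
  have c3: "card ({1..<l} - {i, j}) = l - 3" using lt I by (simp add: card_Diff_subset)
  have s: "insert j {i, l} = {i, j, l}" "insert l {i, j} = {i, j, l}" by auto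
  have p: "(- 1) ^ (i - 1) = (- ((- 1) ^ i) :: complex)" "(- 1) ^ (j - 2) = ((- 1) ^ j :: complex)"
    "(- 1) ^ (l - 3) = (- ((- 1) ^ l) :: complex)"
    by (rule minus_one_power_diff; use I lt in simp)+
  have "so_wedge j l = fscale ?s (?w i)"
    using lt alt_rest_list[OF wedge_alt_map k(1) I(1)] unfolding so_wedge_def c1 p
    by (simp add: sgn2_def power_add mult_ac)
  moreover have "so_wedge i l = fscale (- ?s) (?w j)"
    using lt alt_rest_list[OF wedge_alt_map k(2) I(2)] unfolding so_wedge_def c2 s p
    by (simp add: sgn2_def power_add mult_ac)
  moreover have "so_wedge i j = fscale ?s (?w l)"
    using lt alt_rest_list[OF wedge_alt_map k(3) I(3)] unfolding so_wedge_def c3 s p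
    by (simp add: sgn2_def power_add mult_ac)
  moreover have "?s * ?s = 1" by (simp flip: power_add mult_2)
  ultimately have "hodge3 i j l ?s" by (simp add: hodge3_def)
  then show "\<exists>s. hodge3 i j l s" by blast
qed (use hodge3_swap in blast)+

text \<open>So \<open>so_wedge i j\<close> acts on the algebra as x_i d_j - x_j d_i acts on linear
  forms: e_i goes to - e_j and e_j to e_i, while \<open>br_rest_other\<close> says that the other
  basis vectors go to 0.\<close>

lemma br_rest_pair:
  assumes ij: "i \<noteq> j" and I: "i \<in> {1..n+1}" "j \<in> {1..n+1}"
  shows "scale (sgn2 i j) (br (map e (rest_list {i, j}) @ [e i])) = - e j"
    and "scale (sgn2 i j) (br (map e (rest_list {i, j}) @ [e j])) = e i"
proof -
  have len: "length (rest_list {i, j}) + 1 = n" if "i \<noteq> j" "i \<in> {1..n+1}" "j \<in> {1..n+1}" for i j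
    using that card_rest[of "{i, j}"] by (simp add: length_rest_list)
  have brj: "br (map e (rest_list {j})) = scale ((- 1) ^ j) (e j)" if "j \<in> {1..n+1}" for j
    using br_basis[OF that] by (simp add: rest_list_def)
  have front: "br (map e (rest_list {i, j}) @ [e x]) = scale ((- 1) ^ (n - 1)) (br (e x # map e (rest_list {i, j})))"
    if ij: "i \<noteq> j" "i \<in> {1..n+1}" "j \<in> {1..n+1}" for i j x
  proof -
    have l: "length (rest_list {i, j}) = n - 1" "0 < n" using len[OF ij] by auto
    then have "br (e x # map e (rest_list {i, j})) = scale ((- 1) ^ (n - 1)) (br (map e (rest_list {i, j}) @ [e x]))"
      using br.move[of "[]" "map e (rest_list {i, j})" "[]" "e x"] by simp
    then show ?thesis by (simp flip: power_add mult_2)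
  qed
  have both: "scale (sgn2 i j) (br (map e (rest_list {i, j}) @ [e i])) = - e j \<and>
    scale (sgn2 i j) (br (map e (rest_list {i, j}) @ [e j])) = e i"
    if ij: "i < j" and I: "i \<in> {1..n+1}" "j \<in> {1..n+1}" for i j
  proof -
    have n: "n > 0" using that by auto
    have k: "n = card ({1..n+1} - {j})" "n = card ({1..n+1} - {i})"
      using I by (subst card_rest; auto)+
    have "{1..<i} - {j} = {1..<i}" using ij by auto
    then have c1: "card ({1..<i} - {j}) = i - 1" by simp
    have c2: "card ({1..<j} - {i}) = j - 2" using ij I by (simp add: card_Diff_subset)
    have p: "(- 1) ^ (i - 1) = (- ((- 1) ^ i) :: complex)" "(- 1) ^ (j - 2) = ((- 1) ^ j :: complex)"
      "(- 1) ^ (n - 1) = (- ((- 1) ^ n) :: complex)"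
      by (rule minus_one_power_diff; use I ij n in simp)+
    have "scale ((- 1) ^ j) (e j) = scale (- ((- 1) ^ i)) (br (e i # map e (rest_list {i, j})))"
      using alt_rest_list[OF br.alt_map_axioms k(1) I(1)] ij brj[OF I(2)] unfolding c1 p by simp
    then have "scale ((- 1) ^ i * (- 1) ^ j) (e j) = scale ((- 1) ^ i * (- ((- 1) ^ i))) (br (e i # map e (rest_list {i, j})))"
      by (metis scale_scale)
    then have 1: "br (e i # map e (rest_list {i, j})) = - scale ((- 1) ^ i * (- 1) ^ j) (e j)"
      by (simp flip: power_add mult_2)
    have "scale ((- 1) ^ i) (e i) = scale ((- 1) ^ j) (br (e j # map e (rest_list {j, i})))"
      using alt_rest_list[OF br.alt_map_axioms k(2) I(2)] ij brj[OF I(1)] unfolding c2 p by simp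
    then have "scale ((- 1) ^ j * (- 1) ^ i) (e i) = scale ((- 1) ^ j * (- 1) ^ j) (br (e j # map e (rest_list {j, i})))"
      by (metis scale_scale)
    then have 2: "br (e j # map e (rest_list {i, j})) = scale ((- 1) ^ i * (- 1) ^ j) (e i)"
      by (simp add: insert_commute mult.commute flip: power_add mult_2)
    have s: "sgn2 i j = - ((- 1) ^ i * (- 1) ^ j * (- 1) ^ n)" using ij by (simp add: sgn2_def power_add)
    have q: "(- 1) ^ i * ((- 1) ^ i * x) = x" "(- 1) ^ i * (- 1) ^ i = (1::complex)" for x :: complex and i :: nat
      by (simp_all flip: power_add mult_2 mult.assoc)
    show ?thesis
      unfolding front[OF less_imp_neq[OF ij] I] 1 2 s p by (simp add: mult_ac q)
  qed
  have "(scale (sgn2 i j) (br (map e (rest_list {i, j}) @ [e i])) = - e j) \<and>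
    (scale (sgn2 i j) (br (map e (rest_list {i, j}) @ [e j])) = e i)"
  proof (cases "i < j")
    case True
    then show ?thesis using both I by blast
  next
    case False
    then have "j < i" using ij by simp
    from both[OF this I(2,1)] show ?thesis
      by (simp add: sgn2_anti[of j i] insert_commute minus_equation_iff[of _ "e _"])
  qed
  then show "scale (sgn2 i j) (br (map e (rest_list {i, j}) @ [e i])) = - e j"
    "scale (sgn2 i j) (br (map e (rest_list {i, j}) @ [e j])) = e i" by blast+
qed

lemma br_rest_other:
  assumes "i \<noteq> j" "i \<in> {1..n+1}" "j \<in> {1..n+1}" "q \<in> {1..n+1}" "q \<noteq> i" "q \<noteq> j"
  shows "br (map e (rest_list {i, j}) @ [e q]) = 0"
proof (rule br.not_distinct)
  show "length (map e (rest_list {i, j}) @ [e q]) = n"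
    using assms card_rest[of "{i, j}"] by (simp add: length_rest_list)
  have "q \<in> set (rest_list {i, j})" using assms by (simp add: set_rest_list)
  then show "\<not> distinct (map e (rest_list {i, j}) @ [e q])" by auto
qed

end

section \<open>The basic Lie algebra of the vector products algebra\<close>

context vector_products_algebra
begin

lemma wedge_in_ext_power: "length as = k \<Longrightarrow> wedge scale as \<in> ext_power scale k"
  unfolding ext_power_def by (intro fscale.span_base) auto

lemma ext_power_subspace: "fscale.subspace (ext_power scale k)"
  by (simp add: ext_power_def)

lemma so_wedge_in_ext_power:
  assumes "i \<in> {1..n+1}" "j \<in> {1..n+1}"
  shows "so_wedge i j \<in> ext_power scale (n - 1)"
proof (cases "i = j")
  case True
  then show ?thesis using fscale.subspace_0[OF ext_power_subspace] by (simp add: so_wedge_same)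
next
  case False
  then have "length (map e (rest_list {i, j})) = n - 1"
    using assms card_rest[of "{i, j}"] by (simp add: length_rest_list)
  then show ?thesis
    unfolding so_wedge_def by (intro fscale.subspace_scale ext_power_subspace wedge_in_ext_power)
qed

text \<open>The derivation induced by as on the exterior power, transposed to forms.\<close>

definition adjoint_form :: "('a list \<Rightarrow> complex) \<Rightarrow> 'a list \<Rightarrow> 'a list \<Rightarrow> complex" where
  "adjoint_form f as bs = (\<Sum>i<n - 1. f (bs[i := br (as @ [bs ! i])]))"

lemma basic_bracket_adjoint_form:
  "basic_bracket scale n br x y =
    (\<lambda>f. if alternating_map scale (*) (n - 1) f then x (\<lambda>as. y (adjoint_form f as)) else 0)"
  unfolding basic_bracket_def adjoint_form_def[abs_def] ..

lemma adjoint_form_alternating_right: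
  assumes f: "alternating_map scale (*) (n - 1) f" and n: "1 \<le> n" and as: "length as = n - 1"
  shows "alternating_map scale (*) (n - 1) (adjoint_form f as)"
  unfolding adjoint_form_def
  by (rule alternating_form_derivation[OF f]) (use br.add_at[of as "[]"] br.scale_at[of as "[]"] n as in auto)

lemma adjoint_form_alternating_left:
  assumes f: "alternating_map scale (*) (n - 1) f" and n: "1 \<le> n" and bs: "length bs = n - 1"
  shows "alternating_map scale (*) (n - 1) (\<lambda>as. adjoint_form f as bs)"
  unfolding alternating_map_def adjoint_form_def
proof (intro conjI allI impI)
  fix cs :: "'a list" and j x y
  assume a: "length cs = n - 1 \<and> j < n - 1"
  then have jn: "j < n" "length cs + 1 = n" using n by linarith+
  have "br (cs[j := x + y] @ [u]) = br (cs[j := x] @ [u]) + br (cs[j := y] @ [u])" for u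
    using alternating_mapD(1)[OF br_alternating, of "cs @ [u]" j x y] a jn
    by (simp add: list_update_append)
  then show "(\<Sum>i<n - 1. f (bs[i := br (cs[j := x + y] @ [bs ! i])])) =
    (\<Sum>i<n - 1. f (bs[i := br (cs[j := x] @ [bs ! i])])) + (\<Sum>i<n - 1. f (bs[i := br (cs[j := y] @ [bs ! i])]))"
    by (simp add: alternating_mapD(1)[OF f bs] sum.distrib)
next
  fix cs :: "'a list" and j c x
  assume a: "length cs = n - 1 \<and> j < n - 1"
  then have jn: "j < n" "length cs + 1 = n" using n by linarith+
  have "br (cs[j := scale c x] @ [u]) = scale c (br (cs[j := x] @ [u]))" for u
    using alternating_mapD(2)[OF br_alternating, of "cs @ [u]" j c x] a jn
    by (simp add: list_update_append)
  then show "(\<Sum>i<n - 1. f (bs[i := br (cs[j := scale c x] @ [bs ! i])])) =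
    c * (\<Sum>i<n - 1. f (bs[i := br (cs[j := x] @ [bs ! i])]))"
    by (simp add: alternating_mapD(2)[OF f bs] sum_distrib_left)
next
  fix cs :: "'a list"
  assume a: "length cs = n - 1 \<and> \<not> distinct cs"
  have "br (cs @ [u]) = 0" for u
    using a n by (intro br.not_distinct) auto
  moreover have "f (bs[i := 0]) = 0" if "i < n - 1" for i
    using alternating_mapD(2)[OF f bs that, of 0 0] by simp
  ultimately show "(\<Sum>i<n - 1. f (bs[i := br (cs @ [bs ! i])])) = 0" by simp
qed

text \<open>A wedge is 0 by convention on functions that are not alternating, so the inner function
  in the bracket must be seen to be alternating before the outer wedge evaluates it.\<close>

lemma ext_power_form_alternating:
  assumes f: "alternating_map scale (*) (n - 1) f" and n: "1 \<le> n" and y: "y \<in> ext_power scale (n - 1)"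
  shows "alternating_map scale (*) (n - 1) (\<lambda>as. y (adjoint_form f as))"
  using y unfolding ext_power_def
proof (induction rule: fscale.span_induct_alt)
  case base
  show ?case by (simp add: alternating_map_def)
next
  case (step c x z)
  then obtain bs where bs: "x = wedge scale bs" "length bs = n - 1" by blast
  have "alternating_map scale (*) (n - 1) (\<lambda>as. c * adjoint_form f as bs + z (adjoint_form f as))"
    using adjoint_form_alternating_left[OF f n bs(2)] step(2)
    unfolding alternating_map_def by (simp add: distrib_left algebra_simps)
  then show ?case
    by (rule alternating_map_cong[THEN iffD1, rotated])
      (simp add: bs fscale_def wedge_def adjoint_form_alternating_right[OF f n])
qed

lemma basic_bracket_wedge_left:
  assumes n: "1 \<le> n" and as: "length as = n - 1" and y: "y \<in> ext_power scale (n - 1)"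
  shows "basic_bracket scale n br (wedge scale as) y =
    (\<lambda>f. if alternating_map scale (*) (n - 1) f then y (adjoint_form f as) else 0)"
  using ext_power_form_alternating[OF _ n y] as
  by (auto simp: basic_bracket_adjoint_form wedge_def)

lemma basic_bracket_left_linear:
  "basic_bracket scale n br (x + x') y = basic_bracket scale n br x y + basic_bracket scale n br x' y"
  "basic_bracket scale n br (fscale c x) y = fscale c (basic_bracket scale n br x y)"
  by (auto simp: basic_bracket_def fun_eq_iff fscale_def)

text \<open>An arbitrary functional x need not be additive. Inside the exterior power it reduces to
  wedges, for which the bracket becomes evaluation of y at transposed forms.\<close>

lemma basic_bracket_right_linear:
  assumes n: "1 \<le> n" and x: "x \<in> ext_power scale (n - 1)"
    and y: "y \<in> ext_power scale (n - 1)" "y' \<in> ext_power scale (n - 1)"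
  shows "basic_bracket scale n br x (fscale c y + y') =
    fscale c (basic_bracket scale n br x y) + basic_bracket scale n br x y'"
  using x unfolding ext_power_def
proof (induction rule: fscale.span_induct_alt)
  case base
  show ?case by (simp add: basic_bracket_def fun_eq_iff fscale_def)
next
  case (step d u v)
  then obtain as where as: "u = wedge scale as" "length as = n - 1" by blast
  have cy: "fscale c y + y' \<in> ext_power scale (n - 1)"
    using y by (intro fscale.subspace_add fscale.subspace_scale ext_power_subspace)
  have "basic_bracket scale n br u (fscale c y + y') =
    fscale c (basic_bracket scale n br u y) + basic_bracket scale n br u y'"
    unfolding as(1) basic_bracket_wedge_left[OF n as(2) cy] basic_bracket_wedge_left[OF n as(2) y(1)]
      basic_bracket_wedge_left[OF n as(2) y(2)]
    by (auto simp: fun_eq_iff fscale_def)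
  then show ?case
    unfolding basic_bracket_left_linear step(2) by (simp add: fun_eq_iff fscale_def algebra_simps)
qed

lemma ext_power_span:
  assumes n: "1 \<le> n"
  shows
  "ext_power scale (n - 1) = fscale.span {so_wedge i j | i j. 1 \<le> i \<and> i < j \<and> j \<le> n + 1}"
    (is "_ = fscale.span ?B")
proof
  show "fscale.span ?B \<subseteq> ext_power scale (n - 1)"
    by (intro fscale.span_minimal ext_power_subspace) (auto intro: so_wedge_in_ext_power)
  interpret w: alt_map scale fscale "n - 1" "wedge scale" by (rule wedge_alt_map)
  have "wedge scale as \<in> fscale.span ?B" if as: "length as = n - 1" for as
  proof (rule w.in_subspace[OF _ e_span _ as])
    fix ks assume ks: "length ks = n - 1" "set ks \<subseteq> {1..n+1}" "distinct ks"
    show "wedge scale (map e ks) \<in> fscale.span ?B"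
    proof -
      \<comment> \<open>A list of n - 1 distinct indices omits exactly two, so up to sign it is a
        \<open>rest_list\<close>.\<close>
      have "card ({1..n+1} - set ks) = 2"
        using ks n by (simp add: card_rest distinct_card)
      then obtain i j where ij: "{1..n+1} - set ks = {i, j}" "i \<noteq> j"
        by (metis card_2_iff)
      then obtain i j where ij: "{1..n+1} - set ks = {i, j}" "i < j"
        by (metis insert_commute linorder_neqE_nat)
      have "set ks = set (rest_list {i, j})" using ij(1) ks(2) by (auto simp: set_rest_list)
      then have "mset ks = mset (rest_list {i, j})"
        using ks(3) distinct_rest_list set_eq_iff_mset_eq_distinct by blast
      then have "mset (map e ks) = mset (map e (rest_list {i, j}))" by simp
      then have "wedge scale (map e ks) = wedge scale (map e (rest_list {i, j})) \<or>
          wedge scale (map e ks) = - wedge scale (map e (rest_list {i, j}))"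
        using w.perm ks(1) by simp
      moreover have "wedge scale (map e (rest_list {i, j})) = fscale (sgn2 i j) (so_wedge i j)"
        unfolding so_wedge_def using sgn2_square[of i j] ij(2) by simp
      moreover have "i \<in> {1..n+1}" "j \<in> {1..n+1}" using ij(1) by blast+
      then have "so_wedge i j \<in> fscale.span ?B" using ij by (intro fscale.span_base) auto
      ultimately show ?thesis by (auto intro!: fscale.span_neg fscale.span_scale)
    qed
  qed simp
  then show "ext_power scale (n - 1) \<subseteq> fscale.span ?B"
    unfolding ext_power_def by (intro fscale.span_minimal) auto
qed

lemma so_wedge_bracket_wedge:
  assumes ij: "i \<noteq> j" "i \<in> {1..n+1}" "j \<in> {1..n+1}" and bs: "length bs = n - 1"
  shows "basic_bracket scale n br (so_wedge i j) (wedge scale bs) =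
    (\<Sum>p<n - 1. wedge scale (bs[p := scale (sgn2 i j) (br (map e (rest_list {i, j}) @ [bs ! p]))]))"
proof -
  have n: "1 \<le> n" using ij by auto
  have as: "length (map e (rest_list {i, j})) = n - 1"
    using ij card_rest[of "{i, j}"] by (simp add: length_rest_list)
  interpret w: alt_map scale fscale "n - 1" "wedge scale" by (rule wedge_alt_map)
  have "basic_bracket scale n br (so_wedge i j) (wedge scale bs) =
    fscale (sgn2 i j) (\<Sum>p<n - 1. wedge scale (bs[p := br (map e (rest_list {i, j}) @ [bs ! p])]))"
    unfolding so_wedge_def basic_bracket_left_linear basic_bracket_wedge[OF n as bs] ..
  also have "\<dots> = (\<Sum>p<n - 1. wedge scale (bs[p := scale (sgn2 i j) (br (map e (rest_list {i, j}) @ [bs ! p]))]))"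
    unfolding fscale.scale_sum_right
    by (intro sum.cong refl) (simp add: alternating_mapD(2)[OF w.alt bs])
  finally show ?thesis .
qed

text \<open>By \<open>hodge3\<close>, \<open>so_wedge j l\<close> is plus or minus the wedge of e_i
  with the common rest. The derivation kills the rest and turns e_i into - e_j, and the same sign
  identifies the result as \<open>so_wedge i l\<close>.\<close>

lemma so_wedge_bracket_shared:
  assumes d: "distinct [i, j, l]" and I: "i \<in> {1..n+1}" "j \<in> {1..n+1}" "l \<in> {1..n+1}"
  shows "basic_bracket scale n br (so_wedge i j) (so_wedge j l) = so_wedge i l"
proof -
  have n: "2 \<le> n"
  proof -
    have "card {i, j, l} \<le> card {1..n+1}" by (rule card_mono) (use I in auto)
    then show ?thesis using d by simp
  qed
  obtain s where h: "hodge3 i j l s" using ex_hodge3[OF d I] by blast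
  let ?r = "map e (rest_list {i, j, l})"
  interpret w: alt_map scale fscale "n - 1" "wedge scale" by (rule wedge_alt_map)
  have len: "length ?r + 1 = n - 1"
    using card_rest[of "{i, j, l}"] I d n by (simp add: length_rest_list)
  have s: "s * s = 1" and wi: "wedge scale (e i # ?r) = fscale s (so_wedge j l)"
    and wj: "wedge scale (e j # ?r) = fscale (- s) (so_wedge i l)"
    using h by (simp_all add: hodge3_def)
  have jl: "so_wedge j l = fscale s (wedge scale (e i # ?r))"
    unfolding wi using s by simp
  let ?D = "\<lambda>u. scale (sgn2 i j) (br (map e (rest_list {i, j}) @ [u]))"
  have "basic_bracket scale n br (so_wedge i j) (wedge scale (e i # ?r)) =
      (\<Sum>p<n - 1. wedge scale ((e i # ?r)[p := ?D ((e i # ?r) ! p)]))"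
    using d I len by (intro so_wedge_bracket_wedge) auto
  also have "\<dots> = (\<Sum>p\<in>{0}. wedge scale ((e i # ?r)[p := ?D ((e i # ?r) ! p)]))"
  proof (rule sum.mono_neutral_right)
    show "\<forall>p\<in>{..<n - 1} - {0}. wedge scale ((e i # ?r)[p := ?D ((e i # ?r) ! p)]) = 0"
    proof
      fix p assume p: "p \<in> {..<n - 1} - {0}"
      then obtain q where q: "p = Suc q" "q < length ?r" using len by (cases p) auto
      let ?k = "rest_list {i, j, l} ! q"
      have "?k \<in> set (rest_list {i, j, l})" using q by simp
      then have "?k \<in> {1..n+1}" "?k \<noteq> i" "?k \<noteq> j" by (auto simp: set_rest_list)
      then have "?D ((e i # ?r) ! p) = 0"
        using br_rest_other[of i j ?k] d I q by simp
      moreover have "wedge scale ((e i # ?r)[p := 0]) = 0"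
        using alternating_mapD(2)[OF w.alt, of "e i # ?r" p 0 0] len p by simp
      ultimately show "wedge scale ((e i # ?r)[p := ?D ((e i # ?r) ! p)]) = 0" by (simp only:)
    qed
  qed (use len in auto)
  also have "\<dots> = wedge scale (- e j # ?r)"
    using br_rest_pair(1)[of i j] d I by simp
  also have "\<dots> = - wedge scale (e j # ?r)"
    using w.scale_at[of "[]" ?r "- 1" "e j"] len by simp
  finally have b: "basic_bracket scale n br (so_wedge i j) (wedge scale (e i # ?r)) = fscale s (so_wedge i l)"
    unfolding wj by simp
  have "basic_bracket scale n br (so_wedge i j) (fscale s (wedge scale (e i # ?r)) + 0)
     = fscale s (basic_bracket scale n br (so_wedge i j) (wedge scale (e i # ?r)))
      + basic_bracket scale n br (so_wedge i j) 0"
    using n I len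
    by (intro basic_bracket_right_linear so_wedge_in_ext_power wedge_in_ext_power)
      (auto simp: fscale.subspace_0 ext_power_subspace)
  moreover have "basic_bracket scale n br (so_wedge i j) 0 = 0"
    using basic_bracket_right_linear[of "so_wedge i j" 0 0 1] n I so_wedge_in_ext_power
    by (simp add: fscale.subspace_0 ext_power_subspace)
  ultimately show ?thesis
    unfolding jl b using s by simp
qed

text \<open>If the pairs are disjoint, replacing e_i by - e_j or e_j by e_i creates a repeated
  factor. If they are equal, neither e_i nor e_j occurs in the wedge.\<close>

lemma so_wedge_bracket_disjoint:
  assumes ij: "i \<noteq> j" "k \<noteq> l" and I: "i \<in> {1..n+1}" "j \<in> {1..n+1}" "k \<in> {1..n+1}" "l \<in> {1..n+1}"
    and kl: "{k, l} = {i, j} \<or> {k, l} \<inter> {i, j} = {}"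
  shows "basic_bracket scale n br (so_wedge i j) (so_wedge k l) = 0"
proof -
  have n: "1 \<le> n" using ij I by auto
  interpret w: alt_map scale fscale "n - 1" "wedge scale" by (rule wedge_alt_map)
  let ?r = "map e (rest_list {k, l})"
  have len: "length ?r = n - 1"
    using ij I card_rest[of "{k, l}"] by (simp add: length_rest_list)
  let ?D = "\<lambda>u. scale (sgn2 i j) (br (map e (rest_list {i, j}) @ [u]))"
  have z: "wedge scale (?r[p := ?D (?r ! p)]) = 0" if p: "p < n - 1" for p
  proof -
    let ?k = "rest_list {k, l} ! p"
    have pl: "p < length (rest_list {k, l})" using p len by simp
    have rp: "?r ! p = e ?k" using pl by simp
    have kI: "?k \<in> {1..n+1}" "?k \<notin> {k, l}" using nth_mem[OF pl] by (auto simp: set_rest_list)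
    have nd: "wedge scale (?r[p := scale c (e q)]) = 0"
      if q: "q \<in> {1..n+1}" "q \<notin> {k, l}" "q \<noteq> ?k" for q c
    proof -
      have "q \<in> set (rest_list {k, l})" using q by (simp add: set_rest_list)
      then obtain p' where p': "p' < length (rest_list {k, l})" "rest_list {k, l} ! p' = q"
        by (meson in_set_conv_nth)
      then have "p' \<noteq> p" using q by auto
      then have "\<not> distinct (?r[p := e q])"
        using p' pl nth_eq_iff_index_eq[of "?r[p := e q]" p p'] by auto
      then have "wedge scale (?r[p := e q]) = 0" using len by (intro w.not_distinct) auto
      then show ?thesis using alternating_mapD(2)[OF w.alt len p, of c "e q"] by simp
    qed
    consider "?k \<noteq> i" "?k \<noteq> j" | "?k = i" "{k, l} \<inter> {i, j} = {}" | "?k = j" "{k, l} \<inter> {i, j} = {}"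
      using kl kI(2) by blast
    then show ?thesis
    proof cases
      case 1
      then have "br (map e (rest_list {i, j}) @ [?r ! p]) = 0"
        using br_rest_other[of i j ?k] ij I kI unfolding rp by simp
      then have "?D (?r ! p) = 0" by (simp only: scale_zero_right)
      then show ?thesis using alternating_mapD(2)[OF w.alt len p, of 0 0] by (simp only: fscale.scale_zero_left scale_zero_left)
    next
      case 2
      then have "?D (?r ! p) = scale (- 1) (e j)" using br_rest_pair(1)[of i j] ij I unfolding rp by simp
      then show ?thesis using nd[of j "- 1"] 2 ij I by (metis Int_iff empty_iff insertCI)
    next
      case 3
      then have "?D (?r ! p) = scale 1 (e i)" using br_rest_pair(2)[of i j] ij I unfolding rp by simp
      then show ?thesis using nd[of i 1] 3 ij I by (metis Int_iff empty_iff insertCI)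
    qed
  qed
  have b: "basic_bracket scale n br (so_wedge i j) (wedge scale ?r) = 0"
    unfolding so_wedge_bracket_wedge[OF ij(1) I(1,2) len] using z by (intro sum.neutral) auto
  have m: "so_wedge i j \<in> ext_power scale (n - 1)" "wedge scale ?r \<in> ext_power scale (n - 1)"
    "0 \<in> ext_power scale (n - 1)"
    using I len by (auto intro: so_wedge_in_ext_power wedge_in_ext_power simp: fscale.subspace_0 ext_power_subspace)
  have "basic_bracket scale n br (so_wedge i j) 0 = 0"
    using basic_bracket_right_linear[OF n m(1,3,3), of 1] by simp
  then show ?thesis
    using basic_bracket_right_linear[OF n m, of "sgn2 k l"] b unfolding so_wedge_def[of k l] by simp
qed

lemma basic_bracket_uminus_right:
  assumes n: "1 \<le> n" and m: "x \<in> ext_power scale (n - 1)" "y \<in> ext_power scale (n - 1)"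
  shows "basic_bracket scale n br x (- y) = - basic_bracket scale n br x y"
proof -
  have z: "0 \<in> ext_power scale (n - 1)" by (simp add: fscale.subspace_0 ext_power_subspace)
  have "basic_bracket scale n br x 0 = 0"
    using basic_bracket_right_linear[OF n m(1) z z, of 1] by simp
  then show ?thesis using basic_bracket_right_linear[OF n m z, of "- 1"] by simp
qed

lemma basic_bracket_uminus_left:
  "basic_bracket scale n br (- x) y = - basic_bracket scale n br x y"
  using basic_bracket_left_linear(2)[of "- 1" x y] by simp

text \<open>Skew-symmetry in each pair of indices brings every overlap into the form treated in
  \<open>so_wedge_bracket_shared\<close>.\<close>

lemma so_wedge_bracket:
  assumes n: "1 \<le> n" and I: "i \<in> {1..n+1}" "j \<in> {1..n+1}" "k \<in> {1..n+1}" "l \<in> {1..n+1}"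
  shows "basic_bracket scale n br (so_wedge i j) (so_wedge k l) =
    fscale (of_bool (j = k)) (so_wedge i l) - fscale (of_bool (j = l)) (so_wedge i k)
    - fscale (of_bool (i = k)) (so_wedge j l) + fscale (of_bool (i = l)) (so_wedge j k)"
proof -
  let ?b = "basic_bracket scale n br"
  note m = so_wedge_in_ext_power
  show ?thesis
  proof (cases "i = j \<or> k = l")
    case True
    have "?b 0 y = 0" for y by (simp add: basic_bracket_def fun_eq_iff)
    moreover have "?b (so_wedge i j) 0 = 0"
      using basic_bracket_right_linear[OF n m m m, of i j 1 1 1 1 1] I by (simp add: so_wedge_same)
    ultimately show ?thesis using True so_wedge_anti[of i j] so_wedge_anti[of i k]
      by (auto simp: so_wedge_same)
  next
    case False
    have an: "so_wedge j i = - so_wedge i j" for i j by (rule so_wedge_anti)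
    consider "{k, l} = {i, j} \<or> {k, l} \<inter> {i, j} = {}" | "j = k" "l \<noteq> i" | "j = l" "k \<noteq> i"
      | "i = k" "l \<noteq> j" | "i = l" "k \<noteq> j" by blast
    then show ?thesis
    proof cases
      case 1
      then have "?b (so_wedge i j) (so_wedge k l) = 0"
        using False I by (intro so_wedge_bracket_disjoint) auto
      then show ?thesis using 1 False by (auto simp: so_wedge_same doubleton_eq_iff)
    next
      case 2
      then show ?thesis using so_wedge_bracket_shared[of i j l] False I by auto
    next
      case 3
      have "?b (so_wedge i j) (so_wedge k j) = - ?b (so_wedge i j) (so_wedge j k)"
        unfolding an[of k j] using I by (intro basic_bracket_uminus_right n m)
      then show ?thesis using 3 so_wedge_bracket_shared[of i j k] False I by auto
    next
      case 4
      have "?b (so_wedge i j) (so_wedge i l) = - ?b (so_wedge j i) (so_wedge i l)"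
        unfolding an[of i j] by (simp add: basic_bracket_uminus_left)
      then show ?thesis using 4 so_wedge_bracket_shared[of j i l] False I by auto
    next
      case 5
      have "?b (so_wedge i j) (so_wedge k i) = ?b (so_wedge j i) (so_wedge i k)"
        unfolding an[of i j] an[of k i] basic_bracket_uminus_left
        using basic_bracket_uminus_right[OF n m m, of j i i k] I by simp
      then show ?thesis using 5 so_wedge_bracket_shared[of j i k] False I by auto
    qed
  qed
qed

section \<open>Alternating forms separating the basis wedges, obtained from the bracket\<close>

definition coord_form :: "nat \<Rightarrow> nat \<Rightarrow> 'a list \<Rightarrow> complex" where
  "coord_form i j as = representation (e ` {1..n+1}) (br (as @ [e i])) (e j)"

lemma coord_form_alternating:
  assumes n: "1 \<le> n"
  shows "alternating_map scale (*) (n - 1) (coord_form i j)"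
  unfolding alternating_map_def coord_form_def
proof (intro conjI allI impI)
  have U: "x \<in> span (e ` {1..n+1})" for x using e_span by simp
  fix cs :: "'a list" and p x y
  assume a: "length cs = n - 1 \<and> p < n - 1"
  then have pn: "p < n" "length cs + 1 = n" using n by linarith+
  have "br (cs[p := x + y] @ [e i]) = br (cs[p := x] @ [e i]) + br (cs[p := y] @ [e i])"
    using alternating_mapD(1)[OF br_alternating, of "cs @ [e i]" p x y] a pn
    by (simp add: list_update_append)
  then show "representation (e ` {1..n+1}) (br (cs[p := x + y] @ [e i])) (e j) =
     representation (e ` {1..n+1}) (br (cs[p := x] @ [e i])) (e j)
     + representation (e ` {1..n+1}) (br (cs[p := y] @ [e i])) (e j)"
    by (simp add: representation_add[OF e_independent U U])
next
  have U: "x \<in> span (e ` {1..n+1})" for x using e_span by simp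
  fix cs :: "'a list" and p c x
  assume a: "length cs = n - 1 \<and> p < n - 1"
  then have pn: "p < n" "length cs + 1 = n" using n by linarith+
  have "br (cs[p := scale c x] @ [e i]) = scale c (br (cs[p := x] @ [e i]))"
    using alternating_mapD(2)[OF br_alternating, of "cs @ [e i]" p c x] a pn
    by (simp add: list_update_append)
  then show "representation (e ` {1..n+1}) (br (cs[p := scale c x] @ [e i])) (e j) =
     c * representation (e ` {1..n+1}) (br (cs[p := x] @ [e i])) (e j)"
    by (simp add: representation_scale[OF e_independent U])
next
  fix cs :: "'a list"
  assume a: "length cs = n - 1 \<and> \<not> distinct cs"
  then have "br (cs @ [e i]) = 0" using n by (intro br.not_distinct) auto
  then show "representation (e ` {1..n+1}) (br (cs @ [e i])) (e j) = 0"
    by (simp add: representation_zero)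
qed

lemma e_eq_iff: "i \<in> {1..n+1} \<Longrightarrow> j \<in> {1..n+1} \<Longrightarrow> e i = e j \<longleftrightarrow> i = j"
  using e_inj by (auto simp: inj_on_def)

lemma coord_e: "i \<in> {1..n+1} \<Longrightarrow> j \<in> {1..n+1} \<Longrightarrow>
  representation (e ` {1..n+1}) (scale c (e i)) (e j) = (if i = j then c else 0)"
  using e_span by (simp add: representation_scale[OF e_independent] representation_basis[OF e_independent] e_eq_iff)

text \<open>The bracket with e_i vanishes unless e_i is one of the two omitted vectors, and then it
  is plus or minus the other one. Hence independence of the wedges follows from that of the
  e_i.\<close>

lemma coord_form_wedge:
  assumes ij: "i \<noteq> j" "i \<in> {1..n+1}" "j \<in> {1..n+1}" and kl: "k \<noteq> l" "k \<in> {1..n+1}" "l \<in> {1..n+1}"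
  shows "wedge scale (map e (rest_list {k, l})) (coord_form i j) \<noteq> 0 \<longleftrightarrow> {k, l} = {i, j}"
proof -
  have n: "1 \<le> n" using ij by auto
  have len: "length (map e (rest_list {k, l})) = n - 1"
    using kl card_rest[of "{k, l}"] by (simp add: length_rest_list)
  have w: "wedge scale (map e (rest_list {k, l})) (coord_form i j) = coord_form i j (map e (rest_list {k, l}))"
    unfolding wedge_def len using coord_form_alternating[OF n] by simp
  have sq: "sgn2 k l * sgn2 k l = 1" "sgn2 k l \<noteq> 0" using sgn2_square[OF kl(1)] by auto
  consider "i \<noteq> k" "i \<noteq> l" | "i = k" | "i = l" by blast
  then show ?thesis
  proof cases
    case 1
    then show ?thesis
      unfolding w coord_form_def using br_rest_other[OF kl ij(2)] by (auto simp: representation_zero)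
  next
    case 2
    have "scale (sgn2 k l) (scale (sgn2 k l) (br (map e (rest_list {k, l}) @ [e k]))) = scale (sgn2 k l) (- e l)"
      using br_rest_pair(1)[OF kl] by simp
    then have "br (map e (rest_list {k, l}) @ [e k]) = scale (- sgn2 k l) (e l)"
      using sq by simp
    then show ?thesis
      unfolding w unfolding coord_form_def 2 using coord_e[OF kl(3) ij(3), of "- sgn2 k l"] sq ij kl
      by (auto simp: doubleton_eq_iff 2)
  next
    case 3
    have "scale (sgn2 k l) (scale (sgn2 k l) (br (map e (rest_list {k, l}) @ [e l]))) = scale (sgn2 k l) (e k)"
      using br_rest_pair(2)[OF kl] by simp
    then have "br (map e (rest_list {k, l}) @ [e l]) = scale (sgn2 k l) (e k)"
      using sq by simp
    then show ?thesis
      unfolding w unfolding coord_form_def 3 using coord_e[OF kl(2) ij(3)] sq ij kl by (auto simp: doubleton_eq_iff 3)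
  qed
qed

lemma so_wedge_nonzero:
  assumes "i \<noteq> j" "i \<in> {1..n+1}" "j \<in> {1..n+1}"
  shows "so_wedge i j \<noteq> 0"
proof
  assume "so_wedge i j = 0"
  then have "so_wedge i j (coord_form i j) = 0" by simp
  then show False
    using coord_form_wedge[OF assms assms] sgn2_square[OF assms(1)] by (auto simp: so_wedge_def fscale_def)
qed

definition wedge_basis :: "(('a list \<Rightarrow> complex) \<Rightarrow> complex) set" where
  "wedge_basis = {wedge_omit2 scale n e k l | k l. 1 \<le> k \<and> k < l \<and> l \<le> n + 1}"

lemma wedge_omit2_inj:
  assumes "1 \<le> i" "i < j" "j \<le> n + 1" "1 \<le> k" "k < l" "l \<le> n + 1"
  shows "wedge_omit2 scale n e k l = wedge_omit2 scale n e i j \<longleftrightarrow> k = i \<and> l = j"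
proof
  assume eq: "wedge_omit2 scale n e k l = wedge_omit2 scale n e i j"
  have "wedge_omit2 scale n e i j (coord_form i j) \<noteq> 0"
    using assms coord_form_wedge[of i j i j] by (auto simp: wedge_omit2_eq)
  then have "{k, l} = {i, j}"
    using assms coord_form_wedge[of i j k l] unfolding eq[symmetric] by (auto simp: wedge_omit2_eq)
  then show "k = i \<and> l = j" using assms by (auto simp: doubleton_eq_iff)
qed simp

lemma wedge_basis_independent: "\<not> fscale.dependent wedge_basis"
  unfolding fscale.dependent_def
proof clarify
  fix b assume b: "b \<in> wedge_basis" "b \<in> fscale.span (wedge_basis - {b})"
  then obtain i j where ij: "b = wedge_omit2 scale n e i j" "1 \<le> i" "i < j" "j \<le> n + 1"
    unfolding wedge_basis_def by blast
  have "x (coord_form i j) = 0" if "x \<in> fscale.span (wedge_basis - {b})" for x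
    using that
  proof (induction rule: fscale.span_induct_alt)
    case (step c y z)
    then obtain k l where kl: "y = wedge_omit2 scale n e k l" "1 \<le> k" "k < l" "l \<le> n + 1" "y \<noteq> b"
      unfolding wedge_basis_def by blast
    then have "{k, l} \<noteq> {i, j}" using ij by (auto simp: doubleton_eq_iff)
    then have "y (coord_form i j) = 0"
      using coord_form_wedge[of i j k l] kl ij by (auto simp: wedge_omit2_eq)
    then show ?case using step by (simp add: fscale_def)
  qed simp
  then have "b (coord_form i j) = 0" using b(2) by blast
  then show False using coord_form_wedge[of i j i j] ij by (auto simp: wedge_omit2_eq)
qed

lemma ext_power_eq_span_basis:
  assumes n: "1 \<le> n"
  shows "ext_power scale (n - 1) = fscale.span wedge_basis"
proof -
  have w: "so_wedge i j = fscale (sgn2 i j) (wedge_omit2 scale n e i j)" for i j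
    by (simp add: so_wedge_def wedge_omit2_eq)
  have "wedge_basis \<subseteq> ext_power scale (n - 1)"
  proof
    fix x assume "x \<in> wedge_basis"
    then obtain k l where kl: "x = wedge_omit2 scale n e k l" "1 \<le> k" "k < l" "l \<le> n + 1"
      unfolding wedge_basis_def by blast
    have "x = fscale (sgn2 k l) (so_wedge k l)"
      unfolding w kl(1) using sgn2_square[of k l] kl by simp
    then show "x \<in> ext_power scale (n - 1)"
      using kl so_wedge_in_ext_power[of k l] ext_power_subspace fscale.subspace_scale by auto
  qed
  then have "fscale.span wedge_basis \<subseteq> ext_power scale (n - 1)"
    by (intro fscale.span_minimal ext_power_subspace)
  moreover have "ext_power scale (n - 1) \<subseteq> fscale.span wedge_basis"
    unfolding ext_power_span[OF n]
    by (intro fscale.span_minimal) (auto simp: w wedge_basis_def intro!: fscale.span_scale intro: fscale.span_base)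
  ultimately show ?thesis by blast
qed

section \<open>The isomorphism on generators\<close>

lemma vp_iso_linear:
  assumes n: "1 \<le> n" and "x \<in> ext_power scale (n - 1)" "y \<in> ext_power scale (n - 1)"
  shows "vp_iso scale n e (x + y) = vp_iso scale n e x + vp_iso scale n e y"
    and "vp_iso scale n e (fscale c x) = oscale c (vp_iso scale n e x)"
  using assms(2,3) unfolding vp_iso_def ext_power_eq_span_basis[OF n] wedge_basis_def[symmetric]
  by (simp_all add: fscale.representation_add[OF wedge_basis_independent]
      fscale.representation_scale[OF wedge_basis_independent] distrib_right
      oscale.scale_left_distrib case_prod_unfold sum.distrib oscale.scale_sum_right mult.assoc)

lemma vp_iso_so_wedge:
  assumes n: "1 \<le> n" and ij: "i \<in> {1..n+1}" "j \<in> {1..n+1}"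
  shows "vp_iso scale n e (so_wedge i j) = so_gen i j"
proof -
  have lt: "vp_iso scale n e (so_wedge i j) = so_gen i j" if ij: "1 \<le> i" "i < j" "j \<le> n + 1" for i j
  proof -
    let ?P = "{(i, j). 1 \<le> i \<and> i < j \<and> j \<le> n + 1}"
    have fin: "finite ?P" by (rule finite_subset[of _ "{1..n+1} \<times> {1..n+1}"]) auto
    have b: "wedge_omit2 scale n e i j \<in> wedge_basis" using ij by (auto simp: wedge_basis_def)
    have "vp_iso scale n e (wedge_omit2 scale n e i j) =
      (\<Sum>p\<in>?P. if p = (i, j) then oscale ((- 1) ^ (i + j + n + 1)) (so_gen i j) else 0)"
      unfolding vp_iso_def wedge_basis_def[symmetric] case_prod_unfold
    proof (rule sum.cong[OF refl])
      fix p assume p: "p \<in> {p. 1 \<le> fst p \<and> fst p < snd p \<and> snd p \<le> n + 1}"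
      have "wedge_omit2 scale n e (fst p) (snd p) = wedge_omit2 scale n e i j \<longleftrightarrow> p = (i, j)"
        using wedge_omit2_inj[OF ij, of "fst p" "snd p"] p by (auto simp: prod_eq_iff)
      then show "oscale (fscale.representation wedge_basis (wedge_omit2 scale n e i j)
           (wedge_omit2 scale n e (fst p) (snd p)) * (- 1) ^ (fst p + snd p + n + 1)) (so_gen (fst p) (snd p)) =
         (if p = (i, j) then oscale ((- 1) ^ (i + j + n + 1)) (so_gen i j) else 0)"
        by (auto simp: fscale.representation_basis[OF wedge_basis_independent b])
    qed
    also have "\<dots> = oscale ((- 1) ^ (i + j + n + 1)) (so_gen i j)"
      using fin ij by (simp add: sum.delta case_prod_unfold)
    finally have "vp_iso scale n e (wedge_omit2 scale n e i j) = oscale (sgn2 i j) (so_gen i j)"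
      using ij by (simp add: sgn2_def)
    moreover have "so_wedge i j = fscale (sgn2 i j) (wedge_omit2 scale n e i j)"
      by (simp add: so_wedge_def wedge_omit2_eq)
    moreover have "wedge_omit2 scale n e i j \<in> ext_power scale (n - 1)"
      unfolding ext_power_eq_span_basis[OF n] using b by (rule fscale.span_base)
    ultimately show ?thesis
      using vp_iso_linear(2)[OF n] sgn2_square[of i j] ij by (metis nat_neq_iff oscale.scale_one oscale.scale_scale)
  qed
  have m: "so_wedge a b \<in> ext_power scale (n - 1)" if "a \<in> {1..n+1}" "b \<in> {1..n+1}" for a b
    by (rule so_wedge_in_ext_power[OF that])
  consider "i < j" | "i = j" | "j < i" by linarith
  then show ?thesis
  proof cases
    case 2
    have "vp_iso scale n e 0 = 0"
      using vp_iso_linear(1)[OF n, of 0 0] by (simp add: fscale.subspace_0 ext_power_subspace)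
    then show ?thesis using 2 by (simp add: so_wedge_same so_gen_same)
  next
    case 3
    have "so_wedge i j = fscale (- 1) (so_wedge j i)" using so_wedge_anti[of i j] by simp
    then have "vp_iso scale n e (so_wedge i j) = oscale (- 1) (so_gen j i)"
      using vp_iso_linear(2)[OF n m m, of j i j i "- 1"] ij lt[of j i] 3 by (simp del: fscale.scale_minus_left fscale.scale_one)
    then show ?thesis by (simp add: so_gen_anti[of i j])
  qed (use lt ij in auto)
qed

end

section \<open>The prolongation condition\<close>

lemma alternating_map_diff:
  assumes "complex_space sW" "alternating_map sV sW k f" "alternating_map sV sW k g"
  shows "alternating_map sV sW k (\<lambda>xs. f xs - g xs)"
proof -
  interpret complex_space sW by fact
  show ?thesis
    using assms(2,3) unfolding alternating_map_def by (simp add: scale_right_diff_distrib)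
qed

lemma alternating_map_sum:
  assumes "complex_space sW" "\<And>i. i \<in> A \<Longrightarrow> alternating_map sV sW k (f i)"
  shows "alternating_map sV sW k (\<lambda>xs. \<Sum>i\<in>A. f i xs)"
proof -
  interpret complex_space sW by fact
  show ?thesis
    using assms(2) unfolding alternating_map_def
    by (intro conjI allI impI) (simp_all add: sum.distrib scale_sum_right)
qed

lemma alternating_map_compose:
  assumes f: "alternating_map sV sW k f" and M: "\<And>xs. length xs = k \<Longrightarrow> f xs \<in> M"
    and T: "\<And>x y. x \<in> M \<Longrightarrow> y \<in> M \<Longrightarrow> T (x + y) = T x + T y" "\<And>c x. x \<in> M \<Longrightarrow> T (sW c x) = sU c (T x)"
      "T 0 = 0"
  shows "alternating_map sV sU k (\<lambda>xs. T (f xs))"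
  using f M T unfolding alternating_map_def by simp

lemma alternating_map_Cons:
  fixes f :: "'a::ab_group_add list \<Rightarrow> 'b::ab_group_add"
  assumes f: "alternating_map sV sW (Suc k) f"
  shows "alternating_map sV sW k (\<lambda>xs. f (a # xs))"
  unfolding alternating_map_def
proof (intro conjI allI impI)
  fix xs :: "'a list" and i x y assume "length xs = k \<and> i < k"
  then show "f (a # xs[i := x + y]) = f (a # xs[i := x]) + f (a # xs[i := y])"
    using alternating_mapD(1)[OF f, of "a # xs" "Suc i" x y] by simp
next
  fix xs :: "'a list" and i c x assume "length xs = k \<and> i < k"
  then show "f (a # xs[i := sV c x]) = sW c (f (a # xs[i := x]))"
    using alternating_mapD(2)[OF f, of "a # xs" "Suc i" c x] by simp
next
  fix xs :: "'a list" assume "length xs = k \<and> \<not> distinct xs"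
  then show "f (a # xs) = 0" by (intro alternating_mapD(3)[OF f]) auto
qed

lemma length_omit: "i < length xs \<Longrightarrow> length (omit i xs) = length xs - 1"
  by (simp add: omit_def)

lemma omit_append: "length xs = i \<Longrightarrow> omit i (xs @ a # ys) = xs @ ys"
  by (auto simp: omit_def)

lemma omit_update_same: "omit i (xs[i := x]) = omit i xs"
  by (simp add: omit_def)

lemma omit_update_other:
  assumes "i \<noteq> p" "p < length xs" "i < length xs"
  shows "\<exists>p'<length xs - 1. \<forall>x. omit i (xs[p := x]) = (omit i xs)[p' := x]"
proof (cases "p < i")
  case True
  have "omit i (xs[p := x]) = (omit i xs)[p := x]" for x
    using True assms by (simp add: omit_def take_update_swap list_update_append drop_update_cancel)
  then show ?thesis
    using True assms by (intro exI[of _ p]) auto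
next
  case False
  then have p: "i < p" using assms by simp
  then obtain q where q: "p = Suc (i + q)" using less_iff_Suc_add by auto
  have "omit i (xs[p := x]) = (omit i xs)[p - 1 := x]" for x
    unfolding q using assms(3) by (simp add: omit_def list_update_append drop_update_swap)
  then show ?thesis using p assms by (auto intro!: exI[of _ "p - 1"])
qed

lemma omit_not_distinct:
  assumes "p < length xs" "q < length xs" "p \<noteq> q" "xs ! p = xs ! q" "i \<noteq> p" "i \<noteq> q" "i < length xs"
  shows "\<not> distinct (omit i xs)"
proof -
  define pos where "pos = (\<lambda>p. if p < i then p else p - 1)"
  have nth: "omit i xs ! pos r = xs ! r" "pos r < length (omit i xs)" if "r \<noteq> i" "r < length xs" for r
    using that assms(7) by (auto simp: omit_def pos_def nth_append min_def)
  have "pos p \<noteq> pos q" using assms(3,5,6) by (auto simp: pos_def)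
  then show ?thesis
    using nth[of p] nth[of q] assms by (metis nth_eq_iff_index_eq)
qed

text \<open>If the entries at positions p < q agree, only the terms omitting one of them survive.
  The two remaining lists differ by moving that entry past q - p - 1 others, and with the signs in
  front the terms cancel.\<close>

lemma alternating_contract:
  assumes sV: "complex_space sV" and sW: "complex_space sW"
    and alt: "\<And>v. alternating_map sV sW (n - 1) (\<lambda>l. \<Phi> l v)"
    and lin: "\<And>l v w. length l = n - 1 \<Longrightarrow> \<Phi> l (v + w) = \<Phi> l v + \<Phi> l w"
      "\<And>l c v. length l = n - 1 \<Longrightarrow> \<Phi> l (sV c v) = sW c (\<Phi> l v)"
  shows "alternating_map sV sW n (\<lambda>as. \<Sum>i=1..n. sW ((- 1) ^ (i + n)) (\<Phi> (omit (i - 1) as) (as ! (i - 1))))"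
  unfolding alternating_map_def
proof (intro conjI allI impI)
  interpret W: complex_space sW by fact
  fix xs :: "'a list" and p x y
  assume a: "length xs = n \<and> p < n"
  have "\<Phi> (omit (i - 1) (xs[p := x + y])) (xs[p := x + y] ! (i - 1)) =
    \<Phi> (omit (i - 1) (xs[p := x])) (xs[p := x] ! (i - 1)) + \<Phi> (omit (i - 1) (xs[p := y])) (xs[p := y] ! (i - 1))"
    if i: "i \<in> {1..n}" for i
  proof -
    have il: "i - 1 < n" using i by auto
    then have len: "length (omit (i - 1) xs) = n - 1" using a by (subst length_omit) auto
    show ?thesis
    proof (cases "i - 1 = p")
    case True
    then show ?thesis using a i len by (simp add: omit_update_same lin)
  next
    case False
    then obtain p' where "p' < n - 1" "\<And>x. omit (i - 1) (xs[p := x]) = (omit (i - 1) xs)[p' := x]"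
      using omit_update_other[of "i - 1" p xs] a il by auto
    then show ?thesis using False alternating_mapD(1)[OF alt len] by simp
    qed
  qed
  then show "(\<Sum>i=1..n. sW ((- 1) ^ (i + n)) (\<Phi> (omit (i - 1) (xs[p := x + y])) (xs[p := x + y] ! (i - 1)))) =
    (\<Sum>i=1..n. sW ((- 1) ^ (i + n)) (\<Phi> (omit (i - 1) (xs[p := x])) (xs[p := x] ! (i - 1)))) +
    (\<Sum>i=1..n. sW ((- 1) ^ (i + n)) (\<Phi> (omit (i - 1) (xs[p := y])) (xs[p := y] ! (i - 1))))"
    by (simp add: W.scale_right_distrib sum.distrib)
next
  interpret W: complex_space sW by fact
  fix xs :: "'a list" and p c x
  assume a: "length xs = n \<and> p < n"
  have "\<Phi> (omit (i - 1) (xs[p := sV c x])) (xs[p := sV c x] ! (i - 1)) =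
    sW c (\<Phi> (omit (i - 1) (xs[p := x])) (xs[p := x] ! (i - 1)))"
    if i: "i \<in> {1..n}" for i
  proof -
    have il: "i - 1 < n" using i by auto
    then have len: "length (omit (i - 1) xs) = n - 1" using a by (subst length_omit) auto
    show ?thesis
    proof (cases "i - 1 = p")
    case True
    then show ?thesis using a i len by (simp add: omit_update_same lin)
  next
    case False
    then obtain p' where "p' < n - 1" "\<And>x. omit (i - 1) (xs[p := x]) = (omit (i - 1) xs)[p' := x]"
      using omit_update_other[of "i - 1" p xs] a il by auto
    then show ?thesis using False alternating_mapD(2)[OF alt len] by simp
    qed
  qed
  then show "(\<Sum>i=1..n. sW ((- 1) ^ (i + n)) (\<Phi> (omit (i - 1) (xs[p := sV c x])) (xs[p := sV c x] ! (i - 1)))) =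
    sW c (\<Sum>i=1..n. sW ((- 1) ^ (i + n)) (\<Phi> (omit (i - 1) (xs[p := x])) (xs[p := x] ! (i - 1))))"
    by (simp add: W.scale_sum_right mult.commute)
next
  interpret W: complex_space sW by fact
  fix xs :: "'a list"
  assume a: "length xs = n \<and> \<not> distinct xs"
  then obtain p q where pq: "p < q" "q < n" "xs ! p = xs ! q"
    by (metis distinct_conv_nth linorder_neqE_nat)
  let ?t = "\<lambda>i. sW ((- 1) ^ (i + n)) (\<Phi> (omit (i - 1) xs) (xs ! (i - 1)))"
  \<comment> \<open>The sum counts from 1 and list positions from 0, hence the exceptions p + 1 and
    q + 1.\<close>
  have "?t i = 0" if i: "i \<in> {1..n} - {p + 1, q + 1}" for i
  proof -
    have "\<not> distinct (omit (i - 1) xs)"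
      using a pq i by (intro omit_not_distinct[of p _ q]) auto
    moreover have "length (omit (i - 1) xs) = n - 1" using a i by (subst length_omit) auto
    ultimately show ?thesis using alternating_mapD(3)[OF alt] by simp
  qed
  then have "sum ?t {1..n} = sum ?t {p + 1, q + 1}"
    using pq by (intro sum.mono_neutral_right) auto
  also have "\<dots> = sW ((- 1) ^ (p + 1 + n)) (\<Phi> (omit p xs) (xs ! q)) + sW ((- 1) ^ (q + 1 + n)) (\<Phi> (omit q xs) (xs ! q))"
    using pq by simp
  also have "\<dots> = 0"
  proof -
    define X Y Z where "X = take p xs" and "Y = take (q - p - 1) (drop (Suc p) xs)" and "Z = drop (Suc q) xs"
    have x1: "xs = X @ xs ! p # drop (Suc p) xs"
      using id_take_nth_drop[of p xs] a pq by (simp add: X_def)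
    have "drop (Suc p) xs = Y @ xs ! q # Z"
      using id_take_nth_drop[of "q - p - 1" "drop (Suc p) xs"] a pq by (simp add: Y_def Z_def)
    then have xs: "xs = X @ xs ! q # Y @ xs ! q # Z" using x1 pq(3) by simp
    have l: "length X = p" "length Y = q - p - 1" using a pq by (simp_all add: X_def Y_def)
    have o1: "omit p xs = X @ Y @ xs ! q # Z"
      by (subst xs) (rule omit_append[OF l(1)])
    have o2: "omit q xs = X @ xs ! q # Y @ Z"
      using omit_append[of "X @ xs ! q # Y" q "xs ! q" Z] l pq xs by simp
    interpret f: alt_map sV sW "n - 1" "\<lambda>l. \<Phi> l (xs ! q)"
      using sV sW alt by (intro alt_map.intro alt_map_axioms.intro)
    have "length X + length Y + length Z + 1 = n - 1" using arg_cong[OF xs, of length] a by simp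
    then have "\<Phi> (omit q xs) (xs ! q) = sW ((- 1) ^ (q - p - 1)) (\<Phi> (omit p xs) (xs ! q))"
      unfolding o1 o2 using f.move[of X Y Z "xs ! q"] l by simp
    moreover have "(- 1) ^ (q + 1 + n) * (- 1) ^ (q - p - 1) = - ((- 1) ^ (p + 1 + n) :: complex)"
    proof -
      have "q + 1 + n + (q - p - 1) = 2 * (q - p - 1) + 1 + (p + 1 + n)" using pq by linarith
      then show ?thesis by (simp only: power_add[symmetric]) (simp add: power_add power_mult)
    qed
    ultimately show ?thesis by simp
  qed
  finally show "sum ?t {1..n} = 0" .
qed

section \<open>Reduction of the prolongation condition to the Pluecker relations\<close>

locale basic_Lie_module = vector_products_algebra scale n br e + W: complex_space sM
  for scale :: "complex \<Rightarrow> 'a::ab_group_add \<Rightarrow> 'a" and n br e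
    and sM :: "complex \<Rightarrow> 'm::ab_group_add \<Rightarrow> 'm" +
  fixes M :: "'m set" and \<rho> :: "(('a list \<Rightarrow> complex) \<Rightarrow> complex) \<Rightarrow> 'm \<Rightarrow> 'm"
  assumes n2: "2 \<le> n"
    and lie: "lie_module fscale (basic_Lie scale n) (basic_bracket scale n br) sM M \<rho>"
begin

lemma M_subspace: "W.subspace M"
  and rho_M: "x \<in> basic_Lie scale n \<Longrightarrow> u \<in> M \<Longrightarrow> \<rho> x u \<in> M"
  and rho_add_right: "x \<in> basic_Lie scale n \<Longrightarrow> u \<in> M \<Longrightarrow> w \<in> M \<Longrightarrow> \<rho> x (u + w) = \<rho> x u + \<rho> x w"
  and rho_scale_right: "x \<in> basic_Lie scale n \<Longrightarrow> u \<in> M \<Longrightarrow> \<rho> x (sM c u) = sM c (\<rho> x u)"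
  and rho_add_left: "x \<in> basic_Lie scale n \<Longrightarrow> y \<in> basic_Lie scale n \<Longrightarrow> u \<in> M \<Longrightarrow> \<rho> (x + y) u = \<rho> x u + \<rho> y u"
  and rho_scale_left: "x \<in> basic_Lie scale n \<Longrightarrow> u \<in> M \<Longrightarrow> \<rho> (fscale c x) u = sM c (\<rho> x u)"
  and rho_bracket: "x \<in> basic_Lie scale n \<Longrightarrow> y \<in> basic_Lie scale n \<Longrightarrow> u \<in> M \<Longrightarrow>
    \<rho> (basic_bracket scale n br x y) u = \<rho> x (\<rho> y u) - \<rho> y (\<rho> x u)"
  using lie unfolding lie_module_def by blast+

lemma rho_0_left: "u \<in> M \<Longrightarrow> \<rho> 0 u = 0"
  using rho_scale_left[of 0 u 0] fscale.subspace_0[OF ext_power_subspace] by simp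

lemma rho_0_right: "x \<in> basic_Lie scale n \<Longrightarrow> \<rho> x 0 = 0"
  using rho_scale_right[of x 0 0] W.subspace_0[OF M_subspace] by simp

lemma rho_wedge_alternating:
  assumes u: "u \<in> M"
  shows "alternating_map scale sM (n - 1) (\<lambda>as. \<rho> (wedge scale as) u)"
  using wedge_alternating by (rule alternating_map_compose[where M = "basic_Lie scale n"])
    (rule wedge_in_ext_power rho_add_left rho_scale_left rho_0_left u | assumption)+

lemma rho_wedge_alt_map: "u \<in> M \<Longrightarrow> alt_map scale sM (n - 1) (\<lambda>as. \<rho> (wedge scale as) u)"
  by (intro alt_map.intro alt_map_axioms.intro complex_space_axioms W.complex_space_axioms rho_wedge_alternating)

text \<open>The defect of the condition. It is alternating in each of the two lists, so its
  vanishing can be tested on distinct basis vectors.\<close>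

definition prolong_gap :: "'m \<Rightarrow> 'a list \<Rightarrow> 'a list \<Rightarrow> 'm" where
  "prolong_gap u as bs = \<rho> (wedge scale (br as # bs)) u -
     (\<Sum>i=1..n. sM ((- 1) ^ (i + n)) (\<rho> (wedge scale (omit (i - 1) as)) (\<rho> (wedge scale (as ! (i - 1) # bs)) u)))"

lemma can_be_prolonged_gap:
  "can_be_prolonged scale n br sM M \<rho> \<longleftrightarrow>
    (\<forall>as bs. length as = n \<longrightarrow> length bs = n - 2 \<longrightarrow> (\<forall>u\<in>M. prolong_gap u as bs = 0))"
  by (simp add: can_be_prolonged_def prolong_gap_def)

lemma rho_Cons_linear:
  assumes "length bs = n - 2" "u \<in> M"
  shows "\<rho> (wedge scale ((x + y) # bs)) u = \<rho> (wedge scale (x # bs)) u + \<rho> (wedge scale (y # bs)) u"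
    and "\<rho> (wedge scale (scale c x # bs)) u = sM c (\<rho> (wedge scale (x # bs)) u)"
    and "\<rho> (wedge scale (0 # bs)) u = 0"
    and "\<rho> (wedge scale (x # bs)) u \<in> M"
proof -
  interpret f: alt_map scale sM "n - 1" "\<lambda>as. \<rho> (wedge scale as) u" by (rule rho_wedge_alt_map[OF assms(2)])
  have "length bs + 1 = n - 1" using assms(1) n2 by simp
  then show "\<rho> (wedge scale ((x + y) # bs)) u = \<rho> (wedge scale (x # bs)) u + \<rho> (wedge scale (y # bs)) u"
    "\<rho> (wedge scale (scale c x # bs)) u = sM c (\<rho> (wedge scale (x # bs)) u)"
    "\<rho> (wedge scale (0 # bs)) u = 0"
    "\<rho> (wedge scale (x # bs)) u \<in> M"
    using f.add_at[of "[]" bs] f.scale_at[of "[]" bs] f.zero_at[of "[]" bs] assms(2)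
      rho_M[OF wedge_in_ext_power[of "x # bs"] assms(2)]
    by auto
qed

lemma prolong_gap_alternating_left:
  assumes u: "u \<in> M" and bs: "length bs = n - 2"
  shows "alternating_map scale sM n (\<lambda>as. prolong_gap u as bs)"
  unfolding prolong_gap_def
proof (rule alternating_map_diff[OF W.complex_space_axioms])
  show "alternating_map scale sM n (\<lambda>as. \<rho> (wedge scale (br as # bs)) u)"
    using br_alternating by (rule alternating_map_compose[where M = UNIV])
      (use u bs in \<open>simp_all add: rho_Cons_linear\<close>)
  show "alternating_map scale sM n (\<lambda>as. \<Sum>i = 1..n. sM ((- 1) ^ (i + n))
     (\<rho> (wedge scale (omit (i - 1) as)) (\<rho> (wedge scale (as ! (i - 1) # bs)) u)))"
    by (rule alternating_contract[where \<Phi> = "\<lambda>l v. \<rho> (wedge scale l) (\<rho> (wedge scale (v # bs)) u)"])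
      (use u bs in \<open>simp_all add: complex_space_axioms W.complex_space_axioms rho_wedge_alternating rho_Cons_linear
        rho_add_right rho_scale_right wedge_in_ext_power\<close>)
qed

lemma prolong_gap_alternating_right:
  assumes u: "u \<in> M" and as: "length as = n"
  shows "alternating_map scale sM (n - 2) (\<lambda>bs. prolong_gap u as bs)"
  unfolding prolong_gap_def
proof (rule alternating_map_diff[OF W.complex_space_axioms])
  have n': "n - 1 = Suc (n - 2)" using n2 by simp
  have c: "alternating_map scale sM (n - 2) (\<lambda>bs. \<rho> (wedge scale (a # bs)) u)" for a
    using rho_wedge_alternating[OF u] unfolding n' by (rule alternating_map_Cons)
  show "alternating_map scale sM (n - 2) (\<lambda>bs. \<rho> (wedge scale (br as # bs)) u)" by (rule c)
  show "alternating_map scale sM (n - 2) (\<lambda>bs. \<Sum>i = 1..n. sM ((- 1) ^ (i + n))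
     (\<rho> (wedge scale (omit (i - 1) as)) (\<rho> (wedge scale (as ! (i - 1) # bs)) u)))"
  proof (rule alternating_map_sum[OF W.complex_space_axioms])
    fix i assume i: "i \<in> {1..n}"
    have w: "wedge scale (omit (i - 1) as) \<in> basic_Lie scale n"
      using as i by (intro wedge_in_ext_power, subst length_omit) auto
    show "alternating_map scale sM (n - 2) (\<lambda>bs. sM ((- 1) ^ (i + n))
     (\<rho> (wedge scale (omit (i - 1) as)) (\<rho> (wedge scale (as ! (i - 1) # bs)) u)))"
      using c by (rule alternating_map_compose[where M = M])
        (use w u in \<open>simp_all add: rho_add_right rho_scale_right rho_0_right rho_Cons_linear W.scale_right_distrib mult.commute\<close>)
  qed
qed

text \<open>For arguments of this shape, the prolongation condition is the compatibility of \<open>\<rho>\<close> with the bracket.\<close>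

lemma prolong_gap_shared:
  assumes u: "u \<in> M" and bs: "length bs = n - 2"
  shows "prolong_gap u (a # b # bs) bs = 0"
proof -
  have wl: "wedge scale (x # bs) \<in> basic_Lie scale n" for x
    using bs n2 by (intro wedge_in_ext_power) simp
  have len: "length (x # bs) = n - 1" for x using bs n2 by simp
  interpret w: alt_map scale fscale "n - 1" "wedge scale" by (rule wedge_alt_map)
  let ?t = "\<lambda>i. sM ((- 1) ^ (i + n))
     (\<rho> (wedge scale (omit (i - 1) (a # b # bs))) (\<rho> (wedge scale ((a # b # bs) ! (i - 1) # bs)) u))"
  have "sum ?t {1..n} = sum ?t {1, 2}"
  proof (rule sum.mono_neutral_right)
    show "\<forall>i\<in>{1..n} - {1, 2}. ?t i = 0"
    proof
      fix i assume i: "i \<in> {1..n} - {1, 2}"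
      then have "i - 1 = Suc (Suc (i - 3))" "i - 3 < length bs" using bs by auto
      then have "(a # b # bs) ! (i - 1) \<in> set bs" by simp
      then have "wedge scale ((a # b # bs) ! (i - 1) # bs) = 0"
        using len by (intro w.not_distinct) auto
      moreover have "length (omit (i - 1) (a # b # bs)) = n - 1"
        using i bs by (subst length_omit) auto
      ultimately show "?t i = 0"
        using u by (simp add: rho_0_left rho_0_right wedge_in_ext_power)
    qed
  qed (use n2 in auto)
  also have "\<dots> = ?t 1 + ?t 2" by simp
  also have "\<dots> = sM ((- 1) ^ n) (\<rho> (wedge scale (a # bs)) (\<rho> (wedge scale (b # bs)) u)
     - \<rho> (wedge scale (b # bs)) (\<rho> (wedge scale (a # bs)) u))"
    by (simp add: omit_def numeral_2_eq_2 W.scale_right_diff_distrib power_add)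
  also have "\<dots> = sM ((- 1) ^ n) (\<rho> (basic_bracket scale n br (wedge scale (a # bs)) (wedge scale (b # bs))) u)"
    using rho_bracket[OF wl wl u] by simp
  also have "basic_bracket scale n br (wedge scale (a # bs)) (wedge scale (b # bs)) =
     (\<Sum>p<n - 1. wedge scale ((b # bs)[p := br ((a # bs) @ [(b # bs) ! p])]))"
    using n2 by (intro basic_bracket_wedge len) simp
  also have "\<dots> = (\<Sum>p\<in>{0}. wedge scale ((b # bs)[p := br ((a # bs) @ [(b # bs) ! p])]))"
  proof (rule sum.mono_neutral_right)
    show "\<forall>p\<in>{..<n - 1} - {0}. wedge scale ((b # bs)[p := br ((a # bs) @ [(b # bs) ! p])]) = 0"
    proof
      fix p assume p: "p \<in> {..<n - 1} - {0}"
      then obtain q where q: "p = Suc q" "q < length bs" using len[of b] by (cases p) auto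
      have "br ((a # bs) @ [(b # bs) ! p]) = 0"
        using q bs n2 by (intro br.not_distinct) auto
      moreover have "wedge scale ((b # bs)[p := 0]) = 0"
        using alternating_mapD(2)[OF w.alt len[of b], of p 0 0] p by simp
      ultimately show "wedge scale ((b # bs)[p := br ((a # bs) @ [(b # bs) ! p])]) = 0" by (simp only:)
    qed
  qed (use n2 in auto)
  also have "\<dots> = wedge scale (br (a # bs @ [b]) # bs)" by simp
  finally have sum: "sum ?t {1..n} = sM ((- 1) ^ n) (\<rho> (wedge scale (br (a # bs @ [b]) # bs)) u)" .
  have "br (a # b # bs) = scale ((- 1) ^ (n - 2)) (br (a # bs @ [b]))"
    using br.move[of "[a]" bs "[]" b] bs n2 by simp
  also have "(- 1) ^ (n - 2) = ((- 1) ^ n :: complex)" by (rule minus_one_power_diff(2)[OF n2])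
  finally show ?thesis
    unfolding prolong_gap_def sum using rho_Cons_linear(2)[OF bs u] by simp
qed

text \<open>Hodge duality among four indices: two of the vectors wedged with the common rest give
  the generator of the complementary pair, with the sign of the permutation listing both pairs times
  one common s.\<close>

definition hodge4 :: "nat \<Rightarrow> nat \<Rightarrow> nat \<Rightarrow> nat \<Rightarrow> complex \<Rightarrow> bool" where
  "hodge4 i j k m s \<longleftrightarrow> s * s = 1 \<and>
    (let w = \<lambda>x y. wedge scale (e x # e y # map e (rest_list {i, j, k, m})) in
     w j k = fscale s (so_wedge i m) \<and> w i m = fscale s (so_wedge j k) \<and>
     w i k = fscale (- s) (so_wedge j m) \<and> w j m = fscale (- s) (so_wedge i k) \<and>
     w i j = fscale s (so_wedge k m) \<and> w k m = fscale s (so_wedge i j))"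

lemma length_rest4:
  assumes d: "distinct [i, j, k, m]" and I: "i \<in> {1..n+1}" "j \<in> {1..n+1}" "k \<in> {1..n+1}" "m \<in> {1..n+1}"
  shows "3 \<le> n" "length (rest_list {i, j, k, m}) = n - 3"
proof -
  have c: "card {i, j, k, m} = 4" using d by simp
  have s: "{i, j, k, m} \<subseteq> {1..n+1}" using I by blast
  then have "card {i, j, k, m} \<le> card {1..n+1}" by (intro card_mono) auto
  then show "3 \<le> n" unfolding c by simp
  show "length (rest_list {i, j, k, m}) = n - 3"
    unfolding length_rest_list card_rest[OF s] c by simp
qed

text \<open>Each vector in the second slot can be absorbed into the rest, up to a sign, which
  reduces to \<open>hodge3\<close>. Wedges obtained in two ways, by swapping their factors, tie the
  unknown signs together, as the generators are nonzero.\<close>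

lemma ex_hodge4:
  assumes d: "distinct [i, j, k, m]" and I: "i \<in> {1..n+1}" "j \<in> {1..n+1}" "k \<in> {1..n+1}" "m \<in> {1..n+1}"
  shows "\<exists>s. hodge4 i j k m s"
proof -
  interpret w: alt_map scale fscale "n - 1" "wedge scale" by (rule wedge_alt_map)
  let ?r = "map e (rest_list {i, j, k, m})"
  let ?w = "\<lambda>x y. wedge scale (e x # e y # ?r)"
  have n3: "3 \<le> n" by (rule length_rest4[OF d I])
  have len: "length ?r + 2 = n - 1"
    using length_rest4[OF d I] by simp
  have swap: "?w x y = - ?w y x" for x y
    using w.swap_adjacent[of "[]" ?r "e x" "e y"] len by simp
  have ins: "\<exists>\<epsilon>. \<epsilon> * \<epsilon> = 1 \<and> (\<forall>x. ?w x y = fscale \<epsilon> (wedge scale (e x # map e (rest_list S))))"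
    if S: "insert y S = {i, j, k, m}" "y \<notin> S" for y S
  proof -
    have "{i, j, k, m} \<subseteq> {1..n+1}" using I by auto
    then have "y \<in> {1..n+1}" using S(1) by blast
    then obtain xs ys where l: "rest_list S = xs @ y # ys" "rest_list (insert y S) = xs @ ys"
      using rest_list_insert[OF _ S(2)] by metis
    have "?w x y = fscale ((- 1) ^ length xs) (wedge scale (e x # map e (rest_list S)))" for x
      using w.move[of "[e x]" "map e xs" "map e ys" "e y"] len unfolding S(1)[symmetric] l by simp
    moreover have "(- 1) ^ length xs * (- 1) ^ length xs = (1 :: complex)"
      by (simp flip: power_add mult_2)
    ultimately show ?thesis by blast
  qed
  have cancel: "a = b" if "fscale a (so_wedge x y) = fscale b (so_wedge x y)" "x \<noteq> y" "x \<in> {1..n+1}" "y \<in> {1..n+1}" for a b x y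
    using that so_wedge_nonzero[of x y] by (metis fscale.scale_cancel_right)
  obtain \<epsilon>1 s1 where e1: "\<epsilon>1 * \<epsilon>1 = 1" "\<And>x. ?w x m = fscale \<epsilon>1 (wedge scale (e x # map e (rest_list {i, j, k})))"
    "hodge3 i j k s1"
    using ins[of m "{i, j, k}"] ex_hodge3[of i j k] d I by auto
  obtain \<epsilon>2 s2 where e2: "\<And>x. ?w x i = fscale \<epsilon>2 (wedge scale (e x # map e (rest_list {j, k, m})))"
    "hodge3 j k m s2"
    using ins[of i "{j, k, m}"] ex_hodge3[of j k m] d I by auto
  obtain \<epsilon>3 s3 where e3: "\<And>x. ?w x j = fscale \<epsilon>3 (wedge scale (e x # map e (rest_list {i, k, m})))"
    "hodge3 i k m s3"
    using ins[of j "{i, k, m}"] ex_hodge3[of i k m] d I by (auto simp: insert_commute)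
  have ne: "j \<noteq> k" "k \<noteq> m" using d by auto
  define s where "s = \<epsilon>1 * s1"
  have 1: "?w i m = fscale s (so_wedge j k)" "?w j m = fscale (- s) (so_wedge i k)" "?w k m = fscale s (so_wedge i j)"
    using e1 unfolding hodge3_def s_def by simp_all
  have 2: "?w j i = fscale (\<epsilon>2 * s2) (so_wedge k m)" "?w k i = fscale (- (\<epsilon>2 * s2)) (so_wedge j m)"
    "?w m i = fscale (\<epsilon>2 * s2) (so_wedge j k)"
    using e2 unfolding hodge3_def by simp_all
  have 3: "?w i j = fscale (\<epsilon>3 * s3) (so_wedge k m)" "?w k j = fscale (- (\<epsilon>3 * s3)) (so_wedge i m)"
    using e3 unfolding hodge3_def by simp_all
  have "fscale s (so_wedge j k) = fscale (- (\<epsilon>2 * s2)) (so_wedge j k)"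
    using 1(1) 2(3) swap[of i m] by simp
  from cancel[OF this ne(1) I(2,3)] have s2: "\<epsilon>2 * s2 = - s" by simp
  have ij: "?w i j = fscale s (so_wedge k m)" using 2(1) swap[of i j] unfolding s2 by simp
  then have "fscale (\<epsilon>3 * s3) (so_wedge k m) = fscale s (so_wedge k m)" using 3(1) by simp
  from cancel[OF this ne(2) I(3,4)] have s3: "\<epsilon>3 * s3 = s" .
  have "s * s = 1" using e1(1,3) unfolding hodge3_def s_def by (simp add: mult_ac)
  moreover have "?w i k = fscale (- s) (so_wedge j m)" using 2(2) swap[of i k] unfolding s2 by simp
  moreover have "?w j k = fscale s (so_wedge i m)" using 3(2) swap[of j k] unfolding s3 by simp
  ultimately have "hodge4 i j k m s" using 1 ij by (simp add: hodge4_def Let_def)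
  then show ?thesis ..
qed

definition pluecker_op :: "nat \<Rightarrow> nat \<Rightarrow> nat \<Rightarrow> nat \<Rightarrow> 'm \<Rightarrow> 'm" where
  "pluecker_op i j k m u = \<rho> (so_wedge i j) (\<rho> (so_wedge k m) u)
    - \<rho> (so_wedge i k) (\<rho> (so_wedge j m) u) + \<rho> (so_wedge i m) (\<rho> (so_wedge j k) u)"

lemma rho_so_wedge_commute:
  assumes d: "distinct [i, j, k, m]" and I: "i \<in> {1..n+1}" "j \<in> {1..n+1}" "k \<in> {1..n+1}" "m \<in> {1..n+1}"
    and u: "u \<in> M"
  shows "\<rho> (so_wedge i j) (\<rho> (so_wedge k m) u) = \<rho> (so_wedge k m) (\<rho> (so_wedge i j) u)"
proof -
  have "basic_bracket scale n br (so_wedge i j) (so_wedge k m) = 0"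
    using d I by (intro so_wedge_bracket_disjoint) auto
  then show ?thesis
    using rho_bracket[OF so_wedge_in_ext_power[OF I(1,2)] so_wedge_in_ext_power[OF I(3,4)] u]
      rho_0_left[OF u] by simp
qed

text \<open>The entries after the third recur in the second list, so only three terms of the sum
  survive; \<open>hodge4\<close> turns them into the Pluecker expression. The bracket of the first
  list is a multiple of e_m, which heads the second list, so the left-hand side is 0.\<close>

lemma prolong_gap_pluecker:
  assumes d: "distinct [i, j, k, m]" and I: "i \<in> {1..n+1}" "j \<in> {1..n+1}" "k \<in> {1..n+1}" "m \<in> {1..n+1}"
    and u: "u \<in> M"
  shows "prolong_gap u (map e (i # j # k # rest_list {i, j, k, m})) (map e (m # rest_list {i, j, k, m}))
    = sM ((- 1) ^ n) (pluecker_op i j k m u)"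
proof -
  interpret w: alt_map scale fscale "n - 1" "wedge scale" by (rule wedge_alt_map)
  let ?r = "map e (rest_list {i, j, k, m})"
  let ?as = "e i # e j # e k # ?r" and ?bs = "e m # ?r"
  have n3: "3 \<le> n" by (rule length_rest4[OF d I])
  have len: "length ?r = n - 3"
    using length_rest4[OF d I] by simp
  obtain s where s: "hodge4 i j k m s" using ex_hodge4[OF d I] ..
  let ?t = "\<lambda>q. sM ((- 1) ^ (q + n)) (\<rho> (wedge scale (omit (q - 1) ?as)) (\<rho> (wedge scale (?as ! (q - 1) # ?bs)) u))"
  have "sum ?t {1..n} = sum ?t {1, 2, 3}"
  proof (rule sum.mono_neutral_right)
    show "\<forall>q\<in>{1..n} - {1, 2, 3}. ?t q = 0"
    proof
      fix q assume q: "q \<in> {1..n} - {1, 2, 3}"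
      then have "q - 1 = Suc (Suc (Suc (q - 4)))" "q - 4 < length ?r" unfolding len by auto
      then have "?as ! (q - 1) \<in> set ?r" by (simp del: length_map set_map)
      then have "wedge scale (?as ! (q - 1) # ?bs) = 0"
        using len n3 by (intro w.not_distinct) auto
      moreover have "length (omit (q - 1) ?as) = n - 1"
        using q len n3 by (subst length_omit) auto
      ultimately show "?t q = 0"
        using u by (simp add: rho_0_left rho_0_right wedge_in_ext_power)
    qed
  qed (use n3 in auto)
  also have "\<dots> = ?t 1 + ?t 2 + ?t 3" by (simp add: add.assoc)
  also have "?t 1 = sM (- ((- 1) ^ n)) (\<rho> (wedge scale (e j # e k # ?r)) (\<rho> (wedge scale (e i # e m # ?r)) u))"
    by (simp add: omit_def power_add)
  also have "?t 2 = sM ((- 1) ^ n) (\<rho> (wedge scale (e i # e k # ?r)) (\<rho> (wedge scale (e j # e m # ?r)) u))"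
    by (simp add: omit_def numeral_2_eq_2 power_add)
  also have "?t 3 = sM (- ((- 1) ^ n)) (\<rho> (wedge scale (e i # e j # ?r)) (\<rho> (wedge scale (e k # e m # ?r)) u))"
    by (simp add: omit_def numeral_3_eq_3 power_add)
  also have "sM (- ((- 1) ^ n)) (\<rho> (wedge scale (e j # e k # ?r)) (\<rho> (wedge scale (e i # e m # ?r)) u))
    + sM ((- 1) ^ n) (\<rho> (wedge scale (e i # e k # ?r)) (\<rho> (wedge scale (e j # e m # ?r)) u))
    + sM (- ((- 1) ^ n)) (\<rho> (wedge scale (e i # e j # ?r)) (\<rho> (wedge scale (e k # e m # ?r)) u))
    = - sM ((- 1) ^ n) (pluecker_op i j k m u)"
  proof -
    have ss: "s * s = 1" using s by (simp add: hodge4_def)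
    note m = so_wedge_in_ext_power
    have two: "\<rho> (fscale a (so_wedge x y)) (\<rho> (fscale b (so_wedge x' y')) u)
      = sM (a * b) (\<rho> (so_wedge x y) (\<rho> (so_wedge x' y') u))"
      if "x \<in> {1..n+1}" "y \<in> {1..n+1}" "x' \<in> {1..n+1}" "y' \<in> {1..n+1}" for a b x y x' y'
      using m[OF that(1,2)] m[OF that(3,4)] u
      by (simp add: rho_scale_left rho_scale_right rho_M W.subspace_scale[OF M_subspace])
    have w: "wedge scale (e j # e k # ?r) = fscale s (so_wedge i m)" "wedge scale (e i # e m # ?r) = fscale s (so_wedge j k)"
      "wedge scale (e i # e k # ?r) = fscale (- s) (so_wedge j m)" "wedge scale (e j # e m # ?r) = fscale (- s) (so_wedge i k)"
      "wedge scale (e i # e j # ?r) = fscale s (so_wedge k m)" "wedge scale (e k # e m # ?r) = fscale s (so_wedge i j)"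
      using s unfolding hodge4_def Let_def by blast+
    have d': "distinct [i, k, j, m]" using d by auto
    show ?thesis
      unfolding w two[OF I(1,4,2,3)] two[OF I(2,4,1,3)] two[OF I(3,4,1,2)] minus_mult_minus ss pluecker_op_def
        rho_so_wedge_commute[OF d I u] rho_so_wedge_commute[OF d' I(1,3,2,4) u]
      by (simp add: W.scale_right_distrib W.scale_right_diff_distrib)
  qed
  finally have sum: "sum ?t {1..n} = - sM ((- 1) ^ n) (pluecker_op i j k m u)" .
  have "wedge scale (br ?as # ?bs) = 0"
  proof -
    have "set (i # j # k # rest_list {i, j, k, m}) = set (rest_list {m})"
      using d I by (auto simp: set_rest_list)
    moreover have "distinct (i # j # k # rest_list {i, j, k, m})"
      using d distinct_rest_list by (auto simp: set_rest_list)
    ultimately have "mset (i # j # k # rest_list {i, j, k, m}) = mset (rest_list {m})"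
      using distinct_rest_list set_eq_iff_mset_eq_distinct by blast
    then have "mset (map e (i # j # k # rest_list {i, j, k, m})) = mset (map e (rest_list {m}))"
      by (simp only: mset_map)
    then have "br ?as = br (map e (rest_list {m})) \<or> br ?as = - br (map e (rest_list {m}))"
      using br.perm[of "map e (i # j # k # rest_list {i, j, k, m})" "map e (rest_list {m})"] len n3 by simp
    moreover have "br (map e (rest_list {m})) = scale ((- 1) ^ m) (e m)"
      using br_basis[OF I(4)] by (simp add: rest_list_def)
    ultimately obtain c where c: "br ?as = scale c (e m)"
      using scale_minus_left by metis
    have "wedge scale (e m # ?bs) = 0" using len n3 by (intro w.not_distinct) auto
    then show ?thesis
      unfolding c using w.scale_at[of "[]" ?bs c "e m"] len n3 by simp
  qed
  then show ?thesis
    unfolding prolong_gap_def list.map sum using rho_0_left[OF u] by simp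
qed

text \<open>The first list omits exactly one index m. If m occurs in the second list, the three
  indices missing there, together with m, give a Pluecker relation. If not, the second list is
  contained in the first and \<open>prolong_gap_shared\<close> applies.\<close>

lemma can_be_prolonged_iff:
  "can_be_prolonged scale n br sM M \<rho> \<longleftrightarrow>
    (\<forall>i\<in>{1..n+1}. \<forall>j\<in>{1..n+1}. \<forall>k\<in>{1..n+1}. \<forall>m\<in>{1..n+1}. distinct [i, j, k, m] \<longrightarrow>
      (\<forall>u\<in>M. pluecker_op i j k m u = 0))" (is "?L \<longleftrightarrow> ?R")
proof
  assume L: ?L
  show ?R
  proof (intro ballI impI)
    fix i j k m u assume I: "i \<in> {1..n+1}" "j \<in> {1..n+1}" "k \<in> {1..n+1}" "m \<in> {1..n+1}"
      and d: "distinct [i, j, k, m]" and u: "u \<in> M"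
    note len = length_rest4(2)[OF d I] and n3 = length_rest4(1)[OF d I]
    have "prolong_gap u (map e (i # j # k # rest_list {i, j, k, m})) (map e (m # rest_list {i, j, k, m})) = 0"
      using L u len n3 unfolding can_be_prolonged_gap by simp
    then show "pluecker_op i j k m u = 0"
      unfolding prolong_gap_pluecker[OF d I u] by simp
  qed
next
  assume R: ?R
  have basis: "prolong_gap u (map e ks) (map e ls) = 0"
    if u: "u \<in> M" and ks: "length ks = n" "set ks \<subseteq> {1..n+1}" "distinct ks"
      and ls: "length ls = n - 2" "set ls \<subseteq> {1..n+1}" "distinct ls" for u ks ls
  proof -
    have g1: "alt_map scale sM n (\<lambda>as. prolong_gap u as bs)" if "length bs = n - 2" for bs
      by (intro alt_map.intro alt_map_axioms.intro complex_space_axioms W.complex_space_axioms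
        prolong_gap_alternating_left u that)
    have g2: "alt_map scale sM (n - 2) (\<lambda>bs. prolong_gap u as bs)" if "length as = n" for as
      by (intro alt_map.intro alt_map_axioms.intro complex_space_axioms W.complex_space_axioms
        prolong_gap_alternating_right u that)
    have perm: "prolong_gap u (map e ks) (map e ls) = 0"
      if z: "prolong_gap u (map e ks') (map e ls') = 0"
        and k: "set ks' = set ks" "distinct ks'" and l: "set ls' = set ls" "distinct ls'" for ks' ls'
    proof -
      have mk: "mset ks = mset ks'" using k ks(3) set_eq_iff_mset_eq_distinct by blast
      have ml: "mset ls = mset ls'" using l ls(3) set_eq_iff_mset_eq_distinct by blast
      have lk: "length ks' = n" using mk ks(1) by (metis size_mset)
      have "prolong_gap u (map e ks') (map e ls) = 0"
        using alt_map.perm[OF g2, of "map e ks'" "map e ls" "map e ls'"] lk ls(1) z ml by simp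
      then show ?thesis
        using alt_map.perm[OF g1, of "map e ls" "map e ks" "map e ks'"] ks(1) ls(1) mk by simp
    qed
    have "card ({1..n+1} - set ks) = 1" using ks by (simp add: card_rest distinct_card)
    then obtain m where m: "{1..n+1} - set ks = {m}" by (metis card_1_singletonE)
    have mI: "m \<in> {1..n+1}" and mk: "m \<notin> set ks" using m by blast+
    have setk: "set ks = {1..n+1} - {m}" using m ks(2) by blast
    have c3: "card ({1..n+1} - set ls) = 3" using ls n2 by (simp add: card_rest distinct_card)
    show ?thesis
    proof (cases "m \<in> set ls")
      case True
      obtain i j k where ijk: "{1..n+1} - set ls = {i, j, k}" "i \<noteq> j" "i \<noteq> k" "j \<noteq> k"
        using c3 by (auto simp: card_3_iff)
      have I: "i \<in> {1..n+1}" "j \<in> {1..n+1}" "k \<in> {1..n+1}" and nl: "i \<notin> set ls" "j \<notin> set ls" "k \<notin> set ls"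
        using ijk(1) by blast+
      have d: "distinct [i, j, k, m]" using ijk nl True by auto
      have setl: "set ls = {1..n+1} - {i, j, k}" using ijk(1) ls(2) by blast
      show ?thesis
      proof (rule perm)
        show "prolong_gap u (map e (i # j # k # rest_list {i, j, k, m})) (map e (m # rest_list {i, j, k, m})) = 0"
          unfolding prolong_gap_pluecker[OF d I mI u] using R I mI d u by simp
        show "set (i # j # k # rest_list {i, j, k, m}) = set ks"
          unfolding setk using d I by (auto simp: set_rest_list)
        show "set (m # rest_list {i, j, k, m}) = set ls"
          unfolding setl using d mI by (auto simp: set_rest_list)
      qed (use d distinct_rest_list in \<open>auto simp: set_rest_list\<close>)
    next
      case False
      have "m \<in> {1..n+1} - set ls" using False mI by blast
      then have "card ({1..n+1} - set ls - {m}) = 2" using c3 by simp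
      then obtain a b where ab: "{1..n+1} - set ls - {m} = {a, b}" "a \<noteq> b" by (auto simp: card_2_iff)
      show ?thesis
      proof (rule perm)
        show "prolong_gap u (map e (a # b # ls)) (map e ls) = 0"
          using prolong_gap_shared[OF u, of "map e ls"] ls(1) by simp
        show "set (a # b # ls) = set ks"
          unfolding setk using ab(1) False ls(2) by auto
        show "distinct (a # b # ls)" using ab ls(3) by auto
      qed (use ls in auto)
    qed
  qed
  show ?L
    unfolding can_be_prolonged_gap
  proof (intro allI impI ballI)
    fix as bs :: "'a list" and u assume as: "length as = n" and bs: "length bs = n - 2" and u: "u \<in> M"
    have 1: "prolong_gap u as (map e ls) = 0"
      if ls: "length ls = n - 2" "set ls \<subseteq> {1..n+1}" "distinct ls" for ls
    proof -
      interpret g: alt_map scale sM n "\<lambda>as. prolong_gap u as (map e ls)"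
        using ls(1) by (intro alt_map.intro alt_map_axioms.intro complex_space_axioms W.complex_space_axioms
          prolong_gap_alternating_left u) simp
      show ?thesis
        using g.in_subspace[OF W.subspace_single_0 e_span _ as] basis[OF u _ _ _ ls] by auto
    qed
    interpret g: alt_map scale sM "n - 2" "\<lambda>bs. prolong_gap u as bs"
      by (intro alt_map.intro alt_map_axioms.intro complex_space_axioms W.complex_space_axioms
        prolong_gap_alternating_right u as)
    show "prolong_gap u as bs = 0"
      using g.in_subspace[OF W.subspace_single_0 e_span _ bs] 1 by auto
  qed
qed

end

section \<open>Modules over the basic Lie algebra\<close>

lemma (in complex_space) ex_projection:
  assumes "subspace M"
  shows "\<exists>\<pi>. module_hom scale scale \<pi> \<and> (\<forall>u. \<pi> u \<in> M) \<and> (\<forall>u\<in>M. \<pi> u = u)"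
proof -
  interpret vector_space_pair scale scale by unfold_locales
  have "Vector_Spaces.linear scale scale (\<lambda>x. x)"
    by unfold_locales auto
  then obtain g where g: "g ` UNIV \<subseteq> M" "Vector_Spaces.linear scale scale g" "\<forall>v\<in>M. g v = v"
    using linear_exists_left_inverse_on[of "\<lambda>x. x" M] assms by auto
  then show ?thesis
    by (intro exI[of _ g]) (auto simp: Vector_Spaces.linear_def)
qed

text \<open>Abstract in the Lie algebra and its generators, so that the theory serves both the basic
  Lie algebra with \<open>so_wedge\<close> and \<open>so_alg\<close> with
  \<open>so_gen\<close>.\<close>

locale so_lie_module = complex_space sM + LL: complex_space sL
  for sM :: "complex \<Rightarrow> 'm::ab_group_add \<Rightarrow> 'm" and sL :: "complex \<Rightarrow> 'l::ab_group_add \<Rightarrow> 'l" +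
  fixes L :: "'l set" and lb :: "'l \<Rightarrow> 'l \<Rightarrow> 'l" and M :: "'m set" and \<rho> :: "'l \<Rightarrow> 'm \<Rightarrow> 'm"
    and N :: nat and g :: "nat \<Rightarrow> nat \<Rightarrow> 'l"
  assumes N3': "3 \<le> N"
    and lie: "lie_module sL L lb sM M \<rho>"
    and fin: "finite_dim sM M"
    and L_span: "L = LL.span {g i j | i j. i \<in> {1..N} \<and> j \<in> {1..N}}"
    and g_anti: "\<And>i j. g j i = - g i j"
    and g_bracket: "\<And>i j k l. i \<in> {1..N} \<Longrightarrow> j \<in> {1..N} \<Longrightarrow> k \<in> {1..N} \<Longrightarrow> l \<in> {1..N} \<Longrightarrow>
      lb (g i j) (g k l) = sL (of_bool (j = k)) (g i l) - sL (of_bool (j = l)) (g i k)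
        - sL (of_bool (i = k)) (g j l) + sL (of_bool (i = l)) (g j k)"
begin

lemma sub_M: "subspace M"
  and act_M: "x \<in> L \<Longrightarrow> u \<in> M \<Longrightarrow> \<rho> x u \<in> M"
  and act_add_right: "x \<in> L \<Longrightarrow> u \<in> M \<Longrightarrow> w \<in> M \<Longrightarrow> \<rho> x (u + w) = \<rho> x u + \<rho> x w"
  and act_scale_right: "x \<in> L \<Longrightarrow> u \<in> M \<Longrightarrow> \<rho> x (sM c u) = sM c (\<rho> x u)"
  and act_add_left: "x \<in> L \<Longrightarrow> y \<in> L \<Longrightarrow> u \<in> M \<Longrightarrow> \<rho> (x + y) u = \<rho> x u + \<rho> y u"
  and act_scale_left: "x \<in> L \<Longrightarrow> u \<in> M \<Longrightarrow> \<rho> (sL c x) u = sM c (\<rho> x u)"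
  and act_bracket: "x \<in> L \<Longrightarrow> y \<in> L \<Longrightarrow> u \<in> M \<Longrightarrow> \<rho> (lb x y) u = \<rho> x (\<rho> y u) - \<rho> y (\<rho> x u)"
  using lie unfolding lie_module_def by blast+

lemma sub_L: "LL.subspace L"
  by (simp add: L_span)

lemma g_in_L: "i \<in> {1..N} \<Longrightarrow> j \<in> {1..N} \<Longrightarrow> g i j \<in> L"
  unfolding L_span by (intro LL.span_base) blast

lemma act_uminus_left: "x \<in> L \<Longrightarrow> u \<in> M \<Longrightarrow> \<rho> (- x) u = - \<rho> x u"
  using act_scale_left[of x u "- 1"] by simp

lemma act_diff_left: "x \<in> L \<Longrightarrow> y \<in> L \<Longrightarrow> u \<in> M \<Longrightarrow> \<rho> (x - y) u = \<rho> x u - \<rho> y u"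
  using act_add_left[of x "- y" u] act_uminus_left[of y u] sub_L LL.subspace_neg by simp

text \<open>Composing with a projection onto \<open>M\<close> makes the operators linear on the whole type, so that their
  relations hold without membership conditions.\<close>

definition proj :: "'m \<Rightarrow> 'm" where
  "proj = (SOME \<pi>. module_hom sM sM \<pi> \<and> (\<forall>u. \<pi> u \<in> M) \<and> (\<forall>u\<in>M. \<pi> u = u))"

lemma proj: "module_hom sM sM proj" "proj u \<in> M" "u \<in> M \<Longrightarrow> proj u = u"
  using someI_ex[OF ex_projection[OF sub_M]] unfolding proj_def by blast+

text \<open>The value 0 outside the index range keeps linearity and values in \<open>M\<close> valid
  for all indices.\<close>

definition op :: "nat \<Rightarrow> nat \<Rightarrow> 'm \<Rightarrow> 'm" where
  "op i j u = (if i \<in> {1..N} \<and> j \<in> {1..N} then \<rho> (g i j) (proj u) else 0)"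

lemma op_eq: "i \<in> {1..N} \<Longrightarrow> j \<in> {1..N} \<Longrightarrow> op i j u = \<rho> (g i j) (proj u)"
  by (simp add: op_def)

lemma op_on_M: "i \<in> {1..N} \<Longrightarrow> j \<in> {1..N} \<Longrightarrow> u \<in> M \<Longrightarrow> op i j u = \<rho> (g i j) u"
  by (simp add: op_def proj)

sublocale so: so_rep sM N op M
proof
  show "3 \<le> N" by (rule N3')
  show "\<exists>B. finite B \<and> M = span B" using fin unfolding finite_dim_def .
  have M: "op i j u \<in> M" for i j u
    using subspace_0[OF sub_M] by (simp add: op_def act_M g_in_L proj)
  then show "op i j u \<in> M" for i j u .
  show "op i j (u + w) = op i j u + op i j w" "op i j (sM c u) = sM c (op i j u)" for i j u w c
    by (simp_all add: op_def module_hom.add[OF proj(1)] module_hom.scale[OF proj(1)] act_add_right act_scale_right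
        g_in_L proj)
  show "op j i u = - op i j u" if "i \<in> {1..N}" "j \<in> {1..N}" for i j u
    unfolding op_eq[OF that] op_eq[OF that(2,1)] g_anti[of j i] using that by (intro act_uminus_left g_in_L proj)
  have of_bool: "sM (of_bool b) w = (if b then w else 0)" for b w by simp
  show "op i j (op k l u) = op k l (op i j u) + (if j = k then op i l u else 0) - (if j = l then op i k u else 0)
        - (if i = k then op j l u else 0) + (if i = l then op j k u else 0)"
    if I: "i \<in> {1..N}" "j \<in> {1..N}" "k \<in> {1..N}" "l \<in> {1..N}" for i j k l u
  proof -
    have s: "sL c x \<in> L" if "x \<in> L" for c x using that sub_L by (rule LL.subspace_scale[rotated])
    have d: "x - y \<in> L" if "x \<in> L" "y \<in> L" for x y using that sub_L LL.subspace_diff by blast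
    have "op i j (op k l u) - op k l (op i j u) = \<rho> (lb (g i j) (g k l)) (proj u)"
      unfolding op_eq[OF I(1,2)] op_eq[OF I(3,4)] using I act_bracket[OF g_in_L g_in_L proj(2), of i j k l u]
      by (simp add: proj act_M g_in_L)
    also have "\<dots> = sM (of_bool (j = k)) (op i l u) - sM (of_bool (j = l)) (op i k u)
        - sM (of_bool (i = k)) (op j l u) + sM (of_bool (i = l)) (op j k u)"
      unfolding g_bracket[OF I] op_eq[OF I(1,4)] op_eq[OF I(1,3)] op_eq[OF I(2,4)] op_eq[OF I(2,3)]
      using I by (simp only: act_add_left act_diff_left act_scale_left g_in_L proj s d)
    finally have "op i j (op k l u) = (if j = k then op i l u else 0) - (if j = l then op i k u else 0)
        - (if i = k then op j l u else 0) + (if i = l then op j k u else 0) + op k l (op i j u)"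
      unfolding of_bool diff_eq_eq .
    then show ?thesis by (simp add: algebra_simps split del: if_split)
  qed
qed

lemma submod_iff: "so.submod K \<longleftrightarrow> submodule sM L \<rho> M K"
proof
  assume K: "so.submod K"
  have KM: "u \<in> M" if "u \<in> K" for u using so.submod_subset[OF K] that by blast
  \<comment> \<open>Membership in \<open>L\<close> is carried through the induction, because \<rho>
    is linear in x only there.\<close>
  have "x \<in> L \<and> \<rho> x u \<in> K" if x: "x \<in> L" and u: "u \<in> K" for x u
    using x[unfolded L_span]
  proof (induction rule: LL.span_induct_alt)
    case base
    have "\<rho> (sL 0 0) u = sM 0 (\<rho> 0 u)"
      by (rule act_scale_left) (use LL.subspace_0[OF sub_L] KM[OF u] in auto)
    then show ?case using subspace_0[OF so.submod_subspace[OF K]] LL.subspace_0[OF sub_L] by simp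
  next
    case (step c x y)
    then obtain i j where ij: "x = g i j" "i \<in> {1..N}" "j \<in> {1..N}" by blast
    have xL: "x \<in> L" and yL: "y \<in> L" using g_in_L ij step by simp_all
    have "\<rho> x u \<in> K" using so.submod_E[OF K ij(2,3) u] op_on_M[OF ij(2,3) KM[OF u]] ij(1) by simp
    moreover have "\<rho> (sL c x + y) u = sM c (\<rho> x u) + \<rho> y u"
      using xL yL KM[OF u] LL.subspace_scale[OF sub_L] by (simp add: act_add_left act_scale_left)
    ultimately show ?case
      using step xL yL so.submod_subspace[OF K] LL.subspace_scale[OF sub_L] LL.subspace_add[OF sub_L]
      by (simp add: subspace_add subspace_scale)
  qed
  then show "submodule sM L \<rho> M K"
    using so.submod_subspace[OF K] so.submod_subset[OF K] unfolding submodule_def by blast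
next
  assume K: "submodule sM L \<rho> M K"
  show "so.submod K"
    unfolding so.submod_def
  proof (intro conjI ballI)
    fix i j u assume ij: "i \<in> {1..N}" "j \<in> {1..N}" and u: "u \<in> K"
    have "u \<in> M" using K u unfolding submodule_def by blast
    then show "op i j u \<in> K" using K u g_in_L[OF ij] op_on_M[OF ij] unfolding submodule_def by simp
  qed (use K in \<open>auto simp: submodule_def\<close>)
qed

lemma irr_iff: "so.irr K \<longleftrightarrow> submodule sM L \<rho> M K \<and> irreducible_module sM L \<rho> K"
proof -
  have "submodule sM L \<rho> K K' \<longleftrightarrow> so.submod K' \<and> K' \<subseteq> K" if "so.submod K" for K'
    using so.submod_subset[OF that] unfolding submod_iff by (auto simp: submodule_def)
  then show ?thesis
    unfolding so.irr_def irreducible_module_def submod_iff[symmetric] by blast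
qed

lemma completely_reducible_if_pluecker:
  assumes "\<And>i j k l u. i \<in> {1..N} \<Longrightarrow> j \<in> {1..N} \<Longrightarrow> k \<in> {1..N} \<Longrightarrow> l \<in> {1..N} \<Longrightarrow>
    distinct [i, j, k, l] \<Longrightarrow> so.pl i j k l u = 0"
  shows "completely_reducible sM L \<rho> M"
proof -
  interpret pluecker_rep sM N op M
    by unfold_locales (use assms in \<open>simp add: so.pl_def\<close>)
  obtain F where "\<forall>K\<in>F. so.irr K" "span (\<Union>F) = M" "\<forall>K\<in>F. K \<inter> span (\<Union>(F - {K})) = {0}"
    using so.direct_sum_of_irr[OF span_irr] by blast
  then show ?thesis unfolding completely_reducible_def irr_iff by blast
qed

end

section \<open>Weight vectors for the full Cartan subalgebra\<close>

context so_rep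
begin

text \<open>The conditions on a highest weight vector of weight \<open>\<alpha>\<close> in terms of the basis \<open>e_ij\<close>:
  \<open>H_k\<close> is \<open>- \<i> E (2k-1) (2k)\<close>, and the root vectors for \<open>\<epsilon>_k \<plusminus> \<epsilon>_l\<close> and \<open>\<epsilon>_k\<close> span the
  operators \<open>E (2k-1) c + \<i> E (2k) c\<close> with \<open>c > 2k\<close>.\<close>

definition weight_vector :: "(nat \<Rightarrow> complex) \<Rightarrow> 'm \<Rightarrow> bool" where
  "weight_vector \<alpha> v \<longleftrightarrow> v \<in> M \<and> v \<noteq> 0 \<and>
    (\<forall>k\<in>{1..N div 2}. E (2 * k - 1) (2 * k) v = scale (\<i> * \<alpha> k) v) \<and>
    (\<forall>k\<ge>1. \<forall>c\<in>{2 * k + 1..N}. E (2 * k - 1) c v + scale \<i> (E (2 * k) c v) = 0)"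

lemma weight_vector_R:
  assumes v: "weight_vector \<alpha> v" and c: "c \<in> {3..N}"
  shows "R c v = 0"
proof -
  have 1: "2 * 1 = (2 :: nat)" "2 - 1 = (1 :: nat)" by simp_all
  have "c \<in> {2 * 1 + 1..N}" using c by simp
  then have "E (2 * 1 - 1) c v + scale \<i> (E (2 * 1) c v) = 0"
    using v unfolding weight_vector_def by blast
  then show ?thesis unfolding 1 R_def .
qed

lemma weight_vector_H:
  assumes v: "weight_vector \<alpha> v"
  shows "H v = scale (\<alpha> 1) v"
proof -
  have "1 \<in> {1..N div 2}" using N3 by simp
  then have "E (2 * 1 - 1) (2 * 1) v = scale (\<i> * \<alpha> 1) v"
    using v unfolding weight_vector_def by blast
  moreover have "2 * 1 - 1 = (1 :: nat)" "2 * 1 = (2 :: nat)" by simp_all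
  ultimately have "E 1 2 v = scale (\<i> * \<alpha> 1) v" by (simp only:)
  then show ?thesis by (simp add: H_def)
qed

text \<open>For c < d the index c lies in a plane k >= 2 of weight 0. Either d is its partner 2k,
  and the weight gives the claim, or d > 2k, and \<open>tail_zero\<close> applies to this
  plane.\<close>

lemma weight_vector_tail_zero:
  assumes v: "weight_vector \<alpha> v" and \<alpha>: "\<And>k. k \<in> {2..N div 2} \<Longrightarrow> \<alpha> k = 0"
    and cd: "c \<in> {3..N}" "d \<in> {3..N}"
  shows "E c d v = 0"
proof -
  have lt: "E c d v = 0" if cd: "c \<in> {3..N}" "d \<in> {3..N}" "c < d" for c d
  proof -
    define k where "k = (c + 1) div 2"
    have k: "c = 2 * k - 1 \<or> c = 2 * k" "2 \<le> k" "2 * k \<le> N" "2 * k \<le> d"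
      using cd unfolding k_def by auto
    have kk: "k \<in> {2..N div 2}" "k \<in> {1..N div 2}" using k by auto
    have H: "E (2 * k - 1) (2 * k) v = 0"
      using v \<alpha>[OF kk(1)] kk(2) unfolding weight_vector_def by simp
    show ?thesis
    proof (cases "d = 2 * k")
      case True
      then have "c = 2 * k - 1" using k(1) cd by auto
      then show ?thesis using H True by simp
    next
      case False
      then have d: "2 * k < d" using k by simp
      have "E (2 * k - 1) d v + scale \<i> (E (2 * k) d v) = 0"
        using v k d cd unfolding weight_vector_def by auto
      then have "E (2 * k - 1) d v = 0 \<and> E (2 * k) d v = 0"
        using v k d cd H by (intro tail_zero) (auto simp: weight_vector_def)
      then show ?thesis using k(1) by blast
    qed
  qed
  have I: "c \<in> {1..N}" "d \<in> {1..N}" using cd by auto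
  consider "c < d" | "c = d" | "d < c" by linarith
  then show ?thesis
  proof cases
    case 3
    then show ?thesis using lt[of d c] cd E_anti[OF I(2,1), of v] by simp
  qed (use lt cd I in \<open>auto simp: E_same\<close>)
qed

lemma weight_vector_pl:
  assumes "weight_vector \<alpha> v" "\<And>k. k \<in> {2..N div 2} \<Longrightarrow> \<alpha> k = 0"
    and "i \<in> {1..N}" "j \<in> {1..N}" "k \<in> {1..N}" "l \<in> {1..N}" "distinct [i, j, k, l]"
  shows "pl i j k l v = 0"
  by (rule pl_highest[OF weight_vector_R[OF assms(1)] weight_vector_tail_zero[OF assms(1,2)] assms(3-)])

end

lemma (in pluecker_rep) weight_vector_weights:
  assumes N4: "4 \<le> N" and v: "weight_vector \<alpha> v"
  shows "\<exists>t::nat. \<alpha> 1 = of_nat t" and "k \<in> {2..N div 2} \<Longrightarrow> \<alpha> k = 0"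
proof -
  have h: "highest (\<alpha> 1) v"
    using v weight_vector_R[OF v] weight_vector_H[OF v]
    by (intro highestI) (auto simp: weight_vector_def)
  show "\<exists>t::nat. \<alpha> 1 = of_nat t" by (rule highest_vector_nat[OF N4 h])
  assume k: "k \<in> {2..N div 2}"
  then have "2 * k - 1 \<in> {3..N}" "2 * k \<in> {3..N}" "k \<in> {1..N div 2}" by auto
  then have "E (2 * k - 1) (2 * k) v = 0" "E (2 * k - 1) (2 * k) v = scale (\<i> * \<alpha> k) v"
    using h v unfolding highest_def weight_vector_def by blast+
  then have "scale (\<i> * \<alpha> k) v = 0" by simp
  then show "\<alpha> k = 0" using v by (simp add: weight_vector_def)
qed

section \<open>Modules over so(n+1) viewed as modules over the basic Lie algebra\<close>

locale vp_so_module = vector_products_algebra scale n br e + W: complex_space sM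
  for scale :: "complex \<Rightarrow> 'a::ab_group_add \<Rightarrow> 'a" and n br e
    and sM :: "complex \<Rightarrow> 'm::ab_group_add \<Rightarrow> 'm" +
  fixes M :: "'m set" and \<rho> :: "(cpoly \<Rightarrow> cpoly) \<Rightarrow> 'm \<Rightarrow> 'm"
  assumes n2: "2 \<le> n"
    and so_lie: "so_module (n + 1) sM M \<rho>"
    and fin: "finite_dim sM M"
begin

lemma so_alg_span_all: "so_alg (n + 1) = oscale.span {so_gen i j | i j. i \<in> {1..n+1} \<and> j \<in> {1..n+1}}"
proof
  show "so_alg (n + 1) \<subseteq> oscale.span {so_gen i j | i j. i \<in> {1..n+1} \<and> j \<in> {1..n+1}}"
    unfolding so_alg_def by (intro oscale.span_mono subsetI, clarify, intro exI conjI, rule refl) auto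
  show "oscale.span {so_gen i j | i j. i \<in> {1..n+1} \<and> j \<in> {1..n+1}} \<subseteq> so_alg (n + 1)"
    by (intro oscale.span_minimal so_alg_subspace) (auto intro: so_gen_in_so_alg)
qed

sublocale rep: so_lie_module sM oscale "so_alg (n + 1)" commutator M \<rho> "n + 1" so_gen
  by unfold_locales
    (use n2 so_lie fin in \<open>auto simp: so_alg_span_all so_gen_anti[symmetric] commutator_so_gen\<close>)

lemma vp_iso_in_so_alg:
  assumes "x \<in> basic_Lie scale n"
  shows "vp_iso scale n e x \<in> so_alg (n + 1)"
  unfolding vp_iso_def
  by (intro oscale.subspace_sum so_alg_subspace)
    (auto intro!: oscale.subspace_scale so_alg_subspace so_gen_in_so_alg)

lemma so_alg_linear:
  assumes "x \<in> so_alg (n + 1)"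
  shows "x (p + q) = x p + x q \<and> x (Poly_Mapping.single 0 c * p) = Poly_Mapping.single 0 c * x p"
  using assms unfolding so_alg_def
proof (induction rule: oscale.span_induct_alt)
  case (step d y z)
  then obtain i j where "y = so_gen i j" by blast
  then show ?case using step by (simp add: oscale_def so_gen_linear distrib_left mult.left_commute)
qed simp

lemma commutator_left_linear:
  assumes "y \<in> so_alg (n + 1)"
  shows "commutator (oscale c x + x') y = oscale c (commutator x y) + commutator x' y"
  using so_alg_linear[OF assms]
  by (simp add: commutator_def fun_eq_iff oscale_def right_diff_distrib)

lemma commutator_right_linear:
  assumes "x \<in> so_alg (n + 1)"
  shows "commutator x (oscale c y + y') = oscale c (commutator x y) + commutator x y'"
  using so_alg_linear[OF assms]
  by (simp add: commutator_def fun_eq_iff oscale_def right_diff_distrib)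

text \<open>Both sides are bilinear, so the generators suffice, where the structure constants agree.
  Membership in the basic Lie algebra is part of the induction because the linearity of
  \<open>vp_iso\<close> is available only there.\<close>

lemma vp_iso_bracket:
  assumes x: "x \<in> basic_Lie scale n" and y: "y \<in> basic_Lie scale n"
  shows "basic_bracket scale n br x y \<in> basic_Lie scale n \<and>
    vp_iso scale n e (basic_bracket scale n br x y) = commutator (vp_iso scale n e x) (vp_iso scale n e y)"
proof -
  have n: "1 \<le> n" using n2 by simp
  let ?L = "basic_Lie scale n" and ?b = "basic_bracket scale n br" and ?v = "vp_iso scale n e"
  note sL = ext_power_subspace[of "n - 1"]
  note lin = vp_iso_linear[OF n]
  note m = so_wedge_in_ext_power
  have lin2: "?v (fscale c a + b) = oscale c (?v a) + ?v b" if "a \<in> ?L" "b \<in> ?L" for a b c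
    using that lin(1)[of "fscale c a" b] lin(2)[of a a c] fscale.subspace_scale[OF sL] by simp
  have v0: "?v 0 = 0" using lin(2)[of 0 0 0] fscale.subspace_0[OF sL] by simp
  have bb: "?b (so_wedge i j) (so_wedge k l) \<in> ?L \<and>
      ?v (?b (so_wedge i j) (so_wedge k l)) = commutator (so_gen i j) (so_gen k l)"
    if I: "i \<in> {1..n+1}" "j \<in> {1..n+1}" "k \<in> {1..n+1}" "l \<in> {1..n+1}" for i j k l
  proof -
    have s: "fscale c (so_wedge a b) \<in> ?L" "?v (fscale c (so_wedge a b)) = oscale c (so_gen a b)"
      if "a \<in> {1..n+1}" "b \<in> {1..n+1}" for a b c
      using lin(2)[OF m m, of a b a b c] that vp_iso_so_wedge[OF n that] fscale.subspace_scale[OF sL m] by auto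
    have d: "?v (a - b) = ?v a - ?v b" if "a \<in> ?L" "b \<in> ?L" for a b
      using lin2[OF that(2,1), of "- 1"] by simp
    show ?thesis
      unfolding so_wedge_bracket[OF n I] commutator_so_gen
      using s I by (simp add: fscale.subspace_add[OF sL] fscale.subspace_diff[OF sL] lin(1) d)
  qed
  have 1: "y \<in> ?L \<and> ?b (so_wedge i j) y \<in> ?L \<and> ?v (?b (so_wedge i j) y) = commutator (so_gen i j) (?v y)"
    if I: "i \<in> {1..n+1}" "j \<in> {1..n+1}" for i j
    using y[unfolded ext_power_span[OF n]]
  proof (induction rule: fscale.span_induct_alt)
    case base
    have "?b (so_wedge i j) 0 = 0"
      using basic_bracket_right_linear[OF n m[OF I] fscale.subspace_0[OF sL] fscale.subspace_0[OF sL], of 1] by simp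
    moreover have "commutator (so_gen i j) 0 = 0"
      using commutator_right_linear[OF so_gen_in_so_alg[OF I], of 1 0 0] by simp
    ultimately show ?case by (simp only: v0 fscale.subspace_0[OF sL] simp_thms)
  next
    case (step c y z)
    then obtain k l where kl: "y = so_wedge k l" "k \<in> {1..n+1}" "l \<in> {1..n+1}" by force
    have yL: "y \<in> ?L" and zL: "z \<in> ?L" using m kl step(2) by simp_all
    have eq: "?b (so_wedge i j) (fscale c y + z) = fscale c (?b (so_wedge i j) y) + ?b (so_wedge i j) z"
      by (rule basic_bracket_right_linear[OF n m[OF I] yL zL])
    have bz: "?b (so_wedge i j) z \<in> ?L" "?v (?b (so_wedge i j) z) = commutator (so_gen i j) (?v z)"
      using step(2) by simp_all
    have yb: "?b (so_wedge i j) y \<in> ?L" "?v (?b (so_wedge i j) y) = commutator (so_gen i j) (?v y)"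
      using bb[OF I kl(2,3)] vp_iso_so_wedge[OF n kl(2,3)] unfolding kl(1) by simp_all
    show ?case
      unfolding eq lin2[OF yL zL] lin2[OF yb(1) bz(1)] commutator_right_linear[OF so_gen_in_so_alg[OF I]] yb(2) bz(2)
      by (intro conjI refl fscale.subspace_add[OF sL] fscale.subspace_scale[OF sL] yL zL yb(1) bz(1))
  qed
  have "x \<in> ?L \<and> ?b x y \<in> ?L \<and> ?v (?b x y) = commutator (?v x) (?v y)"
    using x[unfolded ext_power_span[OF n]]
  proof (induction rule: fscale.span_induct_alt)
    case base
    have "?b 0 y = 0" by (simp add: basic_bracket_def fun_eq_iff)
    moreover have "commutator 0 (?v y) = 0"
      using commutator_left_linear[OF vp_iso_in_so_alg[OF y], of 1 0 0] by simp
    ultimately show ?case by (simp only: v0 fscale.subspace_0[OF sL] simp_thms)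
  next
    case (step c x z)
    then obtain k l where kl: "x = so_wedge k l" "k \<in> {1..n+1}" "l \<in> {1..n+1}" by force
    have xL: "x \<in> ?L" and zL: "z \<in> ?L" using m kl step(2) by simp_all
    have bz: "?b z y \<in> ?L" "?v (?b z y) = commutator (?v z) (?v y)"
      using step(2) by simp_all
    have xb: "?b x y \<in> ?L" "?v (?b x y) = commutator (?v x) (?v y)"
      using 1[OF kl(2,3)] vp_iso_so_wedge[OF n kl(2,3)] unfolding kl(1) by simp_all
    show ?case
      unfolding basic_bracket_left_linear lin2[OF xL zL] lin2[OF xb(1) bz(1)]
        commutator_left_linear[OF vp_iso_in_so_alg[OF y]] xb(2) bz(2)
      by (intro conjI refl fscale.subspace_add[OF sL] fscale.subspace_scale[OF sL] xL zL xb(1) bz(1))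
  qed
  then show ?thesis by blast
qed

sublocale pull: basic_Lie_module scale n br e sM M "\<lambda>x. \<rho> (vp_iso scale n e x)"
proof unfold_locales
  have n: "1 \<le> n" using n2 by simp
  show "2 \<le> n" by (rule n2)
  show "lie_module fscale (basic_Lie scale n) (basic_bracket scale n br) sM M (\<lambda>x. \<rho> (vp_iso scale n e x))"
    unfolding lie_module_def
    by (auto simp: rep.sub_M rep.act_M rep.act_add_right rep.act_scale_right rep.act_add_left rep.act_scale_left
      rep.act_bracket vp_iso_in_so_alg vp_iso_linear[OF n] vp_iso_bracket)
qed

lemma so_can_be_prolonged_iff:
  "so_can_be_prolonged scale n br e sM M \<rho> \<longleftrightarrow>
    (\<forall>i\<in>{1..n+1}. \<forall>j\<in>{1..n+1}. \<forall>k\<in>{1..n+1}. \<forall>l\<in>{1..n+1}. distinct [i, j, k, l] \<longrightarrow>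
      (\<forall>u\<in>M. rep.so.pl i j k l u = 0))"
proof -
  have n: "1 \<le> n" using n2 by simp
  have "pull.pluecker_op i j k l u = rep.so.pl i j k l u"
    if I: "i \<in> {1..n+1}" "j \<in> {1..n+1}" "k \<in> {1..n+1}" "l \<in> {1..n+1}" and u: "u \<in> M" for i j k l u
  proof -
    have e: "\<rho> (vp_iso scale n e (so_wedge a b)) w = rep.op a b w"
      if "a \<in> {1..n+1}" "b \<in> {1..n+1}" "w \<in> M" for a b w
      using vp_iso_so_wedge[OF n that(1,2)] rep.op_on_M that by simp
    show ?thesis
      unfolding pull.pluecker_op_def rep.so.pl_def using I u by (simp only: e rep.so.E_in_M)
  qed
  then show ?thesis unfolding pull.can_be_prolonged_iff by simp
qed

lemma pluecker_rep_if_prolonged: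
  assumes "so_can_be_prolonged scale n br e sM M \<rho>"
  shows "pluecker_rep sM (n + 1) rep.op M"
proof unfold_locales
  fix i j k l u
  assume I: "i \<in> {1..n+1}" "j \<in> {1..n+1}" "k \<in> {1..n+1}" "l \<in> {1..n+1}" and d: "distinct [i, j, k, l]"
  \<comment> \<open>The operators factor through the projection, which extends relations from
    \<open>M\<close> to the whole type.\<close>
  have op: "rep.op a b u = rep.op a b (rep.proj u)" for a b
    by (simp add: rep.op_def rep.proj)
  have "rep.so.pl i j k l (rep.proj u) = 0"
    using assms I d rep.proj(2) unfolding so_can_be_prolonged_iff by blast
  then show "rep.op i j (rep.op k l u) - rep.op i k (rep.op j l u) + rep.op i l (rep.op j k u) = 0"
    unfolding rep.so.pl_def op[symmetric] .
qed

lemma prolonged_weights: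
  assumes "so_can_be_prolonged scale n br e sM M \<rho>" and "3 \<le> n" and v: "rep.so.weight_vector \<alpha> v"
  shows "\<exists>t::nat. \<alpha> 1 = of_nat t" and "k \<in> {2..(n+1) div 2} \<Longrightarrow> \<alpha> k = 0"
proof -
  interpret p: pluecker_rep sM "n + 1" rep.op M by (rule pluecker_rep_if_prolonged[OF assms(1)])
  show "\<exists>t::nat. \<alpha> 1 = of_nat t" "k \<in> {2..(n+1) div 2} \<Longrightarrow> \<alpha> k = 0"
    using p.weight_vector_weights[OF _ v] assms(2) by auto
qed

lemma prolonged_if_generated:
  assumes v: "rep.so.weight_vector \<alpha> v" and \<alpha>: "\<And>k. k \<in> {2..(n+1) div 2} \<Longrightarrow> \<alpha> k = 0"
    and gen: "\<And>K. submodule sM (so_alg (n + 1)) \<rho> M K \<Longrightarrow> v \<in> K \<Longrightarrow> K = M"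
  shows "so_can_be_prolonged scale n br e sM M \<rho>"
proof -
  let ?Z = "{u \<in> M. \<forall>i\<in>{1..n+1}. \<forall>j\<in>{1..n+1}. \<forall>k\<in>{1..n+1}. \<forall>l\<in>{1..n+1}.
    distinct [i, j, k, l] \<longrightarrow> rep.so.pl i j k l u = 0}"
  have "v \<in> ?Z"
    using v rep.so.weight_vector_pl[OF v \<alpha>] unfolding rep.so.weight_vector_def by blast
  then have "?Z = M"
    using gen rep.so.pl_zero_set_submod unfolding rep.submod_iff by blast
  then show ?thesis unfolding so_can_be_prolonged_iff by blast
qed

lemma act_oscale_so_gen:
  assumes "u \<in> M" "i \<in> {1..n+1}" "j \<in> {1..n+1}"
  shows "\<rho> (oscale c (so_gen i j)) u = sM c (rep.op i j u)"
  using assms by (simp add: rep.act_scale_left rep.g_in_L rep.op_on_M)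

lemma act_isotropic_gen:
  assumes u: "u \<in> M" and k: "1 \<le> k" "2 * k \<le> n + 1" "c \<in> {1..n+1}"
  shows "\<rho> (isotropic_gen k c) u = rep.op (2 * k - 1) c u + sM \<i> (rep.op (2 * k) c u)"
proof -
  have I: "2 * k - 1 \<in> {1..n+1}" "2 * k \<in> {1..n+1}" using k by auto
  show ?thesis
    unfolding isotropic_gen_def using u I k(3) oscale.subspace_scale[OF so_alg_subspace so_gen_in_so_alg]
    by (simp add: rep.act_add_left rep.g_in_L act_oscale_so_gen rep.op_on_M)
qed

lemma act_cartan_H:
  assumes u: "u \<in> M" and k: "k \<in> {1..(n + 1) div 2}"
  shows "\<rho> (cartan_H k) u = sM (- \<i>) (rep.op (2 * k - 1) (2 * k) u)"
  unfolding cartan_H_def using k by (intro act_oscale_so_gen u) auto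

text \<open>The sum and difference of the root vectors for \<epsilon>_k + \<epsilon>_l and
  \<epsilon>_k - \<epsilon>_l separate the two indices of the plane l; the unpaired last index of
  odd n + 1 comes from the root \<epsilon>_k.\<close>

lemma weight_vector_if_highest_weight:
  assumes "has_highest_weight (n + 1) sM M \<rho> \<alpha>"
  obtains v where "rep.so.weight_vector \<alpha> v"
proof -
  obtain v where v: "v \<in> M" "v \<noteq> 0" "\<And>k. k \<in> {1..(n + 1) div 2} \<Longrightarrow> \<rho> (cartan_H k) v = sM (\<alpha> k) v"
    "\<And>\<beta> x. \<beta> \<in> positive_roots (n + 1) \<Longrightarrow> x \<in> root_space (n + 1) \<beta> \<Longrightarrow> \<rho> x v = 0"
    using assms unfolding has_highest_weight_def by blast
  have iso: "\<rho> (isotropic_gen k c) v = 0" if k: "1 \<le> k" and c: "c \<in> {2 * k + 1..n + 1}" for k c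
  proof (cases "c = n + 1 \<and> odd (n + 1)")
    case True
    then have "isotropic_gen k (n + 1) \<in> root_space (n + 1) (eps k)"
      using k c by (intro root_vector_odd) auto
    moreover have "eps k \<in> positive_roots (n + 1)"
      using True k c unfolding positive_roots_def by auto
    ultimately show ?thesis using v(4) True by blast
  next
    case False
    define l where "l = (c + 1) div 2"
    have l: "c = 2 * l - 1 \<or> c = 2 * l" "k < l" "2 * l \<le> n + 1"
      using c False unfolding l_def by (auto, presburger+)
    have m: "isotropic_gen k (2 * l - 1) \<in> so_alg (n + 1)" "isotropic_gen k (2 * l) \<in> so_alg (n + 1)"
      using k l by (auto intro!: isotropic_gen_in_so_alg)
    have pm: "\<rho> (isotropic_gen k (2 * l - 1)) v + sM (s * \<i>) (\<rho> (isotropic_gen k (2 * l)) v) = 0"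
      if s: "s = 1 \<or> s = - 1" for s
    proof -
      have "\<rho> (isotropic_gen k (2 * l - 1) + oscale (s * \<i>) (isotropic_gen k (2 * l))) v = 0"
        using v(4)[OF eps_plus_minus[OF k l(2,3) s] root_vector_pm[OF k l(2,3) s]] .
      then show ?thesis
        using m v(1) oscale.subspace_scale[OF so_alg_subspace m(2)]
        by (simp add: rep.act_add_left rep.act_scale_left)
    qed
    let ?a = "\<rho> (isotropic_gen k (2 * l - 1)) v" and ?b = "sM \<i> (\<rho> (isotropic_gen k (2 * l)) v)"
    have "?a + ?b = 0" "?a - ?b = 0" using pm[of 1] pm[of "- 1"] by simp_all
    then have "?a + ?a = 0" "?b = ?a" by simp_all
    then have "?a = 0" using W.scale_left_distrib[of 1 1 ?a] by simp
    then show ?thesis using \<open>?b = ?a\<close> l(1) by auto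
  qed
  have "rep.so.weight_vector \<alpha> v"
    unfolding rep.so.weight_vector_def
  proof (intro conjI ballI allI impI)
    fix k assume k: "k \<in> {1..(n + 1) div 2}"
    have "sM \<i> (sM (- \<i>) (rep.op (2 * k - 1) (2 * k) v)) = sM \<i> (sM (\<alpha> k) v)"
      using v(3)[OF k] act_cartan_H[OF v(1) k] by simp
    then show "rep.op (2 * k - 1) (2 * k) v = sM (\<i> * \<alpha> k) v" by simp
  next
    fix k c assume k: "1 \<le> k" and c: "c \<in> {2 * k + 1..n + 1}"
    then show "rep.op (2 * k - 1) c v + sM \<i> (rep.op (2 * k) c v) = 0"
      using iso[OF k c] act_isotropic_gen[OF v(1), of k c] by simp
  qed (use v in auto)
  then show thesis using that by blast
qed

lemma generated_if_irreducible:
  assumes "irreducible_module sM (so_alg (n + 1)) \<rho> M" "v \<noteq> 0"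
    "submodule sM (so_alg (n + 1)) \<rho> M K" "v \<in> K"
  shows "K = M"
  using assms unfolding irreducible_module_def by blast

end

lemma fundamental_weight_4:
  "fundamental_weight 4 1 1 = 1 / 2" "fundamental_weight 4 1 2 = - 1 / 2"
  "fundamental_weight 4 2 1 = 1 / 2" "fundamental_weight 4 2 2 = 1 / 2"
proof -
  have "{1..2::nat} = {1, 2}" by auto
  then show "fundamental_weight 4 1 1 = 1 / 2" "fundamental_weight 4 1 2 = - 1 / 2"
    "fundamental_weight 4 2 1 = 1 / 2" "fundamental_weight 4 2 2 = 1 / 2"
    by (simp_all add: fundamental_weight_def Let_def fscale_def eps_def)
qed

text \<open>From N = 5 on, the first fundamental weight is not a spin weight.\<close>

lemma fundamental_weight_1:
  assumes "5 \<le> N"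
  shows "fundamental_weight N 1 k = (if k = 1 then 1 else 0)"
proof -
  have "1 < N div 2" "even N \<Longrightarrow> 1 + 1 < N div 2" using assms by presburger+
  then show ?thesis by (simp add: fundamental_weight_def Let_def eps_def)
qed

context vector_products_algebra
begin

lemma nlie_module_completely_reducible:
  fixes sM :: "complex \<Rightarrow> 'm::ab_group_add \<Rightarrow> 'm"
  assumes "vector_space sM" and n2: "2 \<le> n" and nlie: "nlie_module scale n br sM M \<rho>" and fin: "finite_dim sM M"
  shows "completely_reducible sM (basic_Lie scale n) \<rho> M"
proof -
  interpret W: complex_space sM by (simp add: complex_space_def assms(1))
  have n: "1 \<le> n" using n2 by simp
  have span: "basic_Lie scale n = fscale.span {so_wedge i j | i j. i \<in> {1..n+1} \<and> j \<in> {1..n+1}}"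
  proof
    show "basic_Lie scale n \<subseteq> fscale.span {so_wedge i j | i j. i \<in> {1..n+1} \<and> j \<in> {1..n+1}}"
      unfolding ext_power_span[OF n] by (intro fscale.span_mono subsetI, clarify, intro exI conjI, rule refl) auto
    show "fscale.span {so_wedge i j | i j. i \<in> {1..n+1} \<and> j \<in> {1..n+1}} \<subseteq> basic_Lie scale n"
      by (intro fscale.span_minimal ext_power_subspace) (auto intro: so_wedge_in_ext_power)
  qed
  interpret basic_Lie_module scale n br e sM M \<rho>
    by unfold_locales (use nlie n2 in \<open>auto simp: nlie_module_def\<close>)
  interpret rep: so_lie_module sM fscale "basic_Lie scale n" "basic_bracket scale n br" M \<rho> "n + 1" so_wedge
  proof
    show "so_wedge j i = - so_wedge i j" for i j by (rule so_wedge_anti)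
  qed (use n2 lie fin span so_wedge_bracket[OF n] in auto)
  show ?thesis
  proof (rule rep.completely_reducible_if_pluecker)
    fix i j k l u
    assume I: "i \<in> {1..n+1}" "j \<in> {1..n+1}" "k \<in> {1..n+1}" "l \<in> {1..n+1}" and d: "distinct [i, j, k, l]"
    have "pluecker_op i j k l (rep.proj u) = 0"
      using nlie can_be_prolonged_iff I d rep.proj(2) unfolding nlie_module_def by blast
    moreover have "rep.op a b w = \<rho> (so_wedge a b) w" if "a \<in> {1..n+1}" "b \<in> {1..n+1}" "w \<in> M" for a b w
      using rep.op_on_M that by simp
    moreover have "rep.op a b u = rep.op a b (rep.proj u)" for a b
      by (simp add: rep.op_def rep.proj)
    ultimately show "rep.so.pl i j k l u = 0"
      unfolding rep.so.pl_def pluecker_op_def using I rep.proj(2) rep.so.E_in_M by metis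
  qed
qed

end

section \<open>The case of so(4), and the theorem\<close>

lemma so4_generators_in_so_alg: "E1 \<in> so_alg 4" "E2 \<in> so_alg 4" "F1 \<in> so_alg 4" "F2 \<in> so_alg 4"
proof -
  have g: "so_gen 1 3 \<in> so_alg 4" "so_gen 2 4 \<in> so_alg 4" "so_gen 2 3 \<in> so_alg 4" "so_gen 1 4 \<in> so_alg 4"
    by (auto intro!: so_gen_in_so_alg)
  note i = oscale.subspace_scale[OF so_alg_subspace] oscale.subspace_add[OF so_alg_subspace]
    oscale.subspace_diff[OF so_alg_subspace] g
  show "E1 \<in> so_alg 4" "E2 \<in> so_alg 4" "F1 \<in> so_alg 4" "F2 \<in> so_alg 4"
    unfolding E1_def E2_def F1_def F2_def by (intro i)+
qed

lemma finite_dim_tensor_module: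
  fixes sM :: "complex \<Rightarrow> 'a::ab_group_add \<Rightarrow> 'a"
  assumes "is_tensor_module t r sM M \<rho>"
  shows "finite_dim sM M"
proof -
  obtain b :: "nat \<Rightarrow> nat \<Rightarrow> 'a" where "module.span sM ((\<lambda>(k, l). b k l) ` ({0..t} \<times> {0..r})) = M"
    using assms unfolding is_tensor_module_def by blast
  moreover have "finite ((\<lambda>(k, l). b k l) ` ({0..t} \<times> {0..r}))" by (intro finite_imageI) simp
  ultimately show ?thesis unfolding finite_dim_def by blast
qed

context vp_so_module
begin

text \<open>The vector is v_0 tensor v_0. From H1 = H_1 - H_2 and H2 = H_1 + H_2 its weight is ((t +
  r)/2, (r - t)/2). The sum and difference of E1 and E2 give the raising conditions, and F1, F2
  reach the whole basis.\<close>

lemma tensor_weight_vector: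
  assumes n3: "n = 3" and tensor: "is_tensor_module t r sM M \<rho>"
  obtains v where
    "rep.so.weight_vector (\<lambda>k. if k = 1 then (of_nat t + of_nat r) / 2 else (of_nat r - of_nat t) / 2) v"
    "\<And>K. submodule sM (so_alg (n + 1)) \<rho> M K \<Longrightarrow> v \<in> K \<Longrightarrow> K = M"
proof -
  have N: "n + 1 = 4" using n3 by simp
  obtain b :: "nat \<Rightarrow> nat \<Rightarrow> 'm" where
    ind: "\<not> W.dependent ((\<lambda>(k, l). b k l) ` ({0..t} \<times> {0..r}))" and
    span: "W.span ((\<lambda>(k, l). b k l) ` ({0..t} \<times> {0..r})) = M" and
    act: "\<And>k l. k \<in> {0..t} \<Longrightarrow> l \<in> {0..r} \<Longrightarrow>
           \<rho> H1 (b k l) = sM (of_nat t - 2 * of_nat k) (b k l) \<and>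
           \<rho> E1 (b k l) = sM (of_nat (k * (t - k + 1))) (b (k - 1) l) \<and>
           \<rho> F1 (b k l) = (if k = t then 0 else b (k + 1) l) \<and>
           \<rho> H2 (b k l) = sM (of_nat r - 2 * of_nat l) (b k l) \<and>
           \<rho> E2 (b k l) = sM (of_nat (l * (r - l + 1))) (b k (l - 1)) \<and>
           \<rho> F2 (b k l) = (if l = r then 0 else b k (l + 1))"
    using tensor unfolding is_tensor_module_def by metis
  let ?v = "b 0 0"
  have vB: "?v \<in> (\<lambda>(k, l). b k l) ` ({0..t} \<times> {0..r})" by (rule image_eqI[of _ _ "(0, 0)"]) auto
  have v0: "?v \<noteq> 0" using ind W.dependent_zero vB by metis
  have vM: "?v \<in> M" using W.span_base[OF vB] span by simp
  have H: "\<rho> H1 ?v = sM (of_nat t) ?v" "\<rho> H2 ?v = sM (of_nat r) ?v" and E: "\<rho> E1 ?v = 0" "\<rho> E2 ?v = 0"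
    using act[of 0 0] by simp_all
  have g: "so_gen i j \<in> so_alg (n + 1)" if "i \<in> {1..4}" "j \<in> {1..4}" for i j
    using so_gen_in_so_alg[of i 4 j] that unfolding N by blast
  have gs: "oscale c x \<in> so_alg (n + 1)" if "x \<in> so_alg (n + 1)" for c x
    using that by (rule oscale.subspace_scale[OF so_alg_subspace])
  have gd: "x + y \<in> so_alg (n + 1)" "x - y \<in> so_alg (n + 1)"
    if "x \<in> so_alg (n + 1)" "y \<in> so_alg (n + 1)" for x y
    using that oscale.subspace_add[OF so_alg_subspace] oscale.subspace_diff[OF so_alg_subspace] by blast+
  have g4: "so_gen 1 3 \<in> so_alg (n + 1)" "so_gen 2 4 \<in> so_alg (n + 1)" "so_gen 2 3 \<in> so_alg (n + 1)"
    "so_gen 1 4 \<in> so_alg (n + 1)" "so_gen 1 2 \<in> so_alg (n + 1)" "so_gen 3 4 \<in> so_alg (n + 1)"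
    by (auto intro!: g)
  have op: "\<rho> (so_gen i j) ?v = rep.op i j ?v" if "i \<in> {1..4}" "j \<in> {1..4}" for i j
    using rep.op_on_M[of i j ?v] that vM unfolding N by simp
  note act_lin = rep.act_add_left[OF _ _ vM] rep.act_diff_left[OF _ _ vM] rep.act_scale_left[OF _ vM]
  let ?o = "\<lambda>i j. rep.op i j ?v"
  have o4: "\<rho> (so_gen 1 3) ?v = ?o 1 3" "\<rho> (so_gen 2 4) ?v = ?o 2 4" "\<rho> (so_gen 2 3) ?v = ?o 2 3"
    "\<rho> (so_gen 1 4) ?v = ?o 1 4" "\<rho> (so_gen 1 2) ?v = ?o 1 2" "\<rho> (so_gen 3 4) ?v = ?o 3 4"
    by (auto intro!: op)
  have two: "x = 0" if "x + x = 0" for x :: 'm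
    using that W.scale_left_distrib[of 1 1 x] by simp
  have e1: "sM (1/2) (?o 1 3 + ?o 2 4 + sM \<i> (?o 2 3 - ?o 1 4)) = 0"
    using E(1) unfolding E1_def by (simp only: act_lin g4 gs gd o4)
  have e2: "sM (1/2) (?o 1 3 - ?o 2 4 + sM \<i> (?o 2 3 + ?o 1 4)) = 0"
    using E(2) unfolding E2_def by (simp only: act_lin g4 gs gd o4)
  have p: "?o 1 3 + ?o 2 4 + sM \<i> (?o 2 3) - sM \<i> (?o 1 4) = 0"
    "?o 1 3 - ?o 2 4 + sM \<i> (?o 2 3) + sM \<i> (?o 1 4) = 0"
    using e1 e2 unfolding W.scale_eq_0_iff by (simp_all add: W.scale_right_distrib W.scale_right_diff_distrib algebra_simps)
  have "(?o 1 3 + sM \<i> (?o 2 3)) + (?o 1 3 + sM \<i> (?o 2 3))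
      = (?o 1 3 + ?o 2 4 + sM \<i> (?o 2 3) - sM \<i> (?o 1 4)) + (?o 1 3 - ?o 2 4 + sM \<i> (?o 2 3) + sM \<i> (?o 1 4))"
    by (simp add: algebra_simps)
  \<comment> \<open>E1 + E2 contains only the indices c = 3, and E1 - E2 below only c = 4.\<close>
  then have r3: "?o 1 3 + sM \<i> (?o 2 3) = 0" unfolding p add_0_left diff_self by (rule two)
  have "(?o 2 4 - sM \<i> (?o 1 4)) + (?o 2 4 - sM \<i> (?o 1 4))
      = (?o 1 3 + ?o 2 4 + sM \<i> (?o 2 3) - sM \<i> (?o 1 4)) - (?o 1 3 - ?o 2 4 + sM \<i> (?o 2 3) + sM \<i> (?o 1 4))"
    by (simp add: algebra_simps)
  then have "?o 2 4 - sM \<i> (?o 1 4) = 0" unfolding p add_0_left diff_self by (rule two)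
  then have "sM \<i> (?o 2 4 - sM \<i> (?o 1 4)) = 0" by simp
  then have r4: "?o 1 4 + sM \<i> (?o 2 4) = 0" by (simp add: W.scale_right_diff_distrib algebra_simps)
  have c: "cartan_H 1 = oscale (- \<i>) (so_gen 1 2)" "cartan_H 2 = oscale (- \<i>) (so_gen 3 4)"
    by (simp_all add: cartan_H_def One_nat_def)
  have h1: "sM (- \<i>) (?o 1 2) - sM (- \<i>) (?o 3 4) = sM (of_nat t) ?v"
    using H(1) unfolding H1_def c by (simp only: act_lin g4 gs gd o4)
  have h2: "sM (- \<i>) (?o 1 2) + sM (- \<i>) (?o 3 4) = sM (of_nat r) ?v"
    using H(2) unfolding H2_def c by (simp only: act_lin g4 gs gd o4)
  have half: "sM \<i> (sM (1/2) ((x + y) + (x - y))) = sM \<i> x" "sM \<i> (sM (1/2) ((x + y) - (x - y))) = sM \<i> y" for x y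
  proof -
    have "(x + y) + (x - y) = sM 2 x" "(x + y) - (x - y) = sM 2 y"
      using W.scale_left_distrib[of 1 1] by (simp_all add: algebra_simps)
    then show "sM \<i> (sM (1/2) ((x + y) + (x - y))) = sM \<i> x" "sM \<i> (sM (1/2) ((x + y) - (x - y))) = sM \<i> y"
      by simp_all
  qed
  have o12: "?o 1 2 = sM (\<i> * ((of_nat t + of_nat r) / 2)) ?v"
    using half(1)[of "sM (- \<i>) (?o 1 2)" "sM (- \<i>) (?o 3 4)"] unfolding h1 h2
    by (simp flip: W.scale_left_distrib add: add.commute)
  have o34: "?o 3 4 = sM (\<i> * ((of_nat r - of_nat t) / 2)) ?v"
    using half(2)[of "sM (- \<i>) (?o 1 2)" "sM (- \<i>) (?o 3 4)"] unfolding h1 h2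
    by (simp flip: W.scale_left_diff_distrib)
  let ?\<alpha> = "\<lambda>k::nat. if k = 1 then (of_nat t + of_nat r) / 2 else (of_nat r - of_nat t) / 2 :: complex"
  have wv: "rep.so.weight_vector ?\<alpha> ?v"
    unfolding rep.so.weight_vector_def
  proof (intro conjI ballI allI impI vM v0)
    fix k :: nat assume "k \<in> {1..(n + 1) div 2}"
    then have "k = 1 \<or> k = 2" unfolding N by auto
    then show "rep.op (2 * k - 1) (2 * k) ?v = sM (\<i> * ?\<alpha> k) ?v"
      using o12 o34 by (auto simp: One_nat_def)
  next
    fix k c :: nat assume "1 \<le> k" "c \<in> {2 * k + 1..n + 1}"
    then have "k = 1" "c = 3 \<or> c = 4" unfolding N by auto
    then show "rep.op (2 * k - 1) c ?v + sM \<i> (rep.op (2 * k) c ?v) = 0"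
      using r3 r4 by (auto simp: One_nat_def)
  qed
  have gen: "K = M" if K: "submodule sM (so_alg (n + 1)) \<rho> M K" and vK: "?v \<in> K" for K
  proof -
    have F: "\<rho> F1 u \<in> K" "\<rho> F2 u \<in> K" if "u \<in> K" for u
      using K that so4_generators_in_so_alg unfolding submodule_def N by blast+
    have k0: "b k 0 \<in> K" if "k \<le> t" for k
      using that
    proof (induction k)
      case (Suc k)
      then show ?case using F(1)[of "b k 0"] act[of k 0] by (simp flip: Suc_eq_plus1)
    qed (use vK in simp)
    have kl: "b k l \<in> K" if "k \<le> t" "l \<le> r" for k l
      using that(2)
    proof (induction l)
      case (Suc l)
      then show ?case using F(2)[of "b k l"] act[of k l] that(1) by (simp flip: Suc_eq_plus1)
    qed (use k0 that in simp)
    have "M \<subseteq> K"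
      unfolding span[symmetric] using K kl unfolding submodule_def by (intro W.span_minimal) auto
    then show "K = M" using K unfolding submodule_def by blast
  qed
  show thesis using that wv gen by blast
qed

text \<open>For so(4) the only weight beyond the first is (r - t)/2, and prolongation amounts to its
  vanishing. Both descriptions of the module provide a weight vector that generates it.\<close>

lemma so4_prolonged_iff:
  assumes n3: "n = 3"
    and M: "irreducible_module sM (so_alg 4) \<rho> M \<and>
              has_highest_weight 4 sM M \<rho>
                (fscale (of_nat t) (fundamental_weight 4 1) + fscale (of_nat r) (fundamental_weight 4 2))
            \<or> is_tensor_module t r sM M \<rho>"
  shows "so_can_be_prolonged scale n br e sM M \<rho> \<longleftrightarrow> t = r"
proof -
  have N: "n + 1 = 4" using n3 by simp
  obtain v \<alpha> where v: "rep.so.weight_vector \<alpha> v" "\<alpha> 2 = (of_nat r - of_nat t) / 2"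
    "\<And>K. submodule sM (so_alg (n + 1)) \<rho> M K \<Longrightarrow> v \<in> K \<Longrightarrow> K = M"
  proof (cases "is_tensor_module t r sM M \<rho>")
    case True
    obtain v where
      "rep.so.weight_vector (\<lambda>k. if k = 1 then (of_nat t + of_nat r) / 2 else (of_nat r - of_nat t) / 2) v"
      "\<And>K. submodule sM (so_alg (n + 1)) \<rho> M K \<Longrightarrow> v \<in> K \<Longrightarrow> K = M"
      using tensor_weight_vector[OF n3 True] by blast
    moreover have "(if 2 = (1 :: nat) then (of_nat t + of_nat r) / 2 else (of_nat r - of_nat t) / 2)
        = ((of_nat r - of_nat t) / 2 :: complex)"
      by simp
    ultimately show thesis by (intro that)
  next
    case False
    let ?\<alpha> = "fscale (of_nat t) (fundamental_weight 4 1) + fscale (of_nat r) (fundamental_weight 4 2)"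
    have irr: "irreducible_module sM (so_alg (n + 1)) \<rho> M" and hw: "has_highest_weight (n + 1) sM M \<rho> ?\<alpha>"
      using M False unfolding N by blast+
    obtain v where v: "rep.so.weight_vector ?\<alpha> v" using weight_vector_if_highest_weight[OF hw] by blast
    have "?\<alpha> 2 = (of_nat r - of_nat t) / 2"
      by (simp add: fscale_def fundamental_weight_4 field_simps)
    moreover have "v \<noteq> 0" using v by (simp add: rep.so.weight_vector_def)
    then have "K = M" if "submodule sM (so_alg (n + 1)) \<rho> M K" "v \<in> K" for K
      using generated_if_irreducible[OF irr] that by blast
    ultimately show thesis by (intro that[OF v])
  qed
  have two: "2 \<in> {2..(n + 1) div 2}" "k \<in> {2..(n + 1) div 2} \<Longrightarrow> k = 2" for k unfolding N by auto
  show ?thesis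
  proof
    assume "so_can_be_prolonged scale n br e sM M \<rho>"
    then have "\<alpha> 2 = 0" using prolonged_weights(2)[OF _ _ v(1) two(1)] n3 by simp
    then show "t = r" using v(2) by simp
  next
    assume "t = r"
    then have "\<alpha> k = 0" if "k \<in> {2..(n + 1) div 2}" for k using two(2)[OF that] v(2) by simp
    then show "so_can_be_prolonged scale n br e sM M \<rho>"
      using prolonged_if_generated[OF v(1) _ v(3)] by blast
  qed
qed

lemma so_prolonged_iff:
  assumes n4: "n > 3" and irr: "irreducible_module sM (so_alg (n + 1)) \<rho> M"
    and hw: "has_highest_weight (n + 1) sM M \<rho> \<alpha>"
  shows "so_can_be_prolonged scale n br e sM M \<rho> \<longleftrightarrow>
    (\<exists>t::nat. \<forall>k\<in>{1..(n + 1) div 2}. \<alpha> k = of_nat t * fundamental_weight (n + 1) 1 k)"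
proof -
  obtain v where v: "rep.so.weight_vector \<alpha> v" using weight_vector_if_highest_weight[OF hw] by blast
  have fw: "fundamental_weight (n + 1) 1 k = (if k = 1 then 1 else 0)" for k
    using n4 by (intro fundamental_weight_1) simp
  show ?thesis
    unfolding fw
  proof
    assume p: "so_can_be_prolonged scale n br e sM M \<rho>"
    have n3: "3 \<le> n" using n4 by simp
    obtain t :: nat where t: "\<alpha> 1 = of_nat t" using prolonged_weights(1)[OF p n3 v] ..
    have "\<alpha> k = of_nat t * (if k = 1 then 1 else 0)" if "k \<in> {1..(n + 1) div 2}" for k
    proof (cases "k = 1")
      case False
      then have "k \<in> {2..(n + 1) div 2}" using that by auto
      then show ?thesis using prolonged_weights(2)[OF p n3 v] False by simp
    qed (simp add: t)
    then show "\<exists>t::nat. \<forall>k\<in>{1..(n + 1) div 2}. \<alpha> k = of_nat t * (if k = 1 then 1 else 0)" by blast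
  next
    assume "\<exists>t::nat. \<forall>k\<in>{1..(n + 1) div 2}. \<alpha> k = of_nat t * (if k = 1 then 1 else 0)"
    then have "\<alpha> k = 0" if "k \<in> {2..(n + 1) div 2}" for k using that by auto
    moreover have "v \<noteq> 0" using v by (simp add: rep.so.weight_vector_def)
    ultimately show "so_can_be_prolonged scale n br e sM M \<rho>"
      using prolonged_if_generated[OF v] generated_if_irreducible[OF irr] by blast
  qed
qed

end

theorem theorem1p1:
  fixes sV :: "complex \<Rightarrow> 'v::ab_group_add \<Rightarrow> 'v"
    and n :: nat
    and br :: "'v list \<Rightarrow> 'v"
    and e :: "nat \<Rightarrow> 'v"
    and sM :: "complex \<Rightarrow> 'm::ab_group_add \<Rightarrow> 'm"
  assumes "vector_products_algebra sV n br e"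
    and "vector_space sM"
  shows
    "(n \<ge> 2 \<longrightarrow>
        (\<forall>M \<rho>. nlie_module sV n br sM M \<rho> \<and> finite_dim sM M \<longrightarrow>
           completely_reducible sM (basic_Lie sV n) \<rho> M)) \<and>
     (n = 3 \<longrightarrow>
        (\<forall>(t::nat) (r::nat) M \<rho>.
           so_module 4 sM M \<rho> \<and>
           (finite_dim sM M \<and> irreducible_module sM (so_alg 4) \<rho> M \<and>
              has_highest_weight 4 sM M \<rho>
                (fscale (of_nat t) (fundamental_weight 4 1) + fscale (of_nat r) (fundamental_weight 4 2))
            \<or> is_tensor_module t r sM M \<rho>) \<longrightarrow>
           (so_can_be_prolonged sV n br e sM M \<rho> \<longleftrightarrow> t = r))) \<and>
     (n > 3 \<longrightarrow>
        (\<forall>M \<rho> \<alpha>.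
           so_module (n + 1) sM M \<rho> \<and> finite_dim sM M \<and>
           irreducible_module sM (so_alg (n + 1)) \<rho> M \<and>
           has_highest_weight (n + 1) sM M \<rho> \<alpha> \<longrightarrow>
           (so_can_be_prolonged sV n br e sM M \<rho> \<longleftrightarrow>
            (\<exists>t::nat. \<forall>k\<in>{1..(n + 1) div 2}. \<alpha> k = of_nat t * fundamental_weight (n + 1) 1 k))))"
proof (intro conjI impI allI)
  interpret V: vector_products_algebra sV n br e by fact
  fix M \<rho>
  assume "n \<ge> 2" "nlie_module sV n br sM M \<rho> \<and> finite_dim sM M"
  then show "completely_reducible sM (basic_Lie sV n) \<rho> M"
    using V.nlie_module_completely_reducible[OF assms(2)] by blast
next
  fix t r :: nat and M \<rho>
  assume n3: "n = 3" and a: "so_module 4 sM M \<rho> \<and>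
           (finite_dim sM M \<and> irreducible_module sM (so_alg 4) \<rho> M \<and>
              has_highest_weight 4 sM M \<rho>
                (fscale (of_nat t) (fundamental_weight 4 1) + fscale (of_nat r) (fundamental_weight 4 2))
            \<or> is_tensor_module t r sM M \<rho>)"
  have "finite_dim sM M" using a finite_dim_tensor_module by blast
  then have "vp_so_module sV n br e sM M \<rho>"
    using assms a n3 by (simp add: vp_so_module_def vp_so_module_axioms_def complex_space_def)
  then show "so_can_be_prolonged sV n br e sM M \<rho> \<longleftrightarrow> t = r"
    using vp_so_module.so4_prolonged_iff[OF _ n3] a by blast
next
  fix M \<rho> \<alpha>
  assume n4: "n > 3" and a: "so_module (n + 1) sM M \<rho> \<and> finite_dim sM M \<and>
           irreducible_module sM (so_alg (n + 1)) \<rho> M \<and>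
           has_highest_weight (n + 1) sM M \<rho> \<alpha>"
  then have "vp_so_module sV n br e sM M \<rho>"
    using assms by (simp add: vp_so_module_def vp_so_module_axioms_def complex_space_def)
  then show "so_can_be_prolonged sV n br e sM M \<rho> \<longleftrightarrow>
            (\<exists>t::nat. \<forall>k\<in>{1..(n + 1) div 2}. \<alpha> k = of_nat t * fundamental_weight (n + 1) 1 k)"
    using vp_so_module.so_prolonged_iff[OF _ n4] a by blast
qed

end
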